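(* Let $n\ge2$, $G=SL(n,\mathbb R)$. For $(\alpha,\beta;\varpi;\lambda,\nu)\in\{\pm\}^2\times \mathrm{Irr}(SL(n-1,\mathbb R))_{\mathrm{fin}}\times\mathbb C^2$ we have $$\mathrm{Diff}_G(I(\mathrm{triv},\lambda)^\alpha,I(\varpi,\nu)^\beta)=\begin{cases}\mathbb C\,\mathrm{id}&\text{if }(\beta,\varpi,\nu)=(\alpha,\mathrm{triv},\lambda),\\ \mathbb C\,\mathcal D_k&\text{if }(\alpha,\beta;\varpi;\lambda,\nu)\in\Lambda^n_G,\\ \{0\}&\text{otherwise,}\end{cases}$$ where in the second case $k\in\mathbb Z_{\ge0}$ is the integer with $\lambda=1-k$ and $\nu=1+\frac{k}{n-1}$, and $$\mathcal D_k=\sum_{(k_1,\dots,k_{n-1})\in\Xi_k}\frac{\partial^k}{\partial x_1^{k_1}\cdots\partial x_{n-1}^{k_{n-1}}}\otimes\frac{y_1^{k_1}\cdots y_{n-1}^{k_{n-1}}}{k_1!\cdots k_{n-1}!}\colon C^\infty(\mathbb R^{n-1})\to C^\infty(\mathbb R^{n-1})\otimes\mathbb C^k[y_1,\dots,y_{n-1}],$$ with $\mathcal D_0=\mathrm{id}$.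
   Context: Groups. Let $n\ge2$, $G=SL(n,\mathbb R)$; $E_{i,j}$ are the matrix units, $N_j^+=E_{1,j+1}$, $N_j^-=E_{j+1,1}$ for $1\le j\le n-1$, and $\widetilde H_0=\frac1{n-1}\mathrm{diag}(n-1,-1,\dots,-1)$. $P=MAN_+$ is the maximal parabolic subgroup of block upper triangular matrices in $G$ for the partition $n=1+(n-1)$ (so $G/P\cong\mathbb{RP}^{n-1}$), with $M=\{\mathrm{diag}(\det(g)^{-1},g): g\in SL^{\pm}(n-1,\mathbb R)\}\cong SL^\pm(n-1,\mathbb R)$, $A=\exp(\mathbb R\widetilde H_0)$, $N_+=\exp(\mathrm{span}_{\mathbb R}\{N_j^+\})$; put $N_-=\exp(\mathrm{span}_{\mathbb R}\{N_j^-\})$. Here $SL^\pm(m,\mathbb R)$ is the group of real $m\times m$ matrices of determinant $\pm1$; $SL^\pm(1,\mathbb R)=\{\pm1\}$ and $SL(1,\mathbb R)=\{1\}$. Representations. For $\lambda\in\mathbb C$, $\mathbb C_\lambda$ is the character $\exp(t\widetilde H_0)\mapsto e^{\lambda t}$ of $A$. For $\alpha\in\{\pm\}$, $\mathbb C_\alpha$ is the character of $M$ sending $\mathrm{diag}(\det(g)^{-1},g)$ to $1$ if $\alpha=+$ and to $\mathrm{sgn}(\det g)$ if $\alpha=-$. $\mathrm{Irr}(SL(n-1,\mathbb R))_{\mathrm{fin}}$ is the set of equivalence classes of finite-dimensional irreducible complex representations of $SL(n-1,\mathbb R)$, and $\mathrm{triv}$ is the trivial one. The irreducible finite-dimensional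 representations of $M$ are written $\mathbb C_\alpha\otimes\varpi$ with $\alpha\in\{\pm\}$ and $\varpi\in\mathrm{Irr}(SL(n-1,\mathbb R))_{\mathrm{fin}}$; for $n\ge3$ the representation $\mathrm{poly}^k_{n-1}$ below is here extended to $SL^\pm(n-1,\mathbb R)$ by the natural action on $\mathrm{Pol}^k(\mathbb C^{n-1})$ (for other $\varpi$ fix any extension). Induced representations. $I(\varpi,\lambda)^\alpha=\mathrm{Ind}_P^G((\mathbb C_\alpha\otimes\varpi)\boxtimes\mathbb C_\lambda)$ (unnormalized, $N_+$ acting trivially) is the space of smooth $f:G\to W$ ($W$ the space of $\varpi$) with $f(gp)=\tau(p)^{-1}f(g)$ for $p\in P$, where $\tau=(\mathbb C_\alpha\otimes\varpi)\boxtimes\mathbb C_\lambda\boxtimes\mathrm{triv}$, with $G$ acting by left translation; equivalently, smooth sections of the $G$-equivariant vector bundle $G\times_PW\to G/P$. $\mathrm{Diff}_G(I,I')$ denotes the space of $G$-intertwining differential operators $I\to I'$. Realization on the open cell. Restriction to $N_-$ together with the diffeomorphism $\mathbb R^{n-1}\to N_-$, $(x_1,\dots,x_{n-1})\mapsto\exp(x_1N_1^-+\cdots+x_{n-1}N_{n-1}^-)$ embeds $I(\varpi,\lambda)^\alpha$ in $C^\infty(\mathbb R^{n-1})\otimes W$. A differential operator $I(\mathrm{triv},\lambda)^\alpha\to I(\varpi,\nu)^\beta$ is identified with the corresponding differential operator $C^\infty(\mathbb R^{n-1})\to C^\infty(\mathbb R^{n-1})\otimes W$; the equalities in the claim are understood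 in this sense. Parameters. For $\alpha\in\{\pm\}\equiv\{\pm1\}$ and $k\in\mathbb Z_{\ge0}$, $\alpha+k\in\{\pm\}$ is $+$ if $\alpha=(-1)^k$ and $-$ if $\alpha=(-1)^{k+1}$. $\mathrm{poly}^k_{n-1}$ is the irreducible representation of $SL(n-1,\mathbb R)$ on $\mathrm{Pol}^k(\mathbb C^{n-1})=S^k((\mathbb C^{n-1})^\vee)=\mathbb C^k[y_1,\dots,y_{n-1}]$ (homogeneous polynomials of degree $k$ in the coordinates $y_j$ of $\mathbb C^{n-1}$) induced by the standard action on $\mathbb C^{n-1}$; $\mathrm{poly}^k_1$ is regarded as $\mathrm{triv}$ for all $k\in\mathbb Z_{\ge0}$. For $n\ge2$, $\Lambda^n_G=\{(\alpha,\alpha+k;\mathrm{poly}^k_{n-1};1-k,1+\frac{k}{n-1}):\alpha\in\{\pm\},\,k\in\mathbb Z_{\ge0}\}$. $\Xi_k=\{(k_1,\dots,k_{n-1})\in(\mathbb Z_{\ge0})^{n-1}:\sum_jk_j=k\}$.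
   Formalization: For n = 2 and odd k the sign α+k in Λ^n_G is replaced by α: the central element −1 of SL(2,ℝ) acts by α on the source and by β on the target, so with β = α+k every intertwining operator is zero, while D_k intertwines for β = α. *)

theory Defs
  imports "HOL-Analysis.Analysis"
begin

text \<open>
  The rows and columns of the matrices in $G = SL(n)$ are indexed by \<^typ>\<open>'m option\<close>:
  \<^term>\<open>None\<close> is the first index, the elements of \<^typ>\<open>'m\<close> are the remaining $n-1$ indices.
  Thus $n-1$ is \<^term>\<open>CARD('m)\<close>, an arbitrary integer $\ge 1$. The linear order on \<^typ>\<open>'m\<close>
  plays the role of the enumeration $1, \dots, n-1$. A sign is an integer $1$ or $-1$.
\<close>

section \<open>Groups\<close>

definition SL :: "(real^'n^'n) set" where
  "SL = {A. det A = 1}"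

definition SLpm :: "(real^'n^'n) set" where
  "SLpm = {A. det A = 1 \<or> det A = -1}"

definition matrix_exp :: "real^'n^'n \<Rightarrow> real^'n^'n" where
  "matrix_exp A = (\<Sum>k. inverse (fact k) *\<^sub>R (((**) A) ^^ k) (mat 1))"

definition matrix_unit :: "'n \<Rightarrow> 'n \<Rightarrow> real^'n^'n" where
  "matrix_unit i j = (\<chi> a b. if a = i \<and> b = j then 1 else 0)"

definition H0 :: "real^('m::finite option)^('m option)" where
  "H0 = (1 / real CARD('m)) *\<^sub>R
     (\<chi> a b. if a \<noteq> b then 0 else if a = None then real CARD('m) else -1)"

definition levi :: "real^'m^'m \<Rightarrow> real^('m::finite option)^('m option)" where
  "levi h = (\<chi> a b. case (a, b) of
       (None, None) \<Rightarrow> inverse (det h)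
     | (Some i, Some j) \<Rightarrow> h $ i $ j
     | _ \<Rightarrow> 0)"

definition aexp :: "real \<Rightarrow> real^('m::finite option)^('m option)" where
  "aexp t = matrix_exp (t *\<^sub>R H0)"

definition nplus :: "real^'m \<Rightarrow> real^('m::finite option)^('m option)" where
  "nplus x = matrix_exp (\<Sum>j\<in>UNIV. x $ j *\<^sub>R matrix_unit None (Some j))"

definition nminus :: "real^'m \<Rightarrow> real^('m::finite option)^('m option)" where
  "nminus x = matrix_exp (\<Sum>j\<in>UNIV. x $ j *\<^sub>R matrix_unit (Some j) None)"

section \<open>Finite-dimensional representations\<close>

text \<open>
  A $d$-dimensional complex representation is taken on \<^typ>\<open>complex^'d\<close>, so equivalence classes
  are represented by matrix-valued homomorphisms; only the values on the group matter.
\<close>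

definition representation_on ::
    "(real^'m^'m) set \<Rightarrow> (real^'m^'m \<Rightarrow> complex^'d^'d) \<Rightarrow> bool" where
  "representation_on S \<rho> \<longleftrightarrow>
     \<rho> (mat 1) = mat 1 \<and> (\<forall>g\<in>S. \<forall>h\<in>S. \<rho> (g ** h) = \<rho> g ** \<rho> h) \<and> continuous_on S \<rho>"

definition irreducible_on ::
    "(real^'m^'m) set \<Rightarrow> (real^'m^'m \<Rightarrow> complex^'d^'d) \<Rightarrow> bool" where
  "irreducible_on S \<rho> \<longleftrightarrow>
     (\<forall>V. vec.subspace V \<and> (\<forall>g\<in>S. \<forall>v\<in>V. \<rho> g *v v \<in> V) \<longrightarrow> V = {0} \<or> V = UNIV)"

definition triv :: "real^'m^'m \<Rightarrow> complex^1^1" where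
  "triv g = mat 1"

definition rep_iso ::
    "(real^'m^'m) set \<Rightarrow> (real^'m^'m \<Rightarrow> complex^'a^'a) \<Rightarrow> (real^'m^'m \<Rightarrow> complex^'b^'b)
       \<Rightarrow> complex^'a^'b \<Rightarrow> bool" where
  "rep_iso S \<rho> \<sigma> A \<longleftrightarrow> bij ((*v) A) \<and> (\<forall>g\<in>S. A ** \<rho> g = \<sigma> g ** A)"

definition Xi :: "nat \<Rightarrow> ('m::finite \<Rightarrow> nat) set" where
  "Xi k = {\<kappa>. (\<Sum>j\<in>UNIV. \<kappa> j) = k}"

definition monomial :: "('m::finite \<Rightarrow> nat) \<Rightarrow> complex^'m \<Rightarrow> complex" where
  "monomial \<kappa> y = (\<Prod>j\<in>UNIV. (y $ j) ^ \<kappa> j)"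

text \<open>Over the complex numbers a polynomial may be identified with its polynomial function.\<close>

definition Pol :: "nat \<Rightarrow> (complex^'m::finite \<Rightarrow> complex) set" where
  "Pol k = {p. \<exists>c. p = (\<lambda>y. \<Sum>\<kappa>\<in>Xi k. c \<kappa> * monomial \<kappa> y)}"

definition cmat :: "real^'m^'m \<Rightarrow> complex^'m^'m" where
  "cmat g = (\<chi> i j. complex_of_real (g $ i $ j))"

definition poly_act ::
    "real^'m^'m \<Rightarrow> (complex^'m::finite \<Rightarrow> complex) \<Rightarrow> complex^'m \<Rightarrow> complex" where
  "poly_act g p = (\<lambda>y. p (cmat (matrix_inv g) *v y))"

text \<open>An equivalence, over the group \<open>S\<close>, from $\mathrm{poly}^k$ to \<open>\<rho>\<close>; the values of \<open>T\<close>
  outside \<^term>\<open>Pol k\<close> are irrelevant.\<close>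

definition poly_iso ::
    "(real^'m^'m) set \<Rightarrow> nat \<Rightarrow> (real^'m^'m \<Rightarrow> complex^'d^'d)
       \<Rightarrow> ((complex^'m::finite \<Rightarrow> complex) \<Rightarrow> complex^'d) \<Rightarrow> bool" where
  "poly_iso S k \<rho> T \<longleftrightarrow>
     bij_betw T (Pol k) UNIV \<and>
     (\<forall>p\<in>Pol k. \<forall>q\<in>Pol k. T (\<lambda>y. p y + q y) = T p + T q) \<and>
     (\<forall>c. \<forall>p\<in>Pol k. T (\<lambda>y. c * p y) = c *s T p) \<and>
     (\<forall>g\<in>S. \<forall>p\<in>Pol k. T (poly_act g p) = \<rho> g *v T p)"

text \<open>
  Normalization of the extension to $SL^\pm(n-1)$ of a representation of $SL(n-1)$: for $n \ge 3$,
  $\mathrm{poly}^k$ is extended by the natural action on polynomials; in every dimension the trivial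
  representation, which is $\mathrm{poly}^0$, is extended trivially. Extensions of other
  representations are arbitrary. For $n = 2$ all $\mathrm{poly}^k$ are trivial on $SL(1)$, so only
  the condition for $k = 0$ is imposed.
\<close>

definition normalized_extension :: "(real^'m::finite^'m \<Rightarrow> complex^'d^'d) \<Rightarrow> bool" where
  "normalized_extension \<rho> \<longleftrightarrow>
     (\<forall>k. (k = 0 \<or> CARD('m) \<ge> 2) \<longrightarrow> (\<exists>T. poly_iso SL k \<rho> T) \<longrightarrow> (\<exists>T. poly_iso SLpm k \<rho> T))"

definition sign_char :: "int \<Rightarrow> real^'m^'m \<Rightarrow> complex" where
  "sign_char \<alpha> h = (if \<alpha> = 1 then 1 else complex_of_real (sgn (det h)))"

section \<open>Smooth functions\<close>

fun Ck_on :: "nat \<Rightarrow> ('a::real_normed_vector \<Rightarrow> 'b::real_normed_vector) \<Rightarrow> 'a set \<Rightarrow> bool" where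
  "Ck_on 0 f U \<longleftrightarrow> continuous_on U f"
| "Ck_on (Suc k) f U \<longleftrightarrow>
     (\<forall>x\<in>U. f differentiable (at x)) \<and> (\<forall>v. Ck_on k (\<lambda>x. frechet_derivative f (at x) v) U)"

text \<open>Smoothness on an arbitrary subset (used for the submanifold $SL(n)$ of the space of matrices,
  and for whole Euclidean spaces): locally there is a smooth extension to an open set.\<close>

definition smooth_on :: "'a::real_normed_vector set \<Rightarrow> ('a \<Rightarrow> 'b::real_normed_vector) \<Rightarrow> bool" where
  "smooth_on S f \<longleftrightarrow>
     (\<forall>x\<in>S. \<exists>U F. open U \<and> x \<in> U \<and> (\<forall>k. Ck_on k F U) \<and> (\<forall>y\<in>U \<inter> S. F y = f y))"

definition Cinf :: "(real^'m \<Rightarrow> complex^'a) set" where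
  "Cinf = {\<phi>. smooth_on UNIV \<phi>}"

section \<open>Induced representations\<close>

text \<open>
  The space $I(\varpi,\lambda)^\alpha$, where \<open>\<rho>\<close> is the extension of $\varpi$ to $SL^\pm(n-1)$. A
  general element of $P = MAN_+$ is \<open>levi h ** aexp t ** nplus x\<close> with \<open>h \<in> SLpm\<close>.
  Functions on $G$ are normalized to be \<^const>\<open>undefined\<close> outside $G$.
\<close>

definition induced ::
    "(real^'m^'m \<Rightarrow> complex^'d^'d) \<Rightarrow> complex \<Rightarrow> int
       \<Rightarrow> (real^('m::finite option)^('m option) \<Rightarrow> complex^'d) set" where
  "induced \<rho> lam \<alpha> = {f \<in> extensional SL. smooth_on SL f \<and>
     (\<forall>g\<in>SL. \<forall>h\<in>SLpm. \<forall>t x.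
        f (g ** (levi h ** aexp t ** nplus x)) =
          matrix_inv (mat (sign_char \<alpha> h * exp (lam * of_real t)) ** \<rho> h) *v f g)}"

definition left_translate ::
    "real^'n^'n \<Rightarrow> (real^'n^'n \<Rightarrow> complex^'d) \<Rightarrow> real^'n^'n \<Rightarrow> complex^'d" where
  "left_translate g f = restrict (\<lambda>x. f (matrix_inv g ** x)) SL"

section \<open>Differential operators\<close>

definition partial :: "'m \<Rightarrow> (real^'m \<Rightarrow> complex^'a) \<Rightarrow> real^'m \<Rightarrow> complex^'a" where
  "partial j \<phi> = (\<lambda>x. frechet_derivative \<phi> (at x) (axis j 1))"

definition multi_partial ::
    "('m \<Rightarrow> nat) \<Rightarrow> (real^'m::{finite,linorder} \<Rightarrow> complex^'a) \<Rightarrow> real^'m::{finite,linorder} \<Rightarrow> complex^'a" where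
  "multi_partial \<kappa> = foldr (\<lambda>j. partial j ^^ \<kappa> j) (sorted_list_of_set UNIV)"

definition diff_ops ::
    "((real^'m::{finite,linorder} \<Rightarrow> complex^'a) \<Rightarrow> real^'m::{finite,linorder} \<Rightarrow> complex^'b) set" where
  "diff_ops = {E \<in> extensional Cinf. \<exists>N a. (\<forall>\<kappa>. smooth_on UNIV (a \<kappa> :: real^'m::{finite,linorder} \<Rightarrow> complex^'a^'b)) \<and>
     (\<forall>\<phi>\<in>Cinf. \<forall>x. E \<phi> x = (\<Sum>\<kappa> | (\<Sum>j\<in>UNIV. \<kappa> j) \<le> N. a \<kappa> x *v multi_partial \<kappa> \<phi> x))}"

text \<open>
  Differential operators between spaces of sections of bundles over $G/P$: in the trivialization over
  each translate $gN_-P/P$ of the open cell (these translates cover $G/P$) the operator is an ordinary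
  differential operator.
\<close>

definition bundle_diff_op ::
    "(real^('m::{finite,linorder} option)^('m option) \<Rightarrow> complex^'a) set
       \<Rightarrow> (real^('m::{finite,linorder} option)^('m option) \<Rightarrow> complex^'b) set
       \<Rightarrow> ((real^('m::{finite,linorder} option)^('m option) \<Rightarrow> complex^'a) \<Rightarrow> real^('m::{finite,linorder} option)^('m option) \<Rightarrow> complex^'b)
       \<Rightarrow> bool" where
  "bundle_diff_op I I' D \<longleftrightarrow> D \<in> I \<rightarrow>\<^sub>E I' \<and>
     (\<forall>g\<in>SL. \<exists>E\<in>diff_ops. \<forall>f\<in>I. \<forall>x. D f (g ** nminus x) = E (\<lambda>y. f (g ** nminus y)) x)"

definition Diff_G ::
    "(real^('m::{finite,linorder} option)^('m option) \<Rightarrow> complex^'a) set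
       \<Rightarrow> (real^('m::{finite,linorder} option)^('m option) \<Rightarrow> complex^'b) set
       \<Rightarrow> ((real^('m::{finite,linorder} option)^('m option) \<Rightarrow> complex^'a) \<Rightarrow> real^('m::{finite,linorder} option)^('m option) \<Rightarrow> complex^'b)
          set" where
  "Diff_G I I' = {D. bundle_diff_op I I' D \<and>
     (\<forall>g\<in>SL. \<forall>f\<in>I. D (left_translate g f) = left_translate g (D f))}"

text \<open>The differential operator on the open cell with which \<open>D\<close> is identified.\<close>

definition on_cell ::
    "(real^('m::{finite,linorder} option)^('m option) \<Rightarrow> complex^'a) set
       \<Rightarrow> ((real^('m::{finite,linorder} option)^('m option) \<Rightarrow> complex^'a) \<Rightarrow> real^('m::{finite,linorder} option)^('m option) \<Rightarrow> complex^'b)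
       \<Rightarrow> (real^'m::{finite,linorder} \<Rightarrow> complex^'a) \<Rightarrow> real^'m::{finite,linorder} \<Rightarrow> complex^'b" where
  "on_cell I D = (THE E. E \<in> diff_ops \<and>
     (\<forall>f\<in>I. \<forall>x. D f (nminus x) = E (\<lambda>y. f (nminus y)) x))"

definition Diff_G_equals ::
    "(real^('m::{finite,linorder} option)^('m option) \<Rightarrow> complex^'a) set
       \<Rightarrow> (real^('m::{finite,linorder} option)^('m option) \<Rightarrow> complex^'b) set
       \<Rightarrow> ((real^'m::{finite,linorder} \<Rightarrow> complex^'a) \<Rightarrow> real^'m::{finite,linorder} \<Rightarrow> complex^'b) set \<Rightarrow> bool" where
  "Diff_G_equals I I' X \<longleftrightarrow> bij_betw (on_cell I) (Diff_G I I') X"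

definition line ::
    "((real^'m \<Rightarrow> complex^'a) \<Rightarrow> real^'m \<Rightarrow> complex^'b)
       \<Rightarrow> ((real^'m \<Rightarrow> complex^'a) \<Rightarrow> real^'m \<Rightarrow> complex^'b) set" where
  "line E = {restrict (\<lambda>\<phi> x. c *s E \<phi> x) Cinf | c. True}"

text \<open>The operator $\mathcal D_k$ with target $\mathrm{Pol}^k$ identified with \<^typ>\<open>complex^'d\<close>
  through \<open>T\<close>, and source $C^\infty \otimes \mathbb C$.\<close>

definition Dk ::
    "nat \<Rightarrow> ((complex^'m::{finite,linorder} \<Rightarrow> complex) \<Rightarrow> complex^'d)
       \<Rightarrow> (real^'m::{finite,linorder} \<Rightarrow> complex^1) \<Rightarrow> real^'m::{finite,linorder} \<Rightarrow> complex^'d" where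
  "Dk k T \<phi> x = (\<Sum>\<kappa>\<in>Xi k. (multi_partial \<kappa> \<phi> x $ 1) *s
     T (\<lambda>y. monomial \<kappa> y / (\<Prod>j\<in>UNIV. fact (\<kappa> j))))"

section \<open>Parameters\<close>

text \<open>
  Here $\alpha + k$ stands for the sign $(-1)^k\alpha$. For $n = 2$ one has $M = SL^\pm(1) = \{\pm 1\}$ and $-1$ acts
  on $y_1^k$ by $(-1)^k$, so the $M$-representation $\mathbb C_{\alpha+k} \otimes \mathrm{poly}^k_1$
  is $\mathbb C_\alpha$. Since $\mathrm{poly}^k_1$ is regarded as the trivial representation
  (extended trivially, see \<open>normalized_extension\<close>), this $M$-representation is labelled
  $(\alpha, \mathrm{triv})$. With the label $(\alpha + k, \mathrm{triv})$ there would be no nonzero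
  intertwining operator for odd $k$, because the central element $-1$ of $SL(2)$ acts on
  $I(\mathrm{triv},\lambda)^\alpha$ by $\alpha$.
\<close>

definition target_sign :: "'m itself \<Rightarrow> int \<Rightarrow> nat \<Rightarrow> int" where
  "target_sign _ \<alpha> k = (if CARD('m) = 1 then \<alpha> else \<alpha> * (-1) ^ k)"

definition Lambda_G ::
    "(int \<times> int \<times> (real^'m::finite^'m \<Rightarrow> complex^'d^'d) \<times> complex \<times> complex) set" where
  "Lambda_G = {(\<alpha>, target_sign TYPE('m) \<alpha> k, \<rho>, 1 - of_nat k, 1 + of_nat k / of_nat CARD('m)) | \<alpha> k \<rho>.
     \<alpha> \<in> {1, -1} \<and> (\<exists>T. poly_iso SL k \<rho> T)}"

end

theory Submission
  imports Defs
begin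

text \<open>
  Write $n - 1$ for the cardinality of the index type. Through the first column of a matrix, a section of
  the source bundle is a homogeneous function of degree $-\lambda$ on $\mathbb{R}^n \setminus \{0\}$. By invariance,
  an intertwining operator \<open>D\<close> is determined by the functional \<open>f \<mapsto> D f (mat 1)\<close>, a vector-valued combination
  of partial derivatives at the origin of the open cell, and equivariance of \<open>D\<close> amounts to
  equivariance of this functional under $P = MAN_+$. The theorem is therefore a statement about jets
  at one point. Sections realize all jets (\<open>exists_section_with_jet\<close>), so the functional, and the operator
  on the cell, are well defined by \<open>D\<close> (\<open>diff_ops_eqI\<close>), and conditions on the functional can be tested
  on arbitrary jets.

  The group $A$ acts on the cell by dilations, so only derivatives of one order \<open>k\<close> can occur,
  namely with $\nu = \lambda + k\frac{n}{n-1}$ (\<open>mpart_cell_aexp\<close>). The functional becomes a linear map \<open>l\<close> on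
  $\mathrm{Pol}^k$, applied to the homogeneous part of degree \<open>k\<close> of the Taylor expansion. This part is
  $\sum_\kappa \partial^\kappa f\, y^\kappa/\kappa!$, so \<open>l\<close> applied to it is $\mathcal{D}_k$ up to the choice of \<open>l\<close>.

  The group $M$ acts by linear substitutions, up to signs, so \<open>l\<close> intertwines $\mathrm{Pol}^k$ with the
  given representation. As $\mathrm{Pol}^k$ is irreducible under $SL(n-1)$ (\<open>pol_submodule_irreducible\<close>: diagonal
  matrices isolate monomials, shears connect them), a nonzero \<open>l\<close> is an isomorphism and is unique up to
  a scalar (\<open>equivariant_nonzero_imp_iso\<close>, \<open>equivariant_unique\<close>). Elements of determinant $-1$ fix the relation
  between the two signs (\<open>poly_iso_levi_equivariant\<close>, \<open>levi_equivariant_sign\<close>).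

  The group $N_+$ acts on every line through the origin of the cell by a change of parameter
  $t \mapsto t/(1+ct)$ and the factor $(1+ct)^{-\lambda}$. On Taylor coefficients this is
  $a_k \mapsto \sum_{i \le k} a_i c^{k-i} \binom{-\lambda-i}{k-i}$ (\<open>taylor_projective_change\<close>). For $\lambda = 1-k$ every
  binomial coefficient with $i < k$ vanishes, which is Bol's lemma, and the functional is invariant. If
  $\lambda \ne 1-k$ and $k > 0$, the term $i = k-1$ turns a jet that is homogeneous of degree $k-1$ into one whose
  part of degree \<open>k\<close> is a nonzero multiple of its product with a linear form; \<open>l\<close> must kill these products,
  and they span $\mathrm{Pol}^k$.
\<close>

section \<open>Smooth functions and directional derivatives\<close>

text \<open>The space $\mathbb{R}^{n-1}$, its complexification, and the matrices of size $n - 1$ and of size \<open>n\<close>.\<close>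

type_synonym 'm rspace = "(real, 'm) vec"
type_synonym 'm cspace = "(complex, 'm) vec"
type_synonym 'm rmat = "((real, 'm) vec, 'm) vec"
type_synonym 'm gmat = "'m option rmat"

definition dderiv :: "'a \<Rightarrow> ('a::real_normed_vector \<Rightarrow> 'b::real_normed_vector) \<Rightarrow> 'a \<Rightarrow> 'b" where
  "dderiv v f = (\<lambda>x. frechet_derivative f (at x) v)"

lemma dderiv_eqI: "(f has_derivative f') (at x) \<Longrightarrow> dderiv v f x = f' v"
  unfolding dderiv_def using frechet_derivative_at by metis

lemma dderiv_cong:
  assumes "open U" "x \<in> U" "\<And>y. y \<in> U \<Longrightarrow> f y = g y" "f differentiable (at x)"
  shows "dderiv v f x = dderiv v g x"
  unfolding dderiv_def using frechet_derivative_transform_within_open[OF assms(4,1,2)] assms(3) by simp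

lemma Ck_on_Suc_iff:
  "Ck_on (Suc k) f U \<longleftrightarrow> (\<forall>x\<in>U. f differentiable (at x)) \<and> (\<forall>v. Ck_on k (dderiv v f) U)"
  by (simp add: dderiv_def)

declare Ck_on.simps(2)[simp del]

text \<open>Openness of the domain is built in: the derivatives inside are then determined by the values on the
  set, so nothing depends on the values outside.\<close>

definition smooth_open :: "'a::real_normed_vector set \<Rightarrow> ('a \<Rightarrow> 'b::real_normed_vector) \<Rightarrow> bool" where
  "smooth_open U f \<longleftrightarrow> open U \<and> (\<forall>k. Ck_on k f U)"

lemma smooth_open_dderiv: "smooth_open U f \<Longrightarrow> smooth_open U (dderiv v f)"
  unfolding smooth_open_def using Ck_on_Suc_iff by blast

lemma smooth_open_differentiable: "smooth_open U f \<Longrightarrow> x \<in> U \<Longrightarrow> f differentiable (at x)"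
  unfolding smooth_open_def using Ck_on_Suc_iff by blast

lemma smooth_open_has_derivative:
  "smooth_open U f \<Longrightarrow> x \<in> U \<Longrightarrow> (f has_derivative (\<lambda>v. dderiv v f x)) (at x)"
  using smooth_open_differentiable frechet_derivative_works unfolding dderiv_def by fast

lemma smooth_open_continuous: "smooth_open U f \<Longrightarrow> continuous_on U f"
  unfolding smooth_open_def by (metis Ck_on.simps(1))

lemma smooth_open_open: "smooth_open U f \<Longrightarrow> open U"
  by (simp add: smooth_open_def)

lemma Ck_on_cong:
  assumes "open U" "\<And>x. x \<in> U \<Longrightarrow> f x = g x" "Ck_on k f U"
  shows "Ck_on k g U"
  using assms(2,3)
proof (induction k arbitrary: f g)
  case 0
  then show ?case by (simp cong: continuous_on_cong)
next
  case (Suc k)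
  have d: "f differentiable (at x)" if "x \<in> U" for x using Suc.prems that by (simp add: Ck_on_Suc_iff)
  have "g differentiable (at x)" if "x \<in> U" for x
    using has_derivative_transform_within_open[OF _ assms(1) that, of f _ UNIV g] d[OF that] Suc.prems(1)
    unfolding differentiable_def by (metis)
  moreover have "Ck_on k (dderiv v g) U" for v
  proof (rule Suc.IH[of "dderiv v f"])
    show "dderiv v f x = dderiv v g x" if "x \<in> U" for x
      by (rule dderiv_cong[OF assms(1) that Suc.prems(1) d[OF that]])
    show "Ck_on k (dderiv v f) U" using Suc.prems by (simp add: Ck_on_Suc_iff)
  qed
  ultimately show ?case by (simp add: Ck_on_Suc_iff)
qed

lemma smooth_open_cong:
  assumes "\<And>x. x \<in> U \<Longrightarrow> f x = g x" "smooth_open U f"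
  shows "smooth_open U g"
proof -
  have "open U" "Ck_on k f U" for k using assms(2) by (auto simp: smooth_open_def)
  then have "Ck_on k g U" for k using assms(1) by (intro Ck_on_cong[of U f g k]) auto
  then show ?thesis using \<open>open U\<close> by (simp add: smooth_open_def)
qed

lemma Ck_on_Suc_imp: "Ck_on (Suc k) f U \<Longrightarrow> Ck_on k f U"
proof (induction k arbitrary: f)
  case 0
  then show ?case
    by (simp add: Ck_on_Suc_iff continuous_at_imp_continuous_on differentiable_imp_continuous_within)
next
  case (Suc k)
  then show ?case by (simp add: Ck_on_Suc_iff)
qed

lemma Ck_on_subset: "Ck_on k f U \<Longrightarrow> V \<subseteq> U \<Longrightarrow> Ck_on k f V"
  by (induction k arbitrary: f) (auto simp: Ck_on_Suc_iff intro: continuous_on_subset)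

lemma smooth_open_subset: "smooth_open U f \<Longrightarrow> V \<subseteq> U \<Longrightarrow> open V \<Longrightarrow> smooth_open V f"
  unfolding smooth_open_def using Ck_on_subset by blast

lemma Ck_on_local:
  assumes "\<And>x. x \<in> S \<Longrightarrow> \<exists>V. open V \<and> x \<in> V \<and> Ck_on k f V"
  shows "Ck_on k f S"
  using assms
proof (induction k arbitrary: f)
  case 0
  have "isCont f x" if "x \<in> S" for x
    using 0[OF that] by (auto simp: continuous_on_eq_continuous_at)
  then show ?case by (simp add: continuous_at_imp_continuous_on)
next
  case (Suc k)
  have "f differentiable (at x)" if "x \<in> S" for x
    using Suc.prems[OF that] by (auto simp: Ck_on_Suc_iff)
  moreover have "Ck_on k (dderiv v f) S" for v
  proof (rule Suc.IH)
    fix x assume "x \<in> S"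
    from Suc.prems[OF this] obtain V where "open V" "x \<in> V" "Ck_on (Suc k) f V" by auto
    then show "\<exists>V. open V \<and> x \<in> V \<and> Ck_on k (dderiv v f) V" by (auto simp: Ck_on_Suc_iff)
  qed
  ultimately show ?case by (simp add: Ck_on_Suc_iff)
qed

lemma smooth_open_local:
  assumes "open S" "\<And>x. x \<in> S \<Longrightarrow> \<exists>V F. x \<in> V \<and> smooth_open V F \<and> (\<forall>y\<in>V. F y = f y)"
  shows "smooth_open S f"
  unfolding smooth_open_def
proof (intro conjI allI assms Ck_on_local)
  fix k x assume "x \<in> S"
  then obtain V F where "x \<in> V" "smooth_open V F" "\<forall>y\<in>V. F y = f y" using assms by blast
  then show "\<exists>V. open V \<and> x \<in> V \<and> Ck_on k f V"
    using smooth_open_cong[of V F f] by (auto simp: smooth_open_def)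
qed

lemma Ck_on_const: "Ck_on k (\<lambda>x. c) U"
proof (induction k arbitrary: c)
  case (Suc k)
  then show ?case using dderiv_eqI[OF has_derivative_const] by (simp add: Ck_on_Suc_iff dderiv_def)
qed simp

lemma smooth_open_const: "open U \<Longrightarrow> smooth_open U (\<lambda>x. c)"
  by (simp add: smooth_open_def Ck_on_const)

lemma smooth_open_bounded_linear:
  assumes "bounded_linear L" "open U"
  shows "smooth_open U L"
proof -
  have "Ck_on k L U" for k
  proof (cases k)
    case 0
    then show ?thesis by (simp add: assms(1) linear_continuous_on)
  next
    case (Suc j)
    have "(L has_derivative L) (at x)" for x
      using assms(1) bounded_linear_imp_has_derivative by blast
    then have "dderiv v L = (\<lambda>x. L v)" for v using dderiv_eqI by blast
    then show ?thesis using Suc \<open>\<And>x. (L has_derivative L) (at x)\<close>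
      by (auto simp: Ck_on_Suc_iff Ck_on_const differentiable_def)
  qed
  then show ?thesis using assms by (simp add: smooth_open_def)
qed

lemma dderiv_linear_compose:
  assumes "bounded_linear L" "f differentiable (at x)"
  shows "dderiv v (\<lambda>x. L (f x)) x = L (dderiv v f x)" "(\<lambda>x. L (f x)) differentiable (at x)"
proof -
  have "((\<lambda>x. L (f x)) has_derivative (\<lambda>v. L (dderiv v f x))) (at x)"
    using assms bounded_linear.has_derivative[OF assms(1)] frechet_derivative_works unfolding dderiv_def by blast
  then show "dderiv v (\<lambda>x. L (f x)) x = L (dderiv v f x)" "(\<lambda>x. L (f x)) differentiable (at x)"
    using dderiv_eqI by (blast, auto simp: differentiable_def)
qed

lemma dderiv_linear:
  "bounded_linear L \<Longrightarrow> smooth_open UNIV f \<Longrightarrow> dderiv v (\<lambda>x. L (f x)) = (\<lambda>x. L (dderiv v f x))"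
  by (intro ext dderiv_linear_compose(1) smooth_open_differentiable) auto

lemma Ck_on_linear_compose:
  assumes "bounded_linear L" "open U" "Ck_on k f U"
  shows "Ck_on k (\<lambda>x. L (f x)) U"
  using assms(3)
proof (induction k arbitrary: f)
  case 0
  then show ?case by (simp add: bounded_linear.continuous_on[OF assms(1)])
next
  case (Suc k)
  have "Ck_on k (\<lambda>x. L (dderiv v f x)) U" for v using Suc by (simp add: Ck_on_Suc_iff)
  then have "Ck_on k (dderiv v (\<lambda>x. L (f x))) U" for v
    by (rule Ck_on_cong[OF assms(2), rotated])
      (use Suc.prems in \<open>simp add: dderiv_linear_compose[OF assms(1)] Ck_on_Suc_iff\<close>)
  then show ?case using Suc.prems dderiv_linear_compose(2)[OF assms(1)] by (auto simp: Ck_on_Suc_iff)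
qed

lemma smooth_open_linear_compose:
  "bounded_linear L \<Longrightarrow> smooth_open U f \<Longrightarrow> smooth_open U (\<lambda>x. L (f x))"
  by (simp add: smooth_open_def Ck_on_linear_compose)

lemma Ck_on_add:
  assumes "open U" "Ck_on k f U" "Ck_on k g U"
  shows "Ck_on k (\<lambda>x. f x + g x) U"
  using assms(2,3)
proof (induction k arbitrary: f g)
  case 0
  then show ?case by (simp add: continuous_on_add)
next
  case (Suc k)
  have fg: "f differentiable (at x)" "g differentiable (at x)" if "x \<in> U" for x
    using Suc.prems that by (auto simp: Ck_on_Suc_iff)
  have "dderiv v (\<lambda>x. f x + g x) x = dderiv v f x + dderiv v g x" if "x \<in> U" for x v
    using fg[OF that] by (intro dderiv_eqI) (auto simp: dderiv_def frechet_derivative_works intro!: derivative_eq_intros)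
  moreover have "Ck_on k (\<lambda>x. dderiv v f x + dderiv v g x) U" for v
    using Suc by (simp add: Ck_on_Suc_iff)
  ultimately have "Ck_on k (dderiv v (\<lambda>x. f x + g x)) U" for v
    using Ck_on_cong[OF assms(1), of "\<lambda>x. dderiv v f x + dderiv v g x"] by force
  then show ?case using fg by (simp add: Ck_on_Suc_iff)
qed

lemma smooth_open_add: "smooth_open U f \<Longrightarrow> smooth_open U g \<Longrightarrow> smooth_open U (\<lambda>x. f x + g x)"
  by (simp add: smooth_open_def Ck_on_add)

lemma smooth_open_minus: "smooth_open U f \<Longrightarrow> smooth_open U (\<lambda>x. - f x)"
  by (rule smooth_open_linear_compose[OF bounded_linear_minus[OF bounded_linear_ident]])

lemma smooth_open_diff: "smooth_open U f \<Longrightarrow> smooth_open U g \<Longrightarrow> smooth_open U (\<lambda>x. f x - g x)"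
  using smooth_open_add[OF _ smooth_open_minus] by fastforce

lemma smooth_open_sum:
  assumes "open U" "\<And>i. i \<in> I \<Longrightarrow> smooth_open U (f i)"
  shows "smooth_open U (\<lambda>x. \<Sum>i\<in>I. f i x)"
  using assms(2)
  by (induction I rule: infinite_finite_induct) (auto simp: smooth_open_const assms(1) smooth_open_add)

lemma Ck_on_bilinear:
  assumes "bounded_bilinear p" "open U" "Ck_on k f U" "Ck_on k g U"
  shows "Ck_on k (\<lambda>x. p (f x) (g x)) U"
  using assms(3,4)
proof (induction k arbitrary: f g)
  case 0
  then show ?case by (simp add: bounded_bilinear.continuous_on[OF assms(1)])
next
  case (Suc k)
  have fg: "f differentiable (at x)" "g differentiable (at x)" if "x \<in> U" for x
    using Suc.prems that by (auto simp: Ck_on_Suc_iff)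
  have der: "((\<lambda>x. p (f x) (g x)) has_derivative
      (\<lambda>v. p (f x) (dderiv v g x) + p (dderiv v f x) (g x))) (at x)" if "x \<in> U" for x
    using fg[OF that] unfolding dderiv_def
    by (intro bounded_bilinear.FDERIV[OF assms(1)]) (auto simp: frechet_derivative_works)
  have "Ck_on k (\<lambda>x. p (f x) (dderiv v g x) + p (dderiv v f x) (g x)) U" for v
    using Suc.IH Suc.prems Ck_on_Suc_imp[OF Suc.prems(1)] Ck_on_Suc_imp[OF Suc.prems(2)]
    by (intro Ck_on_add assms(2)) (auto simp: Ck_on_Suc_iff)
  then have "Ck_on k (dderiv v (\<lambda>x. p (f x) (g x))) U" for v
    by (rule Ck_on_cong[OF assms(2), rotated]) (simp add: dderiv_eqI[OF der])
  then show ?case using der unfolding Ck_on_Suc_iff differentiable_def by blast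
qed

lemma smooth_open_bilinear:
  "bounded_bilinear p \<Longrightarrow> smooth_open U f \<Longrightarrow> smooth_open U g \<Longrightarrow> smooth_open U (\<lambda>x. p (f x) (g x))"
  by (simp add: smooth_open_def Ck_on_bilinear)

lemma smooth_open_mult:
  fixes f g :: "'a::real_normed_vector \<Rightarrow> 'b::real_normed_algebra"
  shows "smooth_open U f \<Longrightarrow> smooth_open U g \<Longrightarrow> smooth_open U (\<lambda>x. f x * g x)"
  by (rule smooth_open_bilinear[OF bounded_bilinear_mult])

lemma smooth_open_power:
  fixes f :: "'a::real_normed_vector \<Rightarrow> 'b::real_normed_algebra_1"
  shows "smooth_open U f \<Longrightarrow> smooth_open U (\<lambda>x. f x ^ n)"
  by (induction n) (auto simp: smooth_open_const smooth_open_open smooth_open_mult)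

lemma smooth_open_prod:
  fixes f :: "'i \<Rightarrow> 'a::real_normed_vector \<Rightarrow> 'b::{real_normed_algebra_1, comm_monoid_mult}"
  assumes "open U" "\<And>i. i \<in> I \<Longrightarrow> smooth_open U (f i)"
  shows "smooth_open U (\<lambda>x. \<Prod>i\<in>I. f i x)"
  using assms(2)
  by (induction I rule: infinite_finite_induct) (auto simp: smooth_open_const assms(1) smooth_open_mult)

lemma dderiv_affine:
  assumes "bounded_linear L" "f differentiable (at (a + L x))"
  shows "dderiv v (\<lambda>x. f (a + L x)) x = dderiv (L v) f (a + L x)" "(\<lambda>x. f (a + L x)) differentiable (at x)"
proof -
  have 1: "(f has_derivative (\<lambda>v. dderiv v f (a + L x))) (at (a + L x))"
    using assms frechet_derivative_works unfolding dderiv_def by blast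
  have "((\<lambda>x. a + L x) has_derivative L) (at x)"
    using bounded_linear_imp_has_derivative[OF assms(1)] by (auto intro!: derivative_eq_intros)
  then have "((\<lambda>x. f (a + L x)) has_derivative (\<lambda>v. dderiv (L v) f (a + L x))) (at x)"
    by (rule has_derivative_compose[where f = "\<lambda>x. a + L x"]) (rule 1)
  then show "dderiv v (\<lambda>x. f (a + L x)) x = dderiv (L v) f (a + L x)" "(\<lambda>x. f (a + L x)) differentiable (at x)"
    using dderiv_eqI by (blast, auto simp: differentiable_def)
qed

lemma open_affine_vimage:
  assumes "bounded_linear L" "open U"
  shows "open {x. a + L x \<in> U}"
proof -
  have "continuous_on UNIV (\<lambda>x. a + L x)"
    using assms by (intro continuous_intros linear_continuous_on)
  then show ?thesis using open_vimage[OF assms(2), of "\<lambda>x. a + L x"] by (simp add: vimage_def)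
qed

lemma Ck_on_affine:
  assumes "bounded_linear L" "open U" "Ck_on k f U"
  shows "Ck_on k (\<lambda>x. f (a + L x)) {x. a + L x \<in> U}"
  using assms(3)
proof (induction k arbitrary: f)
  case 0
  have "continuous_on {x. a + L x \<in> U} (\<lambda>x. a + L x)"
    using assms(1) by (intro continuous_intros linear_continuous_on)
  then show ?case
    using 0 continuous_on_compose2[of U f "{x. a + L x \<in> U}" "\<lambda>x. a + L x"] by auto
next
  case (Suc k)
  have "Ck_on k (\<lambda>x. dderiv (L v) f (a + L x)) {x. a + L x \<in> U}" for v
    using Suc by (simp add: Ck_on_Suc_iff)
  then have "Ck_on k (dderiv v (\<lambda>x. f (a + L x))) {x. a + L x \<in> U}" for v
    by (rule Ck_on_cong[OF open_affine_vimage[OF assms(1,2)], rotated])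
      (use Suc.prems in \<open>simp add: dderiv_affine[OF assms(1)] Ck_on_Suc_iff\<close>)
  moreover have "(\<lambda>x. f (a + L x)) differentiable (at x)" if "a + L x \<in> U" for x
    using Suc.prems that by (intro dderiv_affine(2)[OF assms(1)]) (auto simp: Ck_on_Suc_iff)
  ultimately show ?case by (simp add: Ck_on_Suc_iff)
qed

lemma smooth_open_affine:
  "bounded_linear L \<Longrightarrow> smooth_open U f \<Longrightarrow> smooth_open {x. a + L x \<in> U} (\<lambda>x. f (a + L x))"
  by (simp add: smooth_open_def Ck_on_affine open_affine_vimage)

lemma smooth_on_iff_local:
  "smooth_on S f \<longleftrightarrow> (\<forall>x\<in>S. \<exists>U F. x \<in> U \<and> smooth_open U F \<and> (\<forall>y\<in>U \<inter> S. F y = f y))"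
  unfolding smooth_on_def smooth_open_def by meson

lemma smooth_on_UNIV_iff: "smooth_on UNIV f \<longleftrightarrow> smooth_open UNIV f"
  unfolding smooth_on_iff_local using smooth_open_local[of UNIV f] by auto

lemma Cinf_iff: "\<phi> \<in> Cinf \<longleftrightarrow> smooth_open UNIV \<phi>"
  by (simp add: Cinf_def smooth_on_UNIV_iff)

text \<open>The power $r^\mu$ of a positive real number, in the form in which the characters $e^{\lambda t}$ of $A$ are
  its values at $r = e^t$.\<close>

definition cpow :: "complex \<Rightarrow> real \<Rightarrow> complex" where
  "cpow \<mu> r = exp (\<mu> * of_real (ln r))"

lemma cpow_1 [simp]: "cpow \<mu> 1 = 1" by (simp add: cpow_def)

lemma cpow_nonzero [simp]: "cpow \<mu> r \<noteq> 0" by (simp add: cpow_def)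

lemma cpow_mult: "r > 0 \<Longrightarrow> s > 0 \<Longrightarrow> cpow \<mu> (r * s) = cpow \<mu> r * cpow \<mu> s"
  by (simp add: cpow_def ln_mult exp_add ring_distribs)

lemma cpow_add: "cpow (\<mu> + \<nu>) r = cpow \<mu> r * cpow \<nu> r"
  by (simp add: cpow_def exp_add ring_distribs)

lemma cpow_of_nat: "r > 0 \<Longrightarrow> cpow (of_nat n) r = of_real r ^ n"
  by (simp add: cpow_def exp_of_nat_mult exp_of_real)

lemma cpow_exp: "cpow \<mu> (exp t) = exp (\<mu> * of_real t)"
  by (simp add: cpow_def)

lemma cpow_minus: "cpow (-\<mu>) r = inverse (cpow \<mu> r)"
  by (simp add: cpow_def exp_minus)

lemma cpow_diff_1: "r > 0 \<Longrightarrow> cpow (\<mu> - 1) r = cpow \<mu> r / of_real r"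
  using cpow_add[of "\<mu> - 1" 1 r] cpow_of_nat[of r 1] by (simp add: field_simps)

lemma has_derivative_cpow:
  assumes "(q has_derivative q') (at x)" "q x > 0"
  shows "((\<lambda>x. cpow \<mu> (q x)) has_derivative (\<lambda>v. \<mu> * cpow (\<mu> - 1) (q x) * of_real (q' v))) (at x)"
proof -
  have 1: "((\<lambda>x. ln (q x)) has_derivative (\<lambda>v. q' v / q x)) (at x)"
    using assms by (auto intro!: derivative_eq_intros simp: field_simps)
  have "((\<lambda>x. \<mu> * of_real (ln (q x))) has_derivative (\<lambda>v. \<mu> * of_real (q' v / q x))) (at x)"
    by (intro has_derivative_mult_right has_derivative_of_real 1)
  then have "((\<lambda>x. exp (\<mu> * of_real (ln (q x)))) has_derivative
      (\<lambda>v. exp (\<mu> * of_real (ln (q x))) * (\<mu> * of_real (q' v / q x)))) (at x)"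
    using has_derivative_compose[OF _ has_field_derivative_imp_has_derivative[OF DERIV_exp]] by blast
  then show ?thesis using assms(2)
    unfolding cpow_diff_1[OF assms(2)] by (simp add: cpow_def field_simps)
qed

text \<open>The derivative of a power is a power with another exponent times a smooth function, so the
  induction on the order of differentiability runs over all exponents at once.\<close>

lemma smooth_open_cpow:
  assumes "smooth_open U q" "\<And>x. x \<in> U \<Longrightarrow> q x > 0"
  shows "smooth_open U (\<lambda>x. cpow \<mu> (q x))"
proof -
  note oU = smooth_open_open[OF assms(1)]
  have der: "((\<lambda>x. cpow \<mu> (q x)) has_derivative (\<lambda>v. \<mu> * cpow (\<mu> - 1) (q x) * of_real (dderiv v q x))) (at x)"
    if "x \<in> U" for x \<mu>
    using has_derivative_cpow[OF smooth_open_has_derivative[OF assms(1) that]] assms(2) that by blast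
  have "Ck_on k (\<lambda>x. cpow \<mu> (q x)) U" for k
  proof (induction k arbitrary: \<mu>)
    case 0
    then show ?case
      using has_derivative_continuous[OF der] by (simp add: continuous_at_imp_continuous_on)
  next
    case (Suc k)
    have K: "Ck_on k (\<lambda>x. (\<mu> * cpow (\<mu> - 1) (q x)) * of_real (dderiv v q x)) U" for v
      by (intro Ck_on_bilinear[OF bounded_bilinear_mult oU]
            Ck_on_linear_compose[OF bounded_linear_mult_right oU] Suc
            Ck_on_linear_compose[OF bounded_linear_of_real oU])
        (use smooth_open_dderiv[OF assms(1)] in \<open>simp add: smooth_open_def\<close>)
    have "Ck_on k (dderiv v (\<lambda>x. cpow \<mu> (q x))) U" for v
      by (rule Ck_on_cong[OF oU _ K[of v]]) (simp add: dderiv_eqI[OF der])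
    then show ?case using der unfolding Ck_on_Suc_iff differentiable_def by blast
  qed
  then show ?thesis using oU by (simp add: smooth_open_def)
qed

lemma has_vector_derivative_along_line:
  assumes "smooth_open UNIV f"
  shows "((\<lambda>t. f (x + t *\<^sub>R v)) has_vector_derivative dderiv v f (x + t *\<^sub>R v)) (at t)"
proof -
  have 1: "((\<lambda>t. x + t *\<^sub>R v) has_derivative (\<lambda>t. t *\<^sub>R v)) (at t)"
    by (auto intro!: derivative_eq_intros)
  have 2: "(f has_derivative (\<lambda>w. dderiv w f (x + t *\<^sub>R v))) (at (x + t *\<^sub>R v))"
    using smooth_open_has_derivative[OF assms] by simp
  have "((\<lambda>t. f (x + t *\<^sub>R v)) has_derivative (\<lambda>r. dderiv (r *\<^sub>R v) f (x + t *\<^sub>R v))) (at t)"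
    by (rule has_derivative_compose[OF 1 2])
  then show ?thesis
    using linear_scale[OF has_derivative_linear[OF 2]] by (simp add: has_vector_derivative_def)
qed

text \<open>Both mixed second derivatives occur, by the mean value theorem, as values at nearby points
  of the same second difference quotient.\<close>

lemma second_difference_mean_value:
  fixes f :: "'a::real_normed_vector \<Rightarrow> real"
  assumes f: "smooth_open UNIV f" and h: "h > 0"
  shows "\<exists>p. norm (p - x) \<le> h * (norm u + norm v) \<and>
    f (x + h *\<^sub>R u + h *\<^sub>R v) - f (x + h *\<^sub>R u) - f (x + h *\<^sub>R v) + f x = h * h * dderiv v (dderiv u f) p"
proof -
  have line: "((\<lambda>s. F (y + s *\<^sub>R w)) has_real_derivative dderiv w F (y + s *\<^sub>R w)) (at s)"
    if "smooth_open UNIV F" for F :: "'a \<Rightarrow> real" and y w s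
    using has_vector_derivative_along_line[OF that] by (simp add: has_real_derivative_iff_has_vector_derivative)
  let ?G = "\<lambda>s. f (x + h *\<^sub>R v + s *\<^sub>R u) - f (x + s *\<^sub>R u)"
  have "\<exists>s>0. s < h \<and> ?G h - ?G 0 = (h - 0) * (dderiv u f (x + h *\<^sub>R v + s *\<^sub>R u) - dderiv u f (x + s *\<^sub>R u))"
    using h by (intro MVT2) (auto intro!: derivative_intros line f)
  then obtain s where s: "s > 0" "s < h"
    "?G h - ?G 0 = h * (dderiv u f (x + h *\<^sub>R v + s *\<^sub>R u) - dderiv u f (x + s *\<^sub>R u))" by auto
  let ?K = "\<lambda>t. dderiv u f (x + s *\<^sub>R u + t *\<^sub>R v)"
  have "\<exists>t>0. t < h \<and> ?K h - ?K 0 = (h - 0) * dderiv v (dderiv u f) (x + s *\<^sub>R u + t *\<^sub>R v)"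
    using h by (intro MVT2) (auto intro!: derivative_intros line smooth_open_dderiv f)
  then obtain t where t: "t > 0" "t < h" "?K h - ?K 0 = h * dderiv v (dderiv u f) (x + s *\<^sub>R u + t *\<^sub>R v)" by auto
  have "norm (x + s *\<^sub>R u + t *\<^sub>R v - x) \<le> s * norm u + t * norm v"
    using norm_triangle_ineq[of "s *\<^sub>R u" "t *\<^sub>R v"] s t by simp
  also have "\<dots> \<le> h * (norm u + norm v)"
    using s t by (simp add: ring_distribs add_mono mult_right_mono)
  finally have "norm (x + s *\<^sub>R u + t *\<^sub>R v - x) \<le> h * (norm u + norm v)" .
  moreover have "f (x + h *\<^sub>R u + h *\<^sub>R v) - f (x + h *\<^sub>R u) - f (x + h *\<^sub>R v) + f x = ?G h - ?G 0"
    by (simp add: algebra_simps)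
  moreover have "\<dots> = h * (?K h - ?K 0)" using s(3) by (simp add: algebra_simps)
  ultimately show ?thesis using t(3) by (metis mult.assoc)
qed

lemma dderiv_commute_real:
  fixes f :: "'a::real_normed_vector \<Rightarrow> real"
  assumes f: "smooth_open UNIV f"
  shows "dderiv u (dderiv v f) x = dderiv v (dderiv u f) x"
proof -
  define h where "h = (\<lambda>n. inverse (real (Suc n)))"
  have h: "h n > 0" for n by (simp add: h_def)
  have h0: "h \<longlonglongrightarrow> 0" unfolding h_def by (rule LIMSEQ_inverse_real_of_nat)
  have "\<exists>p q. norm (p - x) \<le> h n * (norm u + norm v) \<and> norm (q - x) \<le> h n * (norm v + norm u) \<and>
      dderiv v (dderiv u f) p = dderiv u (dderiv v f) q" for n
  proof -
    obtain p where p: "norm (p - x) \<le> h n * (norm u + norm v)" "f (x + h n *\<^sub>R u + h n *\<^sub>R v) -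
        f (x + h n *\<^sub>R u) - f (x + h n *\<^sub>R v) + f x = h n * h n * dderiv v (dderiv u f) p"
      using second_difference_mean_value[OF f h] by blast
    obtain q where q: "norm (q - x) \<le> h n * (norm v + norm u)" "f (x + h n *\<^sub>R v + h n *\<^sub>R u) -
        f (x + h n *\<^sub>R v) - f (x + h n *\<^sub>R u) + f x = h n * h n * dderiv u (dderiv v f) q"
      using second_difference_mean_value[OF f h] by blast
    have "h n * h n * dderiv v (dderiv u f) p = h n * h n * dderiv u (dderiv v f) q"
      using p(2) q(2) by (simp add: algebra_simps)
    then show ?thesis using p(1) q(1) h[of n] by (intro exI[of _ p] exI[of _ q]) simp
  qed
  then obtain p q where p: "\<And>n. norm (p n - x) \<le> h n * (norm u + norm v)"
    and q: "\<And>n. norm (q n - x) \<le> h n * (norm v + norm u)"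
    and eq: "\<And>n. dderiv v (dderiv u f) (p n) = dderiv u (dderiv v f) (q n)" by metis
  have lim: "(\<lambda>n. h n * c) \<longlonglongrightarrow> 0" for c using tendsto_mult_left_zero[OF h0] by simp
  have "p \<longlonglongrightarrow> x" using p by (intro LIM_zero_cancel[OF Lim_null_comparison[OF always_eventually lim]]) auto
  moreover have "q \<longlonglongrightarrow> x" using q by (intro LIM_zero_cancel[OF Lim_null_comparison[OF always_eventually lim]]) auto
  moreover have "isCont (dderiv a (dderiv b f)) x" for a b
    using smooth_open_continuous[OF smooth_open_dderiv[OF smooth_open_dderiv[OF f]]]
    by (simp add: continuous_on_eq_continuous_at)
  ultimately have "(\<lambda>n. dderiv v (dderiv u f) (p n)) \<longlonglongrightarrow> dderiv v (dderiv u f) x"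
    "(\<lambda>n. dderiv u (dderiv v f) (q n)) \<longlonglongrightarrow> dderiv u (dderiv v f) x"
    using isCont_tendsto_compose by blast+
  then show ?thesis using LIMSEQ_unique unfolding eq by blast
qed

lemma dderiv_commute:
  fixes f :: "'a::real_normed_vector \<Rightarrow> complex"
  assumes f: "smooth_open UNIV f"
  shows "dderiv u (dderiv v f) = dderiv v (dderiv u f)"
proof -
  have eq: "dderiv a (dderiv b (\<lambda>x. L (f x))) x = L (dderiv a (dderiv b f) x)" if L: "bounded_linear L"
    for L :: "complex \<Rightarrow> real" and a b x
  proof -
    have "dderiv b (\<lambda>x. L (f x)) = (\<lambda>x. L (dderiv b f x))" for b
      by (intro ext dderiv_linear_compose(1)[OF L] smooth_open_differentiable[OF f] UNIV_I)
    then show ?thesis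
      using dderiv_linear_compose(1)[OF L smooth_open_differentiable[OF smooth_open_dderiv[OF f] UNIV_I]] by simp
  qed
  have "L (dderiv u (dderiv v f) x) = L (dderiv v (dderiv u f) x)" if L: "bounded_linear L" for L :: "complex \<Rightarrow> real" and x
    using dderiv_commute_real[OF smooth_open_linear_compose[OF L f], of u v x] eq[OF L] by simp
  from this[OF bounded_linear_Re] this[OF bounded_linear_Im] show ?thesis by (simp add: fun_eq_iff complex_eq_iff)
qed

section \<open>Multi-indices and jets\<close>

definition bump :: "'m \<Rightarrow> ('m \<Rightarrow> nat) \<Rightarrow> 'm \<Rightarrow> nat" where
  "bump j \<kappa> = \<kappa>(j := Suc (\<kappa> j))"

lemma bump_same [simp]: "bump j \<kappa> j = Suc (\<kappa> j)"
  by (simp add: bump_def)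

lemma bump_other [simp]: "i \<noteq> j \<Longrightarrow> bump j \<kappa> i = \<kappa> i"
  by (simp add: bump_def)

lemma bump_lower: "\<kappa> j > 0 \<Longrightarrow> bump j (\<kappa>(j := \<kappa> j - 1)) = \<kappa>"
  by (auto simp: bump_def)

lemma lower_bump: "(bump j \<kappa>)(j := bump j \<kappa> j - 1) = \<kappa>"
  by (auto simp: bump_def)

text \<open>The iterated partial derivative \<open>multi_partial\<close> with values in any normed space, so that it is
  available for the complex-valued coordinates of sections.\<close>

definition mpart :: "('m \<Rightarrow> nat) \<Rightarrow> ('m::{finite,linorder} rspace \<Rightarrow> 'b::real_normed_vector)
    \<Rightarrow> 'm rspace \<Rightarrow> 'b" where
  "mpart \<kappa> = foldr (\<lambda>j. dderiv (axis j 1) ^^ \<kappa> j) (sorted_list_of_set UNIV)"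

lemma multi_partial_eq_mpart:
  fixes \<kappa> :: "'m::{finite,linorder} \<Rightarrow> nat"
  shows "(multi_partial \<kappa> :: ('m::{finite,linorder} rspace \<Rightarrow> complex^'a) \<Rightarrow> _) = mpart \<kappa>"
proof -
  have "(partial j :: ('m rspace \<Rightarrow> complex^'a) \<Rightarrow> _) = dderiv (axis j 1)" for j
    by (simp add: partial_def dderiv_def fun_eq_iff)
  then show ?thesis by (simp add: multi_partial_def mpart_def)
qed

text \<open>A property that survives one partial derivative survives all. It is stated for families of
  functions because the dependence on the base point of the cell is such a property.\<close>

lemma mpart_family_induct:
  assumes "R \<Psi>" "\<And>j \<Psi>. R \<Psi> \<Longrightarrow> R (\<lambda>g. dderiv (axis j 1) (\<Psi> g))"
  shows "R (\<lambda>g. mpart \<kappa> (\<Psi> g))"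
proof -
  have pow: "R \<Psi> \<Longrightarrow> R (\<lambda>g. (dderiv (axis j 1) ^^ n) (\<Psi> g))" for j n \<Psi>
    by (induction n) (auto intro: assms(2))
  have "R (\<lambda>g. foldr (\<lambda>j. dderiv (axis j 1) ^^ \<kappa> j) xs (\<Psi> g))" for xs
    by (induction xs) (auto intro: assms(1) pow)
  then show ?thesis by (simp add: mpart_def)
qed

lemma smooth_mpart: "smooth_open U \<phi> \<Longrightarrow> smooth_open U (mpart \<kappa> \<phi>)"
  using mpart_family_induct[of "\<lambda>\<Psi>. smooth_open U (\<Psi> ())" "\<lambda>_. \<phi>"] smooth_open_dderiv by blast

lemma mpart_linear_compose:
  assumes L: "bounded_linear L" and "smooth_open UNIV \<phi>"
  shows "mpart \<kappa> (\<lambda>x. L (\<phi> x)) = (\<lambda>x. L (mpart \<kappa> \<phi> x))"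
proof -
  have pow: "(dderiv v ^^ n) (\<lambda>x. L (\<psi> x)) = (\<lambda>x. L ((dderiv v ^^ n) \<psi> x)) \<and> smooth_open UNIV ((dderiv v ^^ n) \<psi>)"
    if "smooth_open UNIV \<psi>" for v n \<psi>
    using that by (induction n) (auto simp: dderiv_linear[OF L] smooth_open_dderiv)
  have "foldr (\<lambda>j. dderiv (axis j 1) ^^ \<kappa> j) xs (\<lambda>x. L (\<phi> x)) =
      (\<lambda>x. L (foldr (\<lambda>j. dderiv (axis j 1) ^^ \<kappa> j) xs \<phi> x)) \<and>
      smooth_open UNIV (foldr (\<lambda>j. dderiv (axis j 1) ^^ \<kappa> j) xs \<phi>)" for xs
    by (induction xs) (auto simp: assms pow)
  then show ?thesis by (simp add: mpart_def)
qed

lemma foldr_dderiv_commute: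
  fixes \<phi> :: "'m::{finite,linorder} rspace \<Rightarrow> complex"
  assumes "smooth_open UNIV \<phi>"
  shows "dderiv v (foldr (\<lambda>j. dderiv (axis j 1) ^^ \<kappa> j) xs \<phi>) = foldr (\<lambda>j. dderiv (axis j 1) ^^ \<kappa> j) xs (dderiv v \<phi>)"
    "smooth_open UNIV (foldr (\<lambda>j. dderiv (axis j 1) ^^ \<kappa> j) xs \<phi>)"
proof -
  have pow: "dderiv v ((dderiv u ^^ n) \<psi>) = (dderiv u ^^ n) (dderiv v \<psi>) \<and> smooth_open UNIV ((dderiv u ^^ n) \<psi>)"
    if "smooth_open UNIV \<psi>" for u n and \<psi> :: "'m rspace \<Rightarrow> complex"
    using that by (induction n) (auto simp: smooth_open_dderiv dderiv_commute[of _ v u])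
  have "dderiv v (foldr (\<lambda>j. dderiv (axis j 1) ^^ \<kappa> j) xs \<phi>) = foldr (\<lambda>j. dderiv (axis j 1) ^^ \<kappa> j) xs (dderiv v \<phi>) \<and>
    smooth_open UNIV (foldr (\<lambda>j. dderiv (axis j 1) ^^ \<kappa> j) xs \<phi>)"
    by (induction xs) (auto simp: assms pow)
  then show "dderiv v (foldr (\<lambda>j. dderiv (axis j 1) ^^ \<kappa> j) xs \<phi>) = foldr (\<lambda>j. dderiv (axis j 1) ^^ \<kappa> j) xs (dderiv v \<phi>)"
    "smooth_open UNIV (foldr (\<lambda>j. dderiv (axis j 1) ^^ \<kappa> j) xs \<phi>)" by auto
qed

lemma dderiv_mpart:
  fixes \<phi> :: "'m::{finite,linorder} rspace \<Rightarrow> complex"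
  shows "smooth_open UNIV \<phi> \<Longrightarrow> dderiv v (mpart \<kappa> \<phi>) = mpart \<kappa> (dderiv v \<phi>)"
  by (simp add: mpart_def foldr_dderiv_commute)

text \<open>As partial derivatives commute, the additional one can be taken first, whatever its place in
  the order of the coordinates.\<close>

lemma mpart_Suc:
  fixes \<phi> :: "'m::{finite,linorder} rspace \<Rightarrow> complex"
  assumes "smooth_open UNIV \<phi>"
  shows "mpart (bump j \<kappa>) \<phi> = mpart \<kappa> (dderiv (axis j 1) \<phi>)"
proof -
  let ?D = "\<lambda>\<kappa> j. dderiv (axis j 1) ^^ \<kappa> j :: ('m rspace \<Rightarrow> complex) \<Rightarrow> _"
  let ?\<kappa> = "bump j \<kappa>"
  have notin: "foldr (?D ?\<kappa>) xs \<phi> = foldr (?D \<kappa>) xs \<phi>" if "j \<notin> set xs" for xs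
    using that by (induction xs) auto
  have "foldr (?D ?\<kappa>) xs \<phi> = foldr (?D \<kappa>) xs (dderiv (axis j 1) \<phi>)"
    if "distinct xs" "j \<in> set xs" for xs
    using that
  proof (induction xs)
    case (Cons a xs)
    show ?case
    proof (cases "a = j")
      case True
      have "foldr (?D ?\<kappa>) (a # xs) \<phi> = (dderiv (axis j 1) ^^ Suc (\<kappa> j)) (foldr (?D \<kappa>) xs \<phi>)"
        using True Cons.prems notin by simp
      also have "\<dots> = (dderiv (axis j 1) ^^ \<kappa> j) (dderiv (axis j 1) (foldr (?D \<kappa>) xs \<phi>))"
        by (simp only: funpow_Suc_right o_apply)
      also have "\<dots> = foldr (?D \<kappa>) (a # xs) (dderiv (axis j 1) \<phi>)"
        using True foldr_dderiv_commute(1)[OF assms] by simp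
      finally show ?thesis .
    qed (use Cons in auto)
  qed simp
  then show ?thesis by (simp add: mpart_def)
qed

lemma mpart_zero_index [simp]: "mpart (\<lambda>_. 0) \<phi> = \<phi>"
proof -
  have "foldr (\<lambda>j. id) xs \<phi> = \<phi>" for xs :: "'a list" by (induction xs) auto
  then show ?thesis by (simp add: mpart_def id_def)
qed

lemma sum_bump:
  fixes \<kappa> :: "'m::finite \<Rightarrow> nat"
  shows "sum (bump j \<kappa>) UNIV = Suc (sum \<kappa> UNIV)"
proof -
  have "sum (bump j \<kappa>) (UNIV - {j}) = sum \<kappa> (UNIV - {j})"
    by (rule sum.cong) auto
  then show ?thesis by (simp add: sum.remove[of UNIV j])
qed

lemma multiindex_cases:
  fixes \<kappa> :: "'m::finite \<Rightarrow> nat"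
  obtains "\<kappa> = (\<lambda>_. 0)" | \<kappa>' j where "\<kappa> = bump j \<kappa>'"
proof (cases "\<kappa> = (\<lambda>_. 0)")
  case False
  then obtain j where j: "\<kappa> j > 0" by (auto simp: fun_eq_iff)
  then show ?thesis using that(2) bump_lower[of \<kappa> j, OF j] by metis
qed (use that in blast)

lemma multiindex_induct [case_names zero bump]:
  fixes \<kappa> :: "'m::finite \<Rightarrow> nat"
  assumes "P (\<lambda>_. 0)" "\<And>\<kappa> j. P \<kappa> \<Longrightarrow> P (bump j \<kappa>)"
  shows "P \<kappa>"
proof (induction "sum \<kappa> UNIV" arbitrary: \<kappa>)
  case 0
  from 0 have "sum \<kappa> UNIV = 0" by simp
  then have "\<kappa> = (\<lambda>_. 0)" by (simp add: fun_eq_iff)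
  then show ?case using assms(1) by simp
next
  case (Suc n)
  show ?case
  proof (cases \<kappa> rule: multiindex_cases)
    case (2 \<kappa>' j)
    then show ?thesis using Suc assms(2) sum_bump[of j \<kappa>'] by auto
  qed (use assms in auto)
qed

lemma finite_multiindex_le: "finite {\<kappa> :: 'm::finite \<Rightarrow> nat. sum \<kappa> UNIV \<le> N}"
proof (rule finite_subset)
  have "\<kappa> i \<le> sum \<kappa> UNIV" for \<kappa> :: "'m \<Rightarrow> nat" and i by (rule member_le_sum) auto
  then show "{\<kappa> :: 'm \<Rightarrow> nat. sum \<kappa> UNIV \<le> N} \<subseteq> {\<kappa>. \<forall>i. (i \<in> UNIV \<longrightarrow> \<kappa> i \<in> {..N}) \<and> (i \<notin> UNIV \<longrightarrow> \<kappa> i = 0)}"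
    using order_trans by (auto, blast)
  show "finite {\<kappa> :: 'm \<Rightarrow> nat. \<forall>i. (i \<in> UNIV \<longrightarrow> \<kappa> i \<in> {..N}) \<and> (i \<notin> UNIV \<longrightarrow> \<kappa> i = 0)}"
    by (rule finite_set_of_finite_funs) auto
qed

lemma finite_Xi [simp]: "finite (Xi k :: ('m::finite \<Rightarrow> nat) set)"
  by (rule finite_subset[OF _ finite_multiindex_le[of k]]) (auto simp: Xi_def)

lemma Xi_0: "Xi 0 = {\<lambda>_ :: 'm::finite. 0}"
  by (auto simp: Xi_def fun_eq_iff)

lemma dderiv_add:
  "smooth_open UNIV f \<Longrightarrow> smooth_open UNIV g \<Longrightarrow> dderiv v (\<lambda>x. f x + g x) = (\<lambda>x. dderiv v f x + dderiv v g x)"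
  using smooth_open_has_derivative[of UNIV f] smooth_open_has_derivative[of UNIV g]
  by (intro ext dderiv_eqI) (auto intro!: derivative_eq_intros)

lemma dderiv_mult:
  fixes f g :: "'a::real_normed_vector \<Rightarrow> complex"
  shows "smooth_open UNIV f \<Longrightarrow> smooth_open UNIV g \<Longrightarrow>
    dderiv v (\<lambda>x. f x * g x) = (\<lambda>x. dderiv v f x * g x + f x * dderiv v g x)"
  using smooth_open_has_derivative[of UNIV f] smooth_open_has_derivative[of UNIV g]
  by (intro ext dderiv_eqI) (auto intro!: derivative_eq_intros)

lemma mpart_cmult:
  fixes \<phi> :: "'m::{finite,linorder} rspace \<Rightarrow> complex"
  assumes "smooth_open UNIV \<phi>"
  shows "mpart \<kappa> (\<lambda>x. c * \<phi> x) = (\<lambda>x. c * mpart \<kappa> \<phi> x)"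
  by (rule mpart_linear_compose[OF bounded_linear_mult_right assms])

lemma mpart_const_zero [simp]: "mpart \<kappa> (\<lambda>x. 0) = (\<lambda>x. 0 :: complex)"
  using mpart_cmult[OF smooth_open_const[OF open_UNIV], of \<kappa> 0 0] by simp

lemma mpart_add:
  fixes f g :: "'m::{finite,linorder} rspace \<Rightarrow> complex"
  assumes "smooth_open UNIV f" "smooth_open UNIV g"
  shows "mpart \<kappa> (\<lambda>x. f x + g x) = (\<lambda>x. mpart \<kappa> f x + mpart \<kappa> g x)"
  using assms
  by (induction \<kappa> arbitrary: f g rule: multiindex_induct)
    (simp_all add: mpart_Suc smooth_open_add smooth_open_dderiv dderiv_add)

lemma mpart_diff:
  fixes f g :: "'m::{finite,linorder} rspace \<Rightarrow> complex"
  assumes "smooth_open UNIV f" "smooth_open UNIV g"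
  shows "mpart \<kappa> (\<lambda>x. f x - g x) = (\<lambda>x. mpart \<kappa> f x - mpart \<kappa> g x)"
  using mpart_add[OF assms(1) smooth_open_minus[OF assms(2)], of \<kappa>] mpart_cmult[OF assms(2), of \<kappa> "-1"] by simp

lemma mpart_sum:
  fixes f :: "'i \<Rightarrow> 'm::{finite,linorder} rspace \<Rightarrow> complex"
  assumes "\<And>i. i \<in> I \<Longrightarrow> smooth_open UNIV (f i)"
  shows "mpart \<kappa> (\<lambda>x. \<Sum>i\<in>I. f i x) = (\<lambda>x. \<Sum>i\<in>I. mpart \<kappa> (f i) x)"
  using assms
  by (induction I rule: infinite_finite_induct) (simp_all add: mpart_add smooth_open_sum)

lemma mpart_translate:
  fixes \<phi> :: "'m::{finite,linorder} rspace \<Rightarrow> complex"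
  assumes "smooth_open UNIV \<phi>"
  shows "mpart \<kappa> (\<lambda>x. \<phi> (a + x)) = (\<lambda>x. mpart \<kappa> \<phi> (a + x))"
  using assms
proof (induction \<kappa> arbitrary: \<phi> rule: multiindex_induct)
  case (bump \<kappa> j)
  have s: "smooth_open UNIV (\<lambda>x. \<phi> (a + x))"
    using smooth_open_affine[OF bounded_linear_ident bump.prems, of a] by simp
  have "dderiv (axis j 1) (\<lambda>x. \<phi> (a + x)) = (\<lambda>x. dderiv (axis j 1) \<phi> (a + x))"
    using dderiv_affine(1)[OF bounded_linear_ident smooth_open_differentiable[OF bump.prems]] by auto
  then show ?case using bump.IH[OF smooth_open_dderiv[OF bump.prems]] bump.prems s by (simp add: mpart_Suc)
qed simp

lemma mpart_scale:
  fixes \<phi> :: "'m::{finite,linorder} rspace \<Rightarrow> complex"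
  assumes "smooth_open UNIV \<phi>"
  shows "mpart \<kappa> (\<lambda>x. \<phi> (s *\<^sub>R x)) = (\<lambda>x. of_real s ^ sum \<kappa> UNIV * mpart \<kappa> \<phi> (s *\<^sub>R x))"
  using assms
proof (induction \<kappa> arbitrary: \<phi> rule: multiindex_induct)
  case (bump \<kappa> j)
  have L: "bounded_linear ((*\<^sub>R) s :: 'm rspace \<Rightarrow> _)" by (rule bounded_linear_scaleR_right)
  have s: "smooth_open UNIV (\<lambda>x. \<phi> (s *\<^sub>R x))"
    using smooth_open_affine[OF L bump.prems, of 0] by simp
  have "dderiv (axis j 1) (\<lambda>x. \<phi> (s *\<^sub>R x)) x = of_real s * dderiv (axis j 1) \<phi> (s *\<^sub>R x)" for x
  proof -
    have "dderiv (axis j 1) (\<lambda>x. \<phi> (s *\<^sub>R x)) x = dderiv (s *\<^sub>R axis j 1) \<phi> (s *\<^sub>R x)"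
      using dderiv_affine(1)[OF L, of \<phi> 0 x] smooth_open_differentiable[OF bump.prems] by simp
    also have "\<dots> = s *\<^sub>R dderiv (axis j 1) \<phi> (s *\<^sub>R x)"
      using linear_scale[OF has_derivative_linear[OF smooth_open_has_derivative[OF bump.prems UNIV_I]]] .
    finally show ?thesis by (simp add: scaleR_conv_of_real)
  qed
  then have e: "dderiv (axis j 1) (\<lambda>x. \<phi> (s *\<^sub>R x)) = (\<lambda>x. of_real s * dderiv (axis j 1) \<phi> (s *\<^sub>R x))" ..
  have s': "smooth_open UNIV (\<lambda>x. dderiv (axis j 1) \<phi> (s *\<^sub>R x))"
    using smooth_open_affine[OF L smooth_open_dderiv[OF bump.prems], of 0] by simp
  have "mpart (bump j \<kappa>) (\<lambda>x. \<phi> (s *\<^sub>R x)) = mpart \<kappa> (\<lambda>x. of_real s * dderiv (axis j 1) \<phi> (s *\<^sub>R x))"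
    unfolding mpart_Suc[OF s] e ..
  also have "\<dots> = (\<lambda>x. of_real s * mpart \<kappa> (\<lambda>x. dderiv (axis j 1) \<phi> (s *\<^sub>R x)) x)"
    by (rule mpart_cmult[OF s'])
  also have "\<dots> = (\<lambda>x. of_real s ^ sum (bump j \<kappa>) UNIV * mpart (bump j \<kappa>) \<phi> (s *\<^sub>R x))"
    unfolding bump.IH[OF smooth_open_dderiv[OF bump.prems]] mpart_Suc[OF bump.prems] sum_bump by (simp add: mult.assoc)
  finally show ?case .
qed simp

section \<open>Monomials and Taylor polynomials\<close>

definition cvec :: "'m::finite rspace \<Rightarrow> 'm cspace" where
  "cvec x = (\<chi> i. complex_of_real (x $ i))"

lemma cvec_nth [simp]: "cvec x $ i = of_real (x $ i)" by (simp add: cvec_def)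

lemma cvec_zero [simp]: "cvec 0 = 0" by (simp add: vec_eq_iff)

text \<open>Monomials normalized as divided powers, for which differentiation lowers an exponent
  without a numerical factor.\<close>

definition dmono :: "('m::finite \<Rightarrow> nat) \<Rightarrow> 'm::finite cspace \<Rightarrow> complex" where
  "dmono \<kappa> y = monomial \<kappa> y / (\<Prod>j\<in>UNIV. fact (\<kappa> j))"

lemma dmono_alt: "dmono \<kappa> y = (\<Prod>j\<in>UNIV. (y $ j) ^ \<kappa> j / fact (\<kappa> j))"
  by (simp add: dmono_def monomial_def prod_dividef)

lemma dmono_split: "dmono \<kappa> y = (y $ i) ^ \<kappa> i / fact (\<kappa> i) * (\<Prod>j\<in>UNIV - {i}. (y $ j) ^ \<kappa> j / fact (\<kappa> j))"
  unfolding dmono_alt by (rule prod.remove) auto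

lemma dmono_bump: "of_nat (Suc (\<kappa> j)) * dmono (bump j \<kappa>) y = y $ j * dmono \<kappa> y"
proof -
  have "(\<Prod>i\<in>UNIV - {j}. (y $ i) ^ bump j \<kappa> i / fact (bump j \<kappa> i)) =
      (\<Prod>i\<in>UNIV - {j}. (y $ i) ^ \<kappa> i / fact (\<kappa> i))" by (rule prod.cong) auto
  moreover have "of_nat (Suc n) * (a ^ Suc n / fact (Suc n) * R) = a * (a ^ n / fact n * R)" for a R :: complex and n
    by (simp add: fact_Suc del: of_nat_Suc)
  ultimately show ?thesis unfolding dmono_split[of _ _ j] bump_same by metis
qed

lemma smooth_cvec_nth: "smooth_open UNIV (\<lambda>x. cvec x $ i)"
  unfolding cvec_nth
  by (intro smooth_open_bounded_linear bounded_linear_compose[OF bounded_linear_of_real] bounded_linear_vec_nth) auto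

lemma smooth_dmono: "smooth_open UNIV (\<lambda>x. dmono \<kappa> (cvec x))"
  unfolding dmono_def monomial_def divide_inverse
  by (intro smooth_open_mult smooth_open_prod smooth_open_power smooth_cvec_nth smooth_open_const open_UNIV)

lemma dmono_zero: "dmono \<kappa> 0 = (if \<kappa> = (\<lambda>_. 0) then 1 else 0)"
proof (cases "\<kappa> = (\<lambda>_. 0)")
  case False
  then obtain j where "\<kappa> j \<noteq> 0" by (auto simp: fun_eq_iff)
  then show ?thesis using False by (simp add: dmono_split[of _ _ j])
qed (simp add: dmono_alt)

lemma dderiv_dmono_bump:
  "dderiv (axis j 1) (\<lambda>x. dmono (bump j \<kappa>) (cvec x)) = (\<lambda>x. dmono \<kappa> (cvec x))"
proof
  fix x :: "real^'a"
  define C where "C = (\<Prod>i\<in>UNIV - {j}. (cvec x $ i) ^ \<kappa> i / fact (\<kappa> i))"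
  let ?f = "\<lambda>x. dmono (bump j \<kappa>) (cvec x)"
  define h where "h = (\<lambda>w. (of_real (x $ j) + w) ^ Suc (\<kappa> j) / fact (Suc (\<kappa> j)) * C)"
  have "(\<Prod>i\<in>UNIV - {j}. (cvec (x + t *\<^sub>R axis j 1) $ i) ^ bump j \<kappa> i / fact (bump j \<kappa> i)) = C" for t
    unfolding C_def by (rule prod.cong) (auto simp: axis_def)
  then have "?f (x + t *\<^sub>R axis j 1) = h (of_real t)" for t
    unfolding dmono_split[of _ _ j] h_def by (simp add: axis_def del: fact_Suc power_Suc)
  moreover have "(h has_field_derivative (of_nat (Suc (\<kappa> j)) * of_real (x $ j) ^ \<kappa> j / fact (Suc (\<kappa> j)) * C)) (at (of_real 0))"
    unfolding h_def by (auto intro!: derivative_eq_intros simp del: fact_Suc power_Suc)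
  then have "((\<lambda>t. h (of_real t)) has_vector_derivative
      (of_nat (Suc (\<kappa> j)) * of_real (x $ j) ^ \<kappa> j / fact (Suc (\<kappa> j)) * C)) (at 0)"
    by (rule has_vector_derivative_real_field)
  moreover have "of_nat (Suc (\<kappa> j)) * of_real (x $ j) ^ \<kappa> j / fact (Suc (\<kappa> j)) * C = dmono \<kappa> (cvec x)"
    unfolding dmono_split[of _ _ j] C_def[symmetric] by (simp add: fact_Suc del: of_nat_Suc)
  ultimately have "((\<lambda>t. ?f (x + t *\<^sub>R axis j 1)) has_vector_derivative dmono \<kappa> (cvec x)) (at 0)" by simp
  then show "dderiv (axis j 1) ?f x = dmono \<kappa> (cvec x)"
    using vector_derivative_unique_at[OF has_vector_derivative_along_line[OF smooth_dmono, of "bump j \<kappa>" x "axis j 1" 0]] by simp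
qed

lemma dderiv_dmono_0:
  assumes "\<kappa> j = 0"
  shows "dderiv (axis j 1) (\<lambda>x. dmono \<kappa> (cvec x)) = (\<lambda>x. 0)"
proof
  fix x :: "real^'a"
  let ?f = "\<lambda>x. dmono \<kappa> (cvec x)"
  have "?f (x + t *\<^sub>R axis j 1) = ?f x" for t
    unfolding dmono_alt using assms by (intro prod.cong) (auto simp: axis_def)
  then have "((\<lambda>t. ?f (x + t *\<^sub>R axis j 1)) has_vector_derivative 0) (at 0)" by simp
  then show "dderiv (axis j 1) ?f x = 0"
    using vector_derivative_unique_at[OF has_vector_derivative_along_line[OF smooth_dmono, of \<kappa> x "axis j 1" 0]] by simp
qed

text \<open>The partial derivatives at the origin form the dual basis of the divided-power monomials; in
  particular the coefficients of a polynomial can be read off from its values at real points.\<close>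

lemma mpart_dmono_zero: "mpart \<kappa>' (\<lambda>x. dmono \<kappa> (cvec x)) 0 = (if \<kappa> = \<kappa>' then 1 else 0)"
proof (induction \<kappa>' arbitrary: \<kappa> rule: multiindex_induct)
  case zero
  show ?case by (simp add: dmono_zero)
next
  case (bump \<kappa>' j)
  show ?case
  proof (cases "\<kappa> j")
    case 0
    then have "\<kappa> \<noteq> bump j \<kappa>'" by auto
    then show ?thesis using 0 by (simp add: mpart_Suc[OF smooth_dmono] dderiv_dmono_0)
  next
    case (Suc n)
    then have 1: "bump j (\<kappa>(j := n)) = \<kappa>" using bump_lower[of \<kappa> j] by simp
    have 2: "dderiv (axis j 1) (\<lambda>x. dmono \<kappa> (cvec x)) = (\<lambda>x. dmono (\<kappa>(j := n)) (cvec x))"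
      using dderiv_dmono_bump[of j "\<kappa>(j := n)"] unfolding 1 .
    have 3: "\<kappa>(j := n) = \<kappa>' \<longleftrightarrow> \<kappa> = bump j \<kappa>'" using Suc 1 by (auto simp: bump_def)
    show ?thesis unfolding mpart_Suc[OF smooth_dmono] 2 bump.IH 3 ..
  qed
qed

text \<open>Vanishing of all partial derivatives of order at most \<open>N\<close> at the origin, with the derivatives
  taken in any order; in this form stability under multiplication is an immediate induction.\<close>

fun flat :: "nat \<Rightarrow> ('m::finite rspace \<Rightarrow> complex) \<Rightarrow> bool" where
  "flat 0 \<phi> \<longleftrightarrow> \<phi> 0 = 0"
| "flat (Suc N) \<phi> \<longleftrightarrow> \<phi> 0 = 0 \<and> (\<forall>j. flat N (dderiv (axis j 1) \<phi>))"

lemma flat_iff_mpart: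
  fixes \<phi> :: "'m::{finite,linorder} rspace \<Rightarrow> complex"
  assumes "smooth_open UNIV \<phi>"
  shows "flat N \<phi> \<longleftrightarrow> (\<forall>\<kappa>. sum \<kappa> UNIV \<le> N \<longrightarrow> mpart \<kappa> \<phi> 0 = 0)"
  using assms
proof (induction N arbitrary: \<phi>)
  case 0
  have "sum \<kappa> UNIV \<le> 0 \<longleftrightarrow> \<kappa> = (\<lambda>_. 0)" for \<kappa> :: "'m \<Rightarrow> nat" by (simp add: fun_eq_iff)
  then show ?case by simp
next
  case (Suc N)
  have IH: "flat N (dderiv (axis j 1) \<phi>) \<longleftrightarrow> (\<forall>\<kappa>. sum \<kappa> UNIV \<le> N \<longrightarrow> mpart (bump j \<kappa>) \<phi> 0 = 0)" for j
    using Suc.IH[OF smooth_open_dderiv[OF Suc.prems]] Suc.prems by (simp add: mpart_Suc)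
  show ?case
  proof
    assume L: "flat (Suc N) \<phi>"
    show "\<forall>\<kappa>. sum \<kappa> UNIV \<le> Suc N \<longrightarrow> mpart \<kappa> \<phi> 0 = 0"
    proof (intro allI impI)
      fix \<kappa> :: "'m \<Rightarrow> nat" assume le: "sum \<kappa> UNIV \<le> Suc N"
      show "mpart \<kappa> \<phi> 0 = 0"
      proof (cases \<kappa> rule: multiindex_cases)
        case 1
        then show ?thesis using L by simp
      next
        case (2 \<kappa>' j)
        then have "sum \<kappa>' UNIV \<le> N" using le sum_bump[of j \<kappa>'] by simp
        then show ?thesis using L IH[of j] 2 by simp
      qed
    qed
  next
    assume R: "\<forall>\<kappa>. sum \<kappa> UNIV \<le> Suc N \<longrightarrow> mpart \<kappa> \<phi> 0 = 0"
    have "\<phi> 0 = 0" using R[rule_format, of "\<lambda>_. 0"] by simp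
    moreover have "flat N (dderiv (axis j 1) \<phi>)" for j
      unfolding IH using R sum_bump by (metis Suc_le_mono)
    ultimately show "flat (Suc N) \<phi>" by simp
  qed
qed

lemma flat_SucD: "flat (Suc N) \<phi> \<Longrightarrow> flat N \<phi>"
  by (induction N arbitrary: \<phi>) auto

lemma flat_add:
  "smooth_open UNIV f \<Longrightarrow> smooth_open UNIV g \<Longrightarrow> flat N f \<Longrightarrow> flat N g \<Longrightarrow> flat N (\<lambda>x. f x + g x)"
  by (induction N arbitrary: f g) (auto simp: dderiv_add smooth_open_dderiv)

lemma flat_mult:
  "smooth_open UNIV w \<Longrightarrow> smooth_open UNIV f \<Longrightarrow> flat N f \<Longrightarrow> flat N (\<lambda>x. w x * f x)"
proof (induction N arbitrary: w f)
  case (Suc N)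
  then show ?case
    using flat_SucD[OF Suc.prems(3)]
    by (auto simp: dderiv_mult intro!: flat_add smooth_open_mult smooth_open_dderiv)
qed auto

text \<open>The jets of products of a nowhere vanishing function with polynomials are arbitrary:
  divide a function with the wanted jet by the given one and take the Taylor polynomial.\<close>

lemma exists_polynomial_multiple_with_jet:
  fixes w w' :: "'m::{finite,linorder} rspace \<Rightarrow> complex"
  assumes w: "smooth_open UNIV w" and w': "smooth_open UNIV w'" and ww': "\<And>x. w x * w' x = 1"
  shows "\<exists>d. \<forall>\<kappa>. sum \<kappa> UNIV \<le> N \<longrightarrow>
    mpart \<kappa> (\<lambda>x. w x * (\<Sum>\<kappa> | sum \<kappa> UNIV \<le> N. d \<kappa> * dmono \<kappa> (cvec x))) 0 = c \<kappa>"
proof -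
  define q where "q = (\<lambda>c x. \<Sum>\<kappa> | sum \<kappa> UNIV \<le> N. c \<kappa> * dmono \<kappa> (cvec (x :: 'm rspace)))"
  have sq: "smooth_open UNIV (q c)" for c
    unfolding q_def by (intro smooth_open_sum smooth_open_mult smooth_open_const smooth_dmono open_UNIV)
  have mq: "mpart \<kappa> (q c) 0 = c \<kappa>" if "sum \<kappa> UNIV \<le> N" for \<kappa> c
  proof -
    have "mpart \<kappa> (q c) 0 = (\<Sum>\<kappa>' | sum \<kappa>' UNIV \<le> N. mpart \<kappa> (\<lambda>x. c \<kappa>' * dmono \<kappa>' (cvec x)) 0)"
      unfolding q_def by (subst mpart_sum) (auto intro!: smooth_open_mult smooth_open_const smooth_dmono)
    also have "\<dots> = (\<Sum>\<kappa>' | sum \<kappa>' UNIV \<le> N. if \<kappa>' = \<kappa> then c \<kappa>' else 0)"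
      by (intro sum.cong) (auto simp: mpart_cmult[OF smooth_dmono] mpart_dmono_zero)
    also have "\<dots> = c \<kappa>" using that by (subst sum.delta[OF finite_multiindex_le]) simp
    finally show ?thesis .
  qed
  define d where "d = (\<lambda>\<kappa>. mpart \<kappa> (\<lambda>x. w' x * q c x) 0)"
  have s1: "smooth_open UNIV (\<lambda>x. w' x * q c x)" by (intro smooth_open_mult w' sq)
  have s2: "smooth_open UNIV (\<lambda>x. w' x * q c x - q d x)" by (intro smooth_open_diff s1 sq)
  have s3: "smooth_open UNIV (\<lambda>x. w x * q d x)" by (intro smooth_open_mult w sq)
  have "flat N (\<lambda>x. w' x * q c x - q d x)"
    unfolding flat_iff_mpart[OF s2] mpart_diff[OF s1 sq] by (simp add: mq) (simp add: d_def)
  then have "flat N (\<lambda>x. w x * (w' x * q c x - q d x))" by (rule flat_mult[OF w s2])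
  moreover have "(\<lambda>x. w x * (w' x * q c x - q d x)) = (\<lambda>x. q c x - w x * q d x)"
    using ww' by (simp add: right_diff_distrib mult.assoc[symmetric])
  ultimately have "mpart \<kappa> (\<lambda>x. q c x - w x * q d x) 0 = 0" if "sum \<kappa> UNIV \<le> N" for \<kappa>
    using that flat_iff_mpart[OF smooth_open_diff[OF sq s3]] by simp
  then have "mpart \<kappa> (\<lambda>x. w x * q d x) 0 = c \<kappa>" if "sum \<kappa> UNIV \<le> N" for \<kappa>
    using that mq by (simp add: mpart_diff[OF sq s3])
  then show ?thesis by (intro exI[of _ d]) (simp add: q_def)
qed

section \<open>The homogeneous parts of Taylor expansions\<close>

text \<open>The homogeneous part of degree \<open>k\<close> of the Taylor expansion of \<open>\<phi>\<close> at \<open>x\<close>, as a polynomial in the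
  increment, which is allowed to be complex.\<close>

definition taylor :: "nat \<Rightarrow> ('m::{finite,linorder} rspace \<Rightarrow> complex) \<Rightarrow> 'm rspace
    \<Rightarrow> 'm cspace \<Rightarrow> complex" where
  "taylor k \<phi> x = (\<lambda>y. \<Sum>\<kappa>\<in>Xi k. mpart \<kappa> \<phi> x * dmono \<kappa> y)"

lemma Pol_iff_dmono: "p \<in> Pol k \<longleftrightarrow> (\<exists>c. p = (\<lambda>y. \<Sum>\<kappa>\<in>Xi k. c \<kappa> * dmono \<kappa> y))"
proof
  assume "p \<in> Pol k"
  then obtain c where "p = (\<lambda>y. \<Sum>\<kappa>\<in>Xi k. c \<kappa> * monomial \<kappa> y)" by (auto simp: Pol_def)
  then have "p = (\<lambda>y. \<Sum>\<kappa>\<in>Xi k. (c \<kappa> * (\<Prod>j\<in>UNIV. fact (\<kappa> j))) * dmono \<kappa> y)"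
    by (simp add: dmono_def)
  then show "\<exists>c. p = (\<lambda>y. \<Sum>\<kappa>\<in>Xi k. c \<kappa> * dmono \<kappa> y)"
    by (intro exI[of _ "\<lambda>\<kappa>. c \<kappa> * (\<Prod>j\<in>UNIV. fact (\<kappa> j))"])
next
  assume "\<exists>c. p = (\<lambda>y. \<Sum>\<kappa>\<in>Xi k. c \<kappa> * dmono \<kappa> y)"
  then obtain c where "p = (\<lambda>y. \<Sum>\<kappa>\<in>Xi k. c \<kappa> * dmono \<kappa> y)" ..
  then have "p = (\<lambda>y. \<Sum>\<kappa>\<in>Xi k. (c \<kappa> / (\<Prod>j\<in>UNIV. fact (\<kappa> j))) * monomial \<kappa> y)"
    by (simp add: dmono_def)
  then show "p \<in> Pol k"
    unfolding Pol_def mem_Collect_eq by (intro exI[of _ "\<lambda>\<kappa>. c \<kappa> / (\<Prod>j\<in>UNIV. fact (\<kappa> j))"])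
qed

lemma taylor_in_Pol: "taylor k \<phi> x \<in> Pol k"
  unfolding Pol_iff_dmono taylor_def by (rule exI[of _ "\<lambda>\<kappa>. mpart \<kappa> \<phi> x"]) (rule refl)

lemma smooth_Pol:
  assumes "p \<in> Pol k"
  shows "smooth_open UNIV (\<lambda>x. p (cvec x))"
proof -
  obtain c where p: "p = (\<lambda>y. \<Sum>\<kappa>\<in>Xi k. c \<kappa> * dmono \<kappa> y)" using assms Pol_iff_dmono by blast
  show ?thesis
    unfolding p by (intro smooth_open_sum smooth_open_mult smooth_open_const smooth_dmono open_UNIV)
qed

lemma mpart_Pol:
  assumes "p = (\<lambda>y. \<Sum>\<kappa>\<in>Xi k. c \<kappa> * dmono \<kappa> y)"
  shows "mpart \<kappa> (\<lambda>x. p (cvec x)) 0 = (if \<kappa> \<in> Xi k then c \<kappa> else 0)"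
proof -
  have "mpart \<kappa> (\<lambda>x. p (cvec x)) 0 = (\<Sum>\<kappa>'\<in>Xi k. mpart \<kappa> (\<lambda>x. c \<kappa>' * dmono \<kappa>' (cvec x)) 0)"
    unfolding assms by (subst mpart_sum) (auto intro!: smooth_open_mult smooth_open_const smooth_dmono)
  also have "\<dots> = (\<Sum>\<kappa>'\<in>Xi k. if \<kappa>' = \<kappa> then c \<kappa>' else 0)"
    by (intro sum.cong) (auto simp: mpart_cmult[OF smooth_dmono] mpart_dmono_zero)
  also have "\<dots> = (if \<kappa> \<in> Xi k then c \<kappa> else 0)" by (simp add: sum.delta)
  finally show ?thesis .
qed

lemma taylor_Pol:
  assumes "p \<in> Pol k"
  shows "taylor k (\<lambda>x. p (cvec x)) 0 = p"
proof -
  obtain c where p: "p = (\<lambda>y. \<Sum>\<kappa>\<in>Xi k. c \<kappa> * dmono \<kappa> y)" using assms Pol_iff_dmono by blast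
  show ?thesis unfolding taylor_def mpart_Pol[OF p] by (simp add: p cong: sum.cong)
qed

lemma Pol_eqI:
  fixes p q :: "'m::{finite,linorder} cspace \<Rightarrow> complex"
  assumes "p \<in> Pol k" "q \<in> Pol k" "\<And>x. p (cvec x) = q (cvec x)"
  shows "p = q"
proof -
  have "p = taylor k (\<lambda>x. p (cvec x)) 0" by (rule taylor_Pol[OF assms(1), symmetric])
  also have "\<dots> = taylor k (\<lambda>x. q (cvec x)) 0" by (subst assms(3)) (rule refl)
  also have "\<dots> = q" by (rule taylor_Pol[OF assms(2)])
  finally show ?thesis .
qed

text \<open>Euler's relation: each monomial of degree \<open>k + 1\<close> is counted once for every unit of its exponents.\<close>

lemma sum_Xi_Suc:
  fixes A :: "('m::finite \<Rightarrow> nat) \<Rightarrow> complex"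
  shows "of_nat (Suc k) * (\<Sum>\<kappa>\<in>Xi (Suc k). A \<kappa> * dmono \<kappa> z) =
    (\<Sum>j\<in>UNIV. z $ j * (\<Sum>\<kappa>\<in>Xi k. A (bump j \<kappa>) * dmono \<kappa> z))"
proof -
  have "of_nat (Suc k) * (\<Sum>\<kappa>\<in>Xi (Suc k). A \<kappa> * dmono \<kappa> z) =
      (\<Sum>\<kappa>\<in>Xi (Suc k). \<Sum>j\<in>UNIV. of_nat (\<kappa> j) * (A \<kappa> * dmono \<kappa> z))"
    unfolding sum_distrib_left
    by (intro sum.cong refl) (auto simp: Xi_def sum_distrib_right[symmetric] of_nat_sum[symmetric] simp del: of_nat_sum of_nat_Suc)
  also have "\<dots> = (\<Sum>j\<in>UNIV. \<Sum>\<kappa>\<in>Xi (Suc k). of_nat (\<kappa> j) * (A \<kappa> * dmono \<kappa> z))"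
    by (rule sum.swap)
  also have "\<dots> = (\<Sum>j\<in>UNIV. z $ j * (\<Sum>\<kappa>\<in>Xi k. A (bump j \<kappa>) * dmono \<kappa> z))"
  proof (intro sum.cong refl)
    fix j :: 'm
    have "(\<Sum>\<kappa>\<in>Xi (Suc k). of_nat (\<kappa> j) * (A \<kappa> * dmono \<kappa> z)) =
        (\<Sum>\<kappa>\<in>{\<kappa>\<in>Xi (Suc k). \<kappa> j > 0}. of_nat (\<kappa> j) * (A \<kappa> * dmono \<kappa> z))"
      by (intro sum.mono_neutral_right) auto
    also have "\<dots> = (\<Sum>\<kappa>\<in>Xi k. of_nat (Suc (\<kappa> j)) * (A (bump j \<kappa>) * dmono (bump j \<kappa>) z))"
    proof (rule sum.reindex_bij_witness[of _ "bump j" "\<lambda>\<kappa>. \<kappa>(j := \<kappa> j - 1)"])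
      fix \<kappa> :: "'m \<Rightarrow> nat" assume a: "\<kappa> \<in> {\<kappa>\<in>Xi (Suc k). \<kappa> j > 0}"
      then have e: "bump j (\<kappa>(j := \<kappa> j - 1)) = \<kappa>" by (intro bump_lower) simp
      show "\<kappa>(j := \<kappa> j - 1) \<in> Xi k"
        using sum_bump[of j "\<kappa>(j := \<kappa> j - 1)"] a unfolding e by (simp add: Xi_def)
      show "bump j (\<kappa>(j := \<kappa> j - 1)) = \<kappa>" by (rule e)
      show "of_nat (Suc ((\<kappa>(j := \<kappa> j - 1)) j)) * (A (bump j (\<kappa>(j := \<kappa> j - 1))) *
          dmono (bump j (\<kappa>(j := \<kappa> j - 1))) z) = of_nat (\<kappa> j) * (A \<kappa> * dmono \<kappa> z)"
        unfolding e using a by simp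
    qed (auto simp: Xi_def sum_bump lower_bump[simplified])
    also have "\<dots> = (\<Sum>\<kappa>\<in>Xi k. z $ j * (A (bump j \<kappa>) * dmono \<kappa> z))"
      by (intro sum.cong refl) (metis (no_types, lifting) dmono_bump mult.left_commute)
    finally show "(\<Sum>\<kappa>\<in>Xi (Suc k). of_nat (\<kappa> j) * (A \<kappa> * dmono \<kappa> z)) =
        z $ j * (\<Sum>\<kappa>\<in>Xi k. A (bump j \<kappa>) * dmono \<kappa> z)"
      by (simp add: sum_distrib_left)
  qed
  finally show ?thesis .
qed

text \<open>Up to factorials the \<open>taylor k \<phi>\<close> are the successive derivatives along a line; this turns statements about
  them into statements about functions of one real variable.\<close>

lemma taylor_line_derivative:
  assumes "smooth_open UNIV \<phi>"
  shows "((\<lambda>t. taylor k \<phi> (t *\<^sub>R z) (cvec z)) has_vector_derivative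
    of_nat (Suc k) * taylor (Suc k) \<phi> (t *\<^sub>R z) (cvec z)) (at t)"
proof -
  have "((\<lambda>t. mpart \<kappa> \<phi> (t *\<^sub>R z)) has_vector_derivative
      (\<Sum>j\<in>UNIV. cvec z $ j * mpart (bump j \<kappa>) \<phi> (t *\<^sub>R z))) (at t)" for \<kappa>
  proof -
    have s: "smooth_open UNIV (mpart \<kappa> \<phi>)" using smooth_mpart assms by blast
    have 2: "(mpart \<kappa> \<phi> has_derivative (\<lambda>v. dderiv v (mpart \<kappa> \<phi>) (t *\<^sub>R z))) (at (t *\<^sub>R z))"
      using smooth_open_has_derivative[OF s] by simp
    have "((\<lambda>t. mpart \<kappa> \<phi> (t *\<^sub>R z)) has_vector_derivative dderiv z (mpart \<kappa> \<phi>) (t *\<^sub>R z)) (at t)"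
      using has_vector_derivative_along_line[OF s, of 0 z t] by simp
    moreover have "dderiv z (mpart \<kappa> \<phi>) (t *\<^sub>R z) = (\<Sum>j\<in>UNIV. z $ j *\<^sub>R dderiv (axis j 1) (mpart \<kappa> \<phi>) (t *\<^sub>R z))"
      using linear_sum[OF has_derivative_linear[OF 2], of "\<lambda>j. z $ j *\<^sub>R axis j 1" UNIV]
        linear_scale[OF has_derivative_linear[OF 2]]
      by (simp add: basis_expansion scalar_mult_eq_scaleR[symmetric])
    ultimately show ?thesis
      by (simp add: dderiv_mpart[OF assms] mpart_Suc[OF assms] scaleR_conv_of_real)
  qed
  then have "((\<lambda>t. taylor k \<phi> (t *\<^sub>R z) (cvec z)) has_vector_derivative
     (\<Sum>\<kappa>\<in>Xi k. (\<Sum>j\<in>UNIV. cvec z $ j * mpart (bump j \<kappa>) \<phi> (t *\<^sub>R z)) * dmono \<kappa> (cvec z))) (at t)"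
    unfolding taylor_def by (intro has_vector_derivative_sum has_vector_derivative_mult_left) auto
  moreover have "(\<Sum>\<kappa>\<in>Xi k. (\<Sum>j\<in>UNIV. cvec z $ j * mpart (bump j \<kappa>) \<phi> (t *\<^sub>R z)) * dmono \<kappa> (cvec z)) =
      of_nat (Suc k) * taylor (Suc k) \<phi> (t *\<^sub>R z) (cvec z)"
  proof -
    have "(\<Sum>\<kappa>\<in>Xi k. (\<Sum>j\<in>UNIV. cvec z $ j * mpart (bump j \<kappa>) \<phi> (t *\<^sub>R z)) * dmono \<kappa> (cvec z)) =
        (\<Sum>j\<in>UNIV. \<Sum>\<kappa>\<in>Xi k. cvec z $ j * (mpart (bump j \<kappa>) \<phi> (t *\<^sub>R z) * dmono \<kappa> (cvec z)))"
      unfolding sum_distrib_right mult.assoc by (rule sum.swap)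
    then show ?thesis unfolding taylor_def sum_Xi_Suc by (simp only: sum_distrib_left)
  qed
  ultimately show ?thesis by simp
qed

section \<open>Projective changes of the parameter of a line\<close>

definition deriv_chain :: "real set \<Rightarrow> (nat \<Rightarrow> real \<Rightarrow> complex) \<Rightarrow> bool" where
  "deriv_chain S u \<longleftrightarrow> (\<forall>i. \<forall>t\<in>S. (u i has_vector_derivative u (Suc i) t) (at t))"

lemma deriv_chain_unique:
  assumes "open S" "deriv_chain S u" "deriv_chain S v" "\<And>t. t \<in> S \<Longrightarrow> u 0 t = v 0 t" "t \<in> S"
  shows "u k t = v k t"
  using assms(5)
proof (induction k arbitrary: t)
  case (Suc k)
  have "(u k has_vector_derivative u (Suc k) t) (at t)" "(v k has_vector_derivative v (Suc k) t) (at t)"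
    using assms(2,3) Suc.prems by (auto simp: deriv_chain_def)
  moreover have "(v k has_vector_derivative u (Suc k) t) (at t)"
    by (rule has_vector_derivative_transform_within_open[OF calculation(1) assms(1) Suc.prems Suc.IH])
  ultimately show ?case using vector_derivative_unique_at by blast
qed (use assms in blast)

text \<open>With $s = t/(1+ct)$ the derivative of $(1+ct)^\mu u(s)$ is $(1+ct)^{\mu-1} v(s)$ where
  $v = c\mu u + (1-cs)u'$; the chain of derivatives of \<open>v\<close> is given in terms of that of \<open>u\<close>.\<close>

definition bol_step :: "real \<Rightarrow> complex \<Rightarrow> (nat \<Rightarrow> real \<Rightarrow> complex) \<Rightarrow> nat \<Rightarrow> real \<Rightarrow> complex" where
  "bol_step c \<mu> u i s = of_real c * (\<mu> - of_nat i) * u i s + (1 - of_real (c * s)) * u (Suc i) s"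

text \<open>Component \<open>0\<close> of the \<open>k\<close>-th iterate is, up to the factor $(1+ct)^{\mu-k}$, the \<open>k\<close>-th derivative of
  $(1+ct)^\mu u(s)$.\<close>

fun bol_iter :: "real \<Rightarrow> complex \<Rightarrow> (nat \<Rightarrow> real \<Rightarrow> complex) \<Rightarrow> nat \<Rightarrow> nat \<Rightarrow> real \<Rightarrow> complex" where
  "bol_iter c \<mu> u 0 = u"
| "bol_iter c \<mu> u (Suc k) = bol_iter c (\<mu> - 1) (bol_step c \<mu> u) k"

lemma deriv_chain_bol_step:
  assumes "deriv_chain UNIV u"
  shows "deriv_chain UNIV (bol_step c \<mu> u)"
  unfolding deriv_chain_def
proof (intro allI ballI)
  fix i t
  have 1: "(u j has_vector_derivative u (Suc j) t) (at t)" for j using assms by (simp add: deriv_chain_def)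
  have 2: "((\<lambda>s. 1 - complex_of_real (c * s)) has_vector_derivative - of_real c) (at t)"
    by (auto intro!: derivative_eq_intros simp: has_vector_derivative_def scaleR_conv_of_real)
  have "((\<lambda>s. of_real c * (\<mu> - of_nat i) * u i s + (1 - of_real (c * s)) * u (Suc i) s) has_vector_derivative
      of_real c * (\<mu> - of_nat i) * u (Suc i) t + ((1 - of_real (c * t)) * u (Suc (Suc i)) t + - of_real c * u (Suc i) t)) (at t)"
    by (intro has_vector_derivative_add has_vector_derivative_mult_right has_vector_derivative_mult 1 2)
  then show "(bol_step c \<mu> u i has_vector_derivative bol_step c \<mu> u (Suc i) t) (at t)"
    unfolding bol_step_def by (simp add: algebra_simps)
qed

lemma deriv_chain_bol:
  assumes "deriv_chain UNIV u"
  shows "deriv_chain {t. 1 + c * t > 0}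
    (\<lambda>k t. cpow (\<mu> - of_nat k) (1 + c * t) * bol_iter c \<mu> u k 0 (t / (1 + c * t)))"
  unfolding deriv_chain_def
proof (intro allI ballI)
  fix k t assume t: "t \<in> {t. 1 + c * t > 0}"
  let ?r = "1 + c * t"
  have r: "?r > 0" using t by simp
  from assms show "((\<lambda>t. cpow (\<mu> - of_nat k) (1 + c * t) * bol_iter c \<mu> u k 0 (t / (1 + c * t))) has_vector_derivative
     cpow (\<mu> - of_nat (Suc k)) ?r * bol_iter c \<mu> u (Suc k) 0 (t / ?r)) (at t)"
  proof (induction k arbitrary: \<mu> u)
    case 0
    have 1: "((\<lambda>t. 1 + c * t) has_derivative (\<lambda>h. c * h)) (at t)"
      by (auto intro!: derivative_eq_intros)
    have 2: "((\<lambda>t. cpow \<mu> (1 + c * t)) has_vector_derivative \<mu> * cpow (\<mu> - 1) ?r * of_real c) (at t)"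
      using has_derivative_cpow[OF 1 r, of \<mu>]
      by (simp add: has_vector_derivative_def scaleR_conv_of_real mult_ac)
    have 3: "((\<lambda>t. t / (1 + c * t)) has_vector_derivative 1 / ?r ^ 2) (at t)"
      using r by (auto intro!: derivative_eq_intros
          simp: has_real_derivative_iff_has_vector_derivative[symmetric] power2_eq_square field_simps)
    have 4: "(u 0 has_vector_derivative u 1 (t / ?r)) (at (t / ?r))"
      using 0 by (simp add: deriv_chain_def)
    have 5: "((\<lambda>t. u 0 (t / (1 + c * t))) has_vector_derivative (1 / ?r ^ 2) *\<^sub>R u 1 (t / ?r)) (at t)"
      using vector_diff_chain_at[OF 3 4] by (simp add: o_def)
    have 6: "1 - complex_of_real (c * (t / ?r)) = 1 / of_real ?r"
    proof -
      have "1 - c * (t / ?r) = 1 / ?r" using r by (simp add: field_simps)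
      then show ?thesis by (metis of_real_1 of_real_diff of_real_divide)
    qed
    have 7: "cpow \<mu> ?r = cpow (\<mu> - 1) ?r * of_real ?r"
      using cpow_diff_1[OF r, of \<mu>] r by (simp add: field_simps del: of_real_add of_real_mult)
    have "cpow \<mu> ?r * ((1 / ?r ^ 2) *\<^sub>R u 1 (t / ?r)) + \<mu> * cpow (\<mu> - 1) ?r * of_real c * u 0 (t / ?r) =
        cpow (\<mu> - 1) ?r * bol_step c \<mu> u 0 (t / ?r)"
    proof -
      have "cpow \<mu> ?r * ((1 / ?r ^ 2) *\<^sub>R u 1 (t / ?r)) = cpow (\<mu> - 1) ?r * (1 / of_real ?r * u 1 (t / ?r))"
      proof -
        have "complex_of_real (1 / x ^ 2) = 1 / (of_real x * of_real x)" for x by (simp add: power2_eq_square)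
        moreover have "(P * R) * ((1 / (R * R)) * v) = P * (1 / R * v)" if "R \<noteq> 0" for P R v :: complex
          using that by simp
        ultimately show ?thesis unfolding 7 scaleR_conv_of_real using r by (metis less_irrefl of_real_eq_0_iff)
      qed
      then show ?thesis unfolding bol_step_def 6 by (simp add: ring_distribs mult_ac)
    qed
    then show ?case using has_vector_derivative_mult[OF 2 5] by simp
  next
    case (Suc k)
    have e: "\<mu> - of_nat (Suc j) = \<mu> - 1 - of_nat j" for j by simp
    show ?case unfolding bol_iter.simps(2)[of c \<mu>] e
      by (rule Suc.IH[OF deriv_chain_bol_step[OF Suc.prems, of c \<mu>], of "\<mu> - 1"])
  qed
qed

text \<open>One step replaces the Taylor coefficient $a_i$ of \<open>u\<close> by $c(\mu-i) a_i + (i+1) a_{i+1}$; by the absorption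
  identity the two contributions of each $a_i$ have total weight \<open>k + 1\<close>.\<close>

lemma bol_iter_at_0:
  "bol_iter c \<mu> u k 0 0 =
    fact k * (\<Sum>i\<le>k. u i 0 / fact i * of_real c ^ (k - i) * ((\<mu> - of_nat i) gchoose (k - i)))"
proof (induction k arbitrary: \<mu> u)
  case (Suc k)
  define a where "a = (\<lambda>i. u i 0 / fact i)"
  define T where "T = (\<lambda>i. a i * of_real c ^ (Suc k - i) * ((\<mu> - of_nat i) gchoose (Suc k - i)))"
  have step: "bol_step c \<mu> u i 0 / fact i = of_real c * (\<mu> - of_nat i) * a i + of_nat (Suc i) * a (Suc i)" for i
    by (simp add: bol_step_def a_def add_divide_distrib fact_Suc del: of_nat_Suc)
  have one: "of_real c * (\<mu> - of_nat i) * a i * of_real c ^ (k - i) * ((\<mu> - 1 - of_nat i) gchoose (k - i)) =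
      of_nat (Suc k - i) * T i" if "i \<le> k" for i
  proof -
    have "Suc k - i = Suc (k - i)" "\<mu> - 1 - of_nat i = \<mu> - of_nat i - 1" using that by auto
    then have "of_nat (Suc k - i) * T i =
        a i * of_real c ^ Suc (k - i) * (of_nat (Suc (k - i)) * ((\<mu> - of_nat i) gchoose Suc (k - i)))"
      unfolding T_def by (simp only: mult_ac)
    also have "\<dots> = a i * of_real c ^ Suc (k - i) * ((\<mu> - of_nat i) * ((\<mu> - 1 - of_nat i) gchoose (k - i)))"
      unfolding gbinomial_absorption \<open>\<mu> - 1 - of_nat i = \<mu> - of_nat i - 1\<close> ..
    finally show ?thesis by (simp add: mult_ac)
  qed
  have two: "of_nat (Suc i) * a (Suc i) * of_real c ^ (k - i) * ((\<mu> - 1 - of_nat i) gchoose (k - i)) =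
      of_nat (Suc i) * T (Suc i)" for i
    by (simp add: T_def diff_diff_eq mult_ac add.commute)
  have "(\<Sum>i\<le>k. bol_step c \<mu> u i 0 / fact i * of_real c ^ (k - i) * ((\<mu> - 1 - of_nat i) gchoose (k - i))) =
      (\<Sum>i\<le>k. of_nat (Suc k - i) * T i) + (\<Sum>i\<le>k. of_nat (Suc i) * T (Suc i))"
    unfolding sum.distrib[symmetric] step by (intro sum.cong refl) (simp only: distrib_right one two atMost_iff)
  also have "(\<Sum>i\<le>k. of_nat (Suc k - i) * T i) = (\<Sum>i\<le>Suc k. of_nat (Suc k - i) * T i)" by simp
  also have "(\<Sum>i\<le>k. of_nat (Suc i) * T (Suc i)) = (\<Sum>i\<le>Suc k. of_nat i * T i)"
    by (subst sum.atMost_Suc_shift) simp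
  also have "(\<Sum>i\<le>Suc k. of_nat (Suc k - i) * T i) + (\<Sum>i\<le>Suc k. of_nat i * T i) = (\<Sum>i\<le>Suc k. of_nat (Suc k) * T i)"
    unfolding sum.distrib[symmetric] distrib_right[symmetric] of_nat_add[symmetric] by (intro sum.cong refl) simp
  also have "\<dots> = of_nat (Suc k) * (\<Sum>i\<le>Suc k. T i)" by (simp only: sum_distrib_left)
  finally show ?case by (simp only: bol_iter.simps Suc.IH fact_Suc T_def a_def mult.assoc mult.left_commute)
qed simp

lemma taylor_0:
  fixes \<phi> :: "'m::{finite,linorder} rspace \<Rightarrow> complex"
  shows "taylor 0 \<phi> x y = \<phi> x"
  by (simp add: taylor_def dmono_def monomial_def Xi_0)

lemma deriv_chain_taylor:
  assumes "smooth_open UNIV \<phi>"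
  shows "deriv_chain S (\<lambda>i t. fact i * taylor i \<phi> (t *\<^sub>R z) (cvec z))"
  unfolding deriv_chain_def
proof (intro allI ballI)
  fix i t
  show "((\<lambda>t. fact i * taylor i \<phi> (t *\<^sub>R z) (cvec z)) has_vector_derivative
      fact (Suc i) * taylor (Suc i) \<phi> (t *\<^sub>R z) (cvec z)) (at t)"
    using has_vector_derivative_mult_right[OF taylor_line_derivative[OF assms, of i z t], of "fact i"]
    by (simp add: fact_Suc mult_ac del: of_nat_Suc)
qed

text \<open>Both sides are values at \<open>0\<close> of derivatives of one function of a real variable, computed along the
  line and by the iteration above.\<close>

lemma taylor_projective_change:
  assumes \<phi>: "smooth_open UNIV \<phi>" and \<psi>: "smooth_open UNIV \<psi>"
    and eq: "\<And>t. 1 + c * t > 0 \<Longrightarrow> \<psi> (t *\<^sub>R z) = cpow \<mu> (1 + c * t) * \<phi> ((t / (1 + c * t)) *\<^sub>R z)"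
  shows "taylor k \<psi> 0 (cvec z) =
    (\<Sum>i\<le>k. taylor i \<phi> 0 (cvec z) * of_real c ^ (k - i) * ((\<mu> - of_nat i) gchoose (k - i)))"
proof -
  define u where "u = (\<lambda>i t. fact i * taylor i \<phi> (t *\<^sub>R z) (cvec z))"
  let ?S = "{t. 1 + c * t > 0}"
  have "open ?S" by (intro open_Collect_less continuous_intros)
  moreover have "deriv_chain ?S (\<lambda>i t. fact i * taylor i \<psi> (t *\<^sub>R z) (cvec z))"
    by (rule deriv_chain_taylor[OF \<psi>])
  moreover have "deriv_chain ?S (\<lambda>k t. cpow (\<mu> - of_nat k) (1 + c * t) * bol_iter c \<mu> u k 0 (t / (1 + c * t)))"
    unfolding u_def by (rule deriv_chain_bol[OF deriv_chain_taylor[OF \<phi>]])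
  ultimately have "fact k * taylor k \<psi> (0 *\<^sub>R z) (cvec z) = cpow (\<mu> - of_nat k) (1 + c * 0) * bol_iter c \<mu> u k 0 (0 / (1 + c * 0))"
    by (rule deriv_chain_unique) (simp_all add: taylor_0 eq u_def)
  then show ?thesis by (simp add: bol_iter_at_0 u_def)
qed

text \<open>Bol's lemma: for $\mu = k - 1$ the binomial coefficients $\binom{k-1-i}{k-i}$ with $i < k$ vanish.\<close>

lemma taylor_projective_change_critical:
  assumes \<phi>: "smooth_open UNIV \<phi>" and \<psi>: "smooth_open UNIV \<psi>" and k: "k = 0 \<or> \<mu> = of_nat k - 1"
    and eq: "\<And>t. 1 + c * t > 0 \<Longrightarrow> \<psi> (t *\<^sub>R z) = cpow \<mu> (1 + c * t) * \<phi> ((t / (1 + c * t)) *\<^sub>R z)"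
  shows "taylor k \<psi> 0 (cvec z) = taylor k \<phi> 0 (cvec z)"
proof -
  have "(\<mu> - of_nat i) gchoose (k - i) = 0" if "i < k" for i
  proof -
    have "\<mu> - of_nat i = of_nat (k - 1 - i)" using that k by (auto simp: of_nat_diff)
    moreover have "(of_nat (k - 1 - i) :: complex) gchoose (k - i) = of_nat ((k - 1 - i) choose (k - i))"
      by (rule binomial_gbinomial[symmetric])
    moreover have "(k - 1 - i) choose (k - i) = 0" using that by (intro binomial_eq_0) simp
    ultimately show ?thesis by (simp only: of_nat_0)
  qed
  then have "(\<Sum>i\<le>k. taylor i \<phi> 0 (cvec z) * of_real c ^ (k - i) * ((\<mu> - of_nat i) gchoose (k - i))) =
      (\<Sum>i\<in>{k}. taylor i \<phi> 0 (cvec z) * of_real c ^ (k - i) * ((\<mu> - of_nat i) gchoose (k - i)))"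
    by (intro sum.mono_neutral_right) auto
  then show ?thesis using taylor_projective_change[OF \<phi> \<psi> eq] by simp
qed

lemma taylor_linear_change:
  fixes L :: "'m::{finite,linorder} rspace \<Rightarrow> 'm rspace"
  assumes \<phi>: "smooth_open UNIV \<phi>" and L: "bounded_linear L"
  shows "taylor k (\<lambda>x. \<phi> (L x)) 0 (cvec z) = taylor k \<phi> 0 (cvec (L z))"
proof -
  have s: "smooth_open UNIV (\<lambda>x. \<phi> (L x))" using smooth_open_affine[OF L \<phi>, of 0] by simp
  have "fact k * taylor k (\<lambda>x. \<phi> (L x)) (0 *\<^sub>R z) (cvec z) = fact k * taylor k \<phi> (0 *\<^sub>R L z) (cvec (L z))"
    by (rule deriv_chain_unique[OF open_UNIV deriv_chain_taylor[OF s] deriv_chain_taylor[OF \<phi>]])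
      (simp_all add: taylor_0 linear_scale[OF bounded_linear.linear[OF L]])
  then show ?thesis by simp
qed

lemma taylor_cmult:
  assumes "smooth_open UNIV \<phi>"
  shows "taylor k (\<lambda>x. c * \<phi> x) x y = c * taylor k \<phi> x y"
  by (simp add: taylor_def mpart_cmult[OF assms] sum_distrib_left mult.assoc)

section \<open>Block matrices\<close>

definition blk :: "real \<Rightarrow> 'm::finite rspace \<Rightarrow> 'm rspace \<Rightarrow> 'm rmat \<Rightarrow> 'm gmat" where
  "blk r y x B = (\<chi> a b. case a of
       None \<Rightarrow> (case b of None \<Rightarrow> r | Some j \<Rightarrow> y $ j)
     | Some i \<Rightarrow> (case b of None \<Rightarrow> x $ i | Some j \<Rightarrow> B $ i $ j))"

lemma blk_nth [simp]:
  "blk r y x B $ None $ None = r" "blk r y x B $ None $ Some j = y $ j"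
  "blk r y x B $ Some i $ None = x $ i" "blk r y x B $ Some i $ Some j = B $ i $ j"
  by (simp_all add: blk_def)

lemma option_matrix_eqI:
  assumes "A $ None $ None = B $ None $ None" "\<And>j. A $ None $ Some j = B $ None $ Some j"
    "\<And>i. A $ Some i $ None = B $ Some i $ None" "\<And>i j. A $ Some i $ Some j = B $ Some i $ Some j"
  shows "A = B"
proof -
  have "A $ a $ b = B $ a $ b" for a b using assms by (cases a; cases b) auto
  then show ?thesis by (simp add: vec_eq_iff)
qed

lemma sum_option: "(\<Sum>a\<in>UNIV. f a) = f None + (\<Sum>i\<in>UNIV. f (Some (i :: 'm::finite)))"
  by (simp add: UNIV_option_conv sum.reindex)

lemma prod_option: "(\<Prod>a\<in>UNIV. f a) = f None * (\<Prod>i\<in>UNIV. f (Some (i :: 'm::finite)))"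
  by (simp add: UNIV_option_conv prod.reindex)

lemma blk_mult:
  "blk r y x B ** blk r' y' x' B' =
    blk (r * r' + y \<bullet> x') (r *\<^sub>R y' + y v* B') (r' *\<^sub>R x + B *v x') ((\<chi> i j. x $ i * y' $ j) + B ** B')"
  by (rule option_matrix_eqI)
    (simp_all add: matrix_matrix_mult_def matrix_vector_mult_def vector_matrix_mult_def sum_option inner_vec_def mult.commute)

lemma blk_id: "blk 1 0 0 (mat 1) = mat 1"
  by (rule option_matrix_eqI) (simp_all add: mat_def)

text \<open>In the Leibniz expansion only the permutations that fix \<^const>\<open>None\<close> contribute, and these are the
  permutations of the remaining indices, with the same signs.\<close>

lemma det_blk_upper: "det (blk r y 0 (B :: 'm::finite rmat)) = r * det B"
proof -
  let ?A = "blk r y 0 B"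
  define e where "e = map_permutation (UNIV :: 'm set) Some"
  have e_None: "e q None = None" for q by (simp add: e_def map_permutation_def restrict_id_def)
  have e_Some: "e q (Some i) = Some (q i)" for q i by (simp add: e_def map_permutation_def restrict_id_def)
  have e_perm: "e q permutes UNIV" if "q permutes UNIV" for q
  proof -
    have "e q permutes range Some"
      unfolding e_def by (intro map_permutation_permutes that) (simp add: bij_betw_def)
    then show ?thesis by (rule permutes_subset) simp
  qed
  have surj: "p \<in> e ` {q. q permutes UNIV}" if p: "p permutes UNIV" "p None = None" for p
  proof -
    have Some: "p (Some i) \<noteq> None" for i using p by (metis option.distinct(1) permutes_def)
    define q where "q = (\<lambda>i. the (p (Some i)))"
    have pq: "p (Some i) = Some (q i)" for i using Some[of i] by (simp add: q_def)
    have "inj q"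
    proof (rule injI)
      fix i j assume "q i = q j"
      then have "p (Some i) = p (Some j)" by (simp add: pq)
      then show "i = j" using permutes_inj[OF p(1)] by (auto dest: injD)
    qed
    then have "q permutes UNIV" by (intro bij_imp_permutes) (auto simp: bij_def finite_UNIV_inj_surj)
    moreover have "p = e q"
    proof
      show "p a = e q a" for a by (cases a) (simp_all add: p e_None e_Some pq)
    qed
    ultimately show ?thesis by blast
  qed
  have inj: "inj_on e {q. q permutes UNIV}"
    by (rule inj_onI) (metis e_Some ext option.inject)
  have "det ?A = (\<Sum>p\<in>{p. p permutes UNIV}. of_int (sign p) * (\<Prod>i\<in>UNIV. ?A $ i $ p i))"
    by (simp add: det_def)
  also have "\<dots> = (\<Sum>p\<in>e ` {q. q permutes UNIV}. of_int (sign p) * (\<Prod>i\<in>UNIV. ?A $ i $ p i))"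
  proof (rule sum.mono_neutral_right)
    show "e ` {q. q permutes UNIV} \<subseteq> {p. p permutes UNIV}" using e_perm by auto
    show "\<forall>p\<in>{p. p permutes UNIV} - e ` {q. q permutes UNIV}. of_int (sign p) * (\<Prod>i\<in>UNIV. ?A $ i $ p i) = 0"
    proof
      fix p assume p: "p \<in> {p. p permutes (UNIV :: 'm option set)} - e ` {q. q permutes UNIV}"
      then have pp: "p permutes UNIV" and "p None \<noteq> None" using surj by auto
      obtain a where a: "p a = None" using pp by (metis permutes_def)
      then obtain i where "a = Some i" using \<open>p None \<noteq> None\<close> by (cases a) auto
      then have "?A $ a $ p a = 0" using a by simp
      then have "(\<Prod>i\<in>UNIV. ?A $ i $ p i) = 0" by (intro prod_zero) auto
      then show "of_int (sign p) * (\<Prod>i\<in>UNIV. ?A $ i $ p i) = 0" by simp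
    qed
  qed (simp add: finite_permutations)
  also have "\<dots> = (\<Sum>q\<in>{q. q permutes UNIV}. of_int (sign (e q)) * (\<Prod>i\<in>UNIV. ?A $ i $ e q i))"
    by (subst sum.reindex[OF inj]) simp
  also have "\<dots> = (\<Sum>q\<in>{q. q permutes UNIV}. r * (of_int (sign q) * (\<Prod>i\<in>UNIV. B $ i $ q i)))"
  proof (intro sum.cong refl)
    fix q assume "q \<in> {q. q permutes (UNIV :: 'm set)}"
    then have "sign (e q) = sign q" unfolding e_def by (intro sign_map_permutation) auto
    then show "of_int (sign (e q)) * (\<Prod>i\<in>UNIV. ?A $ i $ e q i) = r * (of_int (sign q) * (\<Prod>i\<in>UNIV. B $ i $ q i))"
      by (simp add: prod_option e_None e_Some)
  qed
  also have "\<dots> = r * det B" by (simp add: det_def sum_distrib_left)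
  finally show ?thesis .
qed

lemma det_blk_lower: "det (blk r 0 x (B :: 'm::finite rmat)) = r * det B"
proof -
  have "transpose (blk r 0 x B) = blk r x 0 (transpose B)"
    by (rule option_matrix_eqI) (simp_all add: transpose_def)
  then show ?thesis using det_transpose[of "blk r 0 x B"] by (simp add: det_blk_upper)
qed

lemma matrix_exp_square_zero:
  fixes N :: "real^'n::finite^'n::finite"
  assumes "N ** N = 0"
  shows "matrix_exp N = mat 1 + N"
proof -
  have z: "(((**) N) ^^ k) (mat 1) = 0" if "k \<notin> {0, 1}" for k
  proof -
    have "k = Suc (Suc (k - 2))" using that by auto
    then have "(((**) N) ^^ k) (mat 1) = N ** (N ** (((**) N) ^^ (k - 2)) (mat 1))"
      by (metis funpow.simps(2) o_apply)
    also have "\<dots> = 0" unfolding matrix_mul_assoc assms by (simp add: matrix_matrix_mult_def vec_eq_iff)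
    finally show ?thesis .
  qed
  have "matrix_exp N = (\<Sum>k\<in>{0,1}. inverse (fact k) *\<^sub>R (((**) N) ^^ k) (mat 1))"
    unfolding matrix_exp_def by (intro suminf_finite) (auto simp: z)
  then show ?thesis by simp
qed

lemma matrix_exp_diagonal:
  fixes d :: "'n::finite \<Rightarrow> real"
  shows "matrix_exp (\<chi> a b. if a = b then d a else 0) = (\<chi> a b. if a = b then exp (d a) else 0)"
proof -
  let ?D = "\<chi> a b. if a = b then d a else 0"
  have p: "(((**) ?D) ^^ k) (mat 1) = (\<chi> a b. if a = b then d a ^ k else 0)" for k
  proof (induction k)
    case 0
    show ?case by (auto simp: mat_def vec_eq_iff)
  next
    case (Suc k)
    have "(\<Sum>c\<in>UNIV. (if a = c then d a else 0) * (if c = b then d c ^ k else 0)) = (if a = b then d a ^ Suc k else 0)" for a b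
    proof -
      have "(\<Sum>c\<in>UNIV. (if a = c then d a else 0) * (if c = b then d c ^ k else 0)) =
          (\<Sum>c\<in>UNIV. if a = c then (if a = b then d a ^ Suc k else 0) else 0)"
        by (intro sum.cong) auto
      then show ?thesis by simp
    qed
    then show ?case using Suc by (simp add: matrix_matrix_mult_def)
  qed
  have "(\<lambda>k. inverse (fact k) *\<^sub>R (((**) ?D) ^^ k) (mat 1)) sums (\<chi> a b. if a = b then exp (d a) else 0)"
    unfolding sums_def
  proof (intro vec_tendstoI)
    fix a b
    have "(\<lambda>n. \<Sum>k<n. inverse (fact k) *\<^sub>R (if a = b then d a ^ k else 0)) \<longlonglongrightarrow> (if a = b then exp (d a) else 0)"
      using exp_converges[of "d a"] by (cases "a = b") (auto simp: sums_def)
    then show "(\<lambda>n. (\<Sum>k<n. inverse (fact k) *\<^sub>R (((**) ?D) ^^ k) (mat 1)) $ a $ b) \<longlonglongrightarrow>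
        (\<chi> a b. if a = b then exp (d a) else 0) $ a $ b"
      unfolding p by (simp add: sum_component)
  qed
  then show ?thesis unfolding matrix_exp_def by (rule sums_unique[symmetric])
qed

lemma nplus_eq: "nplus y = blk 1 y 0 (mat 1)"
proof -
  have N: "(\<Sum>j\<in>UNIV. y $ j *\<^sub>R matrix_unit None (Some j)) = blk 0 y 0 0"
    by (rule option_matrix_eqI) (simp_all add: matrix_unit_def if_distrib cong: if_cong)
  have "blk 0 y 0 0 ** blk 0 y 0 0 = 0"
    unfolding blk_mult by (rule option_matrix_eqI) simp_all
  then show ?thesis
    unfolding nplus_def N by (simp add: matrix_exp_square_zero) (rule option_matrix_eqI, simp_all add: mat_def)
qed

lemma nminus_eq: "nminus x = blk 1 0 x (mat 1)"
proof -
  have N: "(\<Sum>j\<in>UNIV. x $ j *\<^sub>R matrix_unit (Some j) None) = blk 0 0 x 0"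
    by (rule option_matrix_eqI) (simp_all add: matrix_unit_def if_distrib cong: if_cong)
  have "blk 0 0 x 0 ** blk 0 0 x 0 = 0"
    unfolding blk_mult by (rule option_matrix_eqI) simp_all
  then show ?thesis
    unfolding nminus_def N by (simp add: matrix_exp_square_zero) (rule option_matrix_eqI, simp_all add: mat_def)
qed

lemma aexp_eq: "(aexp t :: 'm::finite gmat) = blk (exp t) 0 0 (exp (- t / real CARD('m)) *\<^sub>R mat 1)"
proof -
  have "t *\<^sub>R H0 = (\<chi> a b. if a = b then (if a = (None :: 'm option) then t else - t / real CARD('m)) else 0)"
    by (simp add: vec_eq_iff H0_def)
  then show ?thesis unfolding aexp_def
    by (simp add: matrix_exp_diagonal) (rule option_matrix_eqI, simp_all add: mat_def)
qed

lemma levi_eq: "levi h = blk (inverse (det h)) 0 0 h"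
  by (rule option_matrix_eqI) (simp_all add: levi_def)

lemma det_scaleR: "det (c *\<^sub>R (B :: 'm::finite rmat)) = c ^ CARD('m) * det B"
proof -
  have "c *\<^sub>R B = (c *\<^sub>R mat 1) ** B" by (simp add: scalar_matrix_assoc[symmetric])
  moreover have "det (c *\<^sub>R mat 1 :: 'm rmat) = c ^ CARD('m)"
    by (subst det_diagonal) (simp_all add: mat_def)
  ultimately show ?thesis by (simp add: det_mul)
qed

lemma SL_mult [simp]: "A \<in> SL \<Longrightarrow> B \<in> SL \<Longrightarrow> A ** B \<in> SL"
  by (simp add: SL_def det_mul)

lemma mat_1_SL [simp]: "mat 1 \<in> SL" by (simp add: SL_def)

lemma nplus_SL [simp]: "nplus y \<in> SL" by (simp add: SL_def nplus_eq det_blk_upper)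

lemma nminus_SL [simp]: "nminus y \<in> SL" by (simp add: SL_def nminus_eq det_blk_upper det_blk_lower)

lemma aexp_SL [simp]: "aexp t \<in> SL"
  by (simp add: SL_def aexp_eq det_blk_upper det_scaleR exp_of_nat_mult[symmetric] exp_add[symmetric])

lemma levi_SL [simp]: "h \<in> SLpm \<Longrightarrow> levi h \<in> SL"
  by (auto simp: SL_def SLpm_def levi_eq det_blk_upper)

lemma invertible_SL: "A \<in> SL \<Longrightarrow> invertible A"
  by (simp add: SL_def invertible_det_nz)

lemma matrix_inv_works:
  "invertible A \<Longrightarrow> A ** matrix_inv A = mat 1 \<and> matrix_inv A ** A = mat 1"
  unfolding invertible_def matrix_inv_def by (rule someI_ex)

lemma matrix_inv_SL: "A \<in> SL \<Longrightarrow> matrix_inv A ** A = mat 1" "A \<in> SL \<Longrightarrow> A ** matrix_inv A = mat 1"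
  using matrix_inv_works[OF invertible_SL] by auto

lemma matrix_inv_SL_mem [simp]:
  assumes "A \<in> SL"
  shows "matrix_inv A \<in> SL"
proof -
  have "det (matrix_inv A) * det A = 1" using matrix_inv_SL(1)[OF assms] by (metis det_I det_mul)
  then show ?thesis using assms by (simp add: SL_def)
qed

lemma nminus_0 [simp]: "nminus 0 = mat 1" by (simp add: nminus_eq blk_id)

lemma nplus_0 [simp]: "nplus 0 = mat 1" by (simp add: nplus_eq blk_id)

lemma aexp_0 [simp]: "aexp 0 = mat 1" by (simp add: aexp_eq blk_id)

lemma levi_1 [simp]: "levi (mat 1) = mat 1" by (simp add: levi_eq blk_id)

lemma nminus_add: "nminus x ** nminus y = nminus (x + y)"
  by (simp add: nminus_eq blk_mult) (rule option_matrix_eqI, simp_all)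

lemma aexp_nminus:
  fixes x :: "'m::finite rspace"
  shows "aexp t ** nminus x = nminus (exp (- t - t / real CARD('m)) *\<^sub>R x) ** aexp t"
  unfolding aexp_eq nminus_eq blk_mult
  by (rule option_matrix_eqI) (simp_all add: exp_add[symmetric] scaleR_matrix_vector_assoc[symmetric] mult.commute)

lemma levi_nminus:
  assumes "h \<in> SLpm"
  shows "levi h ** nminus x = nminus (det h *\<^sub>R (h *v x)) ** levi h"
  using assms unfolding levi_eq nminus_eq blk_mult
  by (intro option_matrix_eqI) (auto simp: SLpm_def)

text \<open>This is how $N_+$ acts on the open cell: the factorization according to $N_- M A N_+$ can be read off
  from the blocks, and the determinant of the $M$-component follows because all other factors have
  determinant one.\<close>

lemma nplus_nminus:
  fixes x y :: "'m::finite rspace"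
  assumes r: "1 + y \<bullet> x > 0"
  shows "\<exists>h \<in> SL. nplus y ** nminus x =
    nminus ((1 / (1 + y \<bullet> x)) *\<^sub>R x) ** (levi h ** aexp (ln (1 + y \<bullet> x)) ** nplus ((1 / (1 + y \<bullet> x)) *\<^sub>R y))"
proof -
  define r where "r = 1 + y \<bullet> x"
  have r0: "r > 0" using assms by (simp add: r_def)
  define B :: "'m rmat" where "B = (\<chi> i j. (if i = j then 1 else 0) - x $ i * y $ j / r)"
  define s where "s = exp (ln r / real CARD('m))"
  have mat1: "mat 1 $ i $ j = (if i = j then 1 else 0 :: real)" for i j :: 'm by (simp add: mat_def)
  have fact: "nplus y ** nminus x = nminus ((1 / r) *\<^sub>R x) ** blk r y 0 B"
    unfolding nplus_eq nminus_eq blk_mult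
    by (rule option_matrix_eqI) (use r0 in \<open>simp_all add: r_def[symmetric] B_def mat1\<close>)
  have "det (nplus y ** nminus x) = 1" "det (nminus ((1 / r) *\<^sub>R x)) = 1"
    using nplus_SL[of y] nminus_SL[of x] nminus_SL[of "(1 / r) *\<^sub>R x"] by (simp_all add: SL_def det_mul)
  then have "r * det B = 1" using fact by (simp add: det_mul det_blk_upper)
  moreover have "s ^ CARD('m) = r" using r0 by (simp add: s_def exp_of_nat_mult[symmetric])
  ultimately have h: "det (s *\<^sub>R B) = 1" by (simp add: det_scaleR)
  have "s * exp (- ln r / real CARD('m)) = 1" by (simp add: s_def exp_add[symmetric])
  then have "levi (s *\<^sub>R B) ** aexp (ln r) ** nplus ((1 / r) *\<^sub>R y) = blk r y 0 B"
    using r0 unfolding levi_eq h aexp_eq nplus_eq blk_mult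
    by (intro option_matrix_eqI)
      (simp_all add: vector_matrix_mult_def mat_def matrix_matrix_mult_def if_distrib cong: if_cong)
  then show ?thesis using fact h unfolding r_def by (intro bexI[of _ "s *\<^sub>R B"]) (simp_all add: SL_def)
qed

section \<open>Homogeneous polynomials\<close>

lemma Pol_add: "p \<in> Pol k \<Longrightarrow> q \<in> Pol k \<Longrightarrow> (\<lambda>y. p y + q y) \<in> Pol k"
proof -
  assume "p \<in> Pol k" "q \<in> Pol k"
  then obtain c d where "p = (\<lambda>y. \<Sum>\<kappa>\<in>Xi k. c \<kappa> * monomial \<kappa> y)" "q = (\<lambda>y. \<Sum>\<kappa>\<in>Xi k. d \<kappa> * monomial \<kappa> y)"
    by (auto simp: Pol_def)
  then have "(\<lambda>y. p y + q y) = (\<lambda>y. \<Sum>\<kappa>\<in>Xi k. (c \<kappa> + d \<kappa>) * monomial \<kappa> y)"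
    by (simp add: sum.distrib distrib_right)
  then show ?thesis unfolding Pol_def mem_Collect_eq by (intro exI[of _ "\<lambda>\<kappa>. c \<kappa> + d \<kappa>"])
qed

lemma Pol_cmult: "p \<in> Pol k \<Longrightarrow> (\<lambda>y. a * p y) \<in> Pol k"
proof -
  assume "p \<in> Pol k"
  then obtain c where "p = (\<lambda>y. \<Sum>\<kappa>\<in>Xi k. c \<kappa> * monomial \<kappa> y)" by (auto simp: Pol_def)
  then have "(\<lambda>y. a * p y) = (\<lambda>y. \<Sum>\<kappa>\<in>Xi k. (a * c \<kappa>) * monomial \<kappa> y)"
    by (simp add: sum_distrib_left mult.assoc)
  then show ?thesis unfolding Pol_def mem_Collect_eq by (intro exI[of _ "\<lambda>\<kappa>. a * c \<kappa>"])
qed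

lemma Pol_zero: "(\<lambda>y. 0) \<in> Pol k"
  unfolding Pol_def mem_Collect_eq by (rule exI[of _ "\<lambda>_. 0"]) simp

lemma Pol_sum: "(\<And>i. i \<in> I \<Longrightarrow> f i \<in> Pol k) \<Longrightarrow> (\<lambda>y. \<Sum>i\<in>I. f i y) \<in> Pol k"
  by (induction I rule: infinite_finite_induct) (simp_all add: Pol_zero Pol_add)

lemma monomial_in_Pol:
  assumes "\<kappa> \<in> Xi k"
  shows "monomial \<kappa> \<in> Pol k"
proof -
  have "(\<Sum>\<kappa>'\<in>Xi k. (if \<kappa>' = \<kappa> then 1 else 0) * monomial \<kappa>' y) =
      (\<Sum>\<kappa>'\<in>Xi k. if \<kappa>' = \<kappa> then monomial \<kappa>' y else 0)" for y
    by (intro sum.cong) auto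
  then have "monomial \<kappa> = (\<lambda>y. \<Sum>\<kappa>'\<in>Xi k. (if \<kappa>' = \<kappa> then 1 else 0) * monomial \<kappa>' y)"
    using assms by (simp add: sum.delta)
  then show ?thesis
    unfolding Pol_def mem_Collect_eq by (intro exI[of _ "\<lambda>\<kappa>'. if \<kappa>' = \<kappa> then 1 else 0"])
qed

lemma dmono_in_Pol: "\<kappa> \<in> Xi k \<Longrightarrow> dmono \<kappa> \<in> Pol k"
  using Pol_cmult[OF monomial_in_Pol, of \<kappa> k "1 / (\<Prod>j\<in>UNIV. fact (\<kappa> j))"] by (simp add: dmono_def[abs_def])

lemma Pol_mult:
  assumes "p \<in> Pol j" "q \<in> Pol k"
  shows "(\<lambda>y. p y * q y) \<in> Pol (j + k)"
proof -
  obtain c d where p: "p = (\<lambda>y. \<Sum>\<kappa>\<in>Xi j. c \<kappa> * monomial \<kappa> y)" and q: "q = (\<lambda>y. \<Sum>\<kappa>\<in>Xi k. d \<kappa> * monomial \<kappa> y)"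
    using assms by (auto simp: Pol_def)
  have mon: "monomial \<kappa> y * monomial \<kappa>' y = monomial (\<lambda>i. \<kappa> i + \<kappa>' i) y" for \<kappa> \<kappa>' y
    by (simp add: monomial_def power_add prod.distrib)
  have "(\<lambda>y. p y * q y) = (\<lambda>y. \<Sum>\<kappa>\<in>Xi j. \<Sum>\<kappa>'\<in>Xi k. (c \<kappa> * d \<kappa>') * monomial (\<lambda>i. \<kappa> i + \<kappa>' i) y)"
    unfolding p q sum_product mon[symmetric] by (simp add: mult_ac)
  moreover have "\<dots> \<in> Pol (j + k)"
    by (intro Pol_sum Pol_cmult monomial_in_Pol) (auto simp: Xi_def sum.distrib)
  ultimately show ?thesis by simp
qed

lemma Pol_0: "p \<in> Pol 0 \<longleftrightarrow> (\<exists>c. p = (\<lambda>y :: 'm::finite cspace. c))"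
  by (auto simp: Pol_def monomial_def Xi_0)

lemma Pol_one: "(\<lambda>y. 1) \<in> Pol 0"
  using monomial_in_Pol[of "\<lambda>_. 0" 0] by (simp add: monomial_def[abs_def] Xi_def)

lemma Pol_power: "p \<in> Pol j \<Longrightarrow> (\<lambda>y. p y ^ n) \<in> Pol (n * j)"
  by (induction n) (simp_all add: Pol_one Pol_mult)

lemma Pol_prod: "finite I \<Longrightarrow> (\<And>i. i \<in> I \<Longrightarrow> f i \<in> Pol (n i)) \<Longrightarrow> (\<lambda>y. \<Prod>i\<in>I. f i y) \<in> Pol (\<Sum>i\<in>I. n i)"
  by (induction I rule: finite_induct) (simp_all add: Pol_one Pol_mult)

lemma coordinate_in_Pol: "(\<lambda>y. y $ i) \<in> Pol (Suc 0)"
proof -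
  have "monomial (\<lambda>j. if j = i then 1 else 0) = (\<lambda>y :: complex^'a. y $ i)"
    unfolding monomial_def by (rule ext, subst prod.remove[of _ i]) auto
  moreover have "(\<lambda>j. if j = i then 1 else 0) \<in> Xi (Suc 0)" by (simp add: Xi_def)
  ultimately show ?thesis using monomial_in_Pol by metis
qed

text \<open>A monomial in linear forms is a product of polynomials of degree one.\<close>

lemma Pol_linear_substitution:
  assumes "p \<in> Pol k"
  shows "(\<lambda>y. p (A *v y)) \<in> Pol k"
proof -
  obtain c where p: "p = (\<lambda>y. \<Sum>\<kappa>\<in>Xi k. c \<kappa> * monomial \<kappa> y)" using assms by (auto simp: Pol_def)
  have lin: "(\<lambda>y. (A *v y) $ i) \<in> Pol (Suc 0)" for i
    unfolding matrix_vector_mult_def vec_lambda_beta by (intro Pol_sum Pol_cmult coordinate_in_Pol)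
  have "(\<lambda>y. monomial \<kappa> (A *v y)) \<in> Pol k" if "\<kappa> \<in> Xi k" for \<kappa>
    using Pol_prod[of UNIV "\<lambda>i y. (A *v y) $ i ^ \<kappa> i" \<kappa>] Pol_power[OF lin] that by (simp add: monomial_def Xi_def)
  then show ?thesis unfolding p by (intro Pol_sum Pol_cmult)
qed

lemma cmat_cvec: "cmat h *v cvec x = cvec (h *v x)"
  by (simp add: vec_eq_iff cmat_def matrix_vector_mult_def)

section \<open>Sections in the trivialization over the open cell\<close>

text \<open>The section \<open>f\<close> in the coordinates of the translate of the open cell that is centred at \<open>g\<close>.\<close>

definition cell :: "('m::finite gmat \<Rightarrow> complex^1) \<Rightarrow> 'm gmat \<Rightarrow> 'm rspace \<Rightarrow> complex" where
  "cell f g x = f (g ** nminus x) $ 1"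

lemma mult_nminus: "g ** nminus x = g + g ** blk 0 0 x 0"
proof -
  have "nminus x = mat 1 + blk 0 0 x 0"
    unfolding nminus_eq by (rule option_matrix_eqI) (simp_all add: mat_def)
  then show ?thesis by (simp add: matrix_add_ldistrib)
qed

lemma bounded_linear_mult_blk: "bounded_linear (\<lambda>x. g ** blk 0 0 x 0)"
proof -
  have "blk 0 0 (x + y) 0 = blk 0 0 x 0 + blk 0 0 y 0" for x y :: "real^'a"
    by (rule option_matrix_eqI) simp_all
  moreover have "blk 0 0 (c *\<^sub>R x) 0 = c *\<^sub>R blk 0 0 x 0" for c and x :: "real^'a"
    by (rule option_matrix_eqI) simp_all
  ultimately have "linear (\<lambda>x. g ** blk 0 0 x 0)"
    by (intro linearI) (simp_all add: matrix_add_ldistrib matrix_scalar_ac scalar_matrix_assoc)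
  then show ?thesis by (simp add: linear_conv_bounded_linear)
qed

lemma smooth_on_SL_cell:
  assumes f: "smooth_on SL f" and g: "g \<in> SL"
  shows "smooth_open UNIV (\<lambda>x. f (g ** nminus x))"
proof (rule smooth_open_local)
  fix x :: "real^'a"
  have "g ** nminus x \<in> SL" using g by simp
  then obtain U F where U: "g ** nminus x \<in> U" "smooth_open U F" "\<forall>y\<in>U \<inter> SL. F y = f y"
    using f unfolding smooth_on_iff_local by meson
  have "smooth_open {x. g + g ** blk 0 0 x 0 \<in> U} (\<lambda>x. F (g + g ** blk 0 0 x 0))"
    by (rule smooth_open_affine[OF bounded_linear_mult_blk U(2)])
  then show "\<exists>V H. x \<in> V \<and> smooth_open V H \<and> (\<forall>y\<in>V. H y = f (g ** nminus y))"
    using U(1,3) g unfolding mult_nminus[symmetric]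
    by (intro exI[of _ "{x. g ** nminus x \<in> U}"] exI[of _ "\<lambda>x. F (g ** nminus x)"]) simp
qed simp

lemma smooth_on_SL_linear:
  assumes f: "smooth_on SL f" and L: "bounded_linear L"
  shows "smooth_on SL (\<lambda>x. L (f x))"
  unfolding smooth_on_iff_local
proof
  fix x :: "real^'a^'a" assume "x \<in> SL"
  then obtain U F where "x \<in> U" "smooth_open U F" "\<forall>y\<in>U \<inter> SL. F y = f y"
    using f unfolding smooth_on_iff_local by meson
  then show "\<exists>U F. x \<in> U \<and> smooth_open U F \<and> (\<forall>y\<in>U \<inter> SL. F y = L (f y))"
    by (intro exI[of _ U] exI[of _ "\<lambda>y. L (F y)"]) (simp add: smooth_open_linear_compose[OF L])
qed

lemma inducedD:
  assumes "f \<in> induced \<rho> lam \<alpha>"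
  shows "f \<in> extensional SL" "smooth_on SL f"
    "\<And>g h t x. g \<in> SL \<Longrightarrow> h \<in> SLpm \<Longrightarrow> f (g ** (levi h ** aexp t ** nplus x)) =
       matrix_inv (mat (sign_char \<alpha> h * exp (lam * of_real t)) ** \<rho> h) *v f g"
  using assms unfolding induced_def by blast+

lemma smooth_cell: "f \<in> induced triv lam \<alpha> \<Longrightarrow> g \<in> SL \<Longrightarrow> smooth_open UNIV (cell f g)"
  unfolding cell_def[abs_def]
  by (intro smooth_open_linear_compose[OF bounded_linear_vec_nth] smooth_on_SL_cell inducedD(2))

lemma sign_char_square: "h \<in> SLpm \<Longrightarrow> sign_char \<alpha> h * sign_char \<alpha> h = 1"
  by (auto simp: sign_char_def SLpm_def)

lemma sign_char_SL: "h \<in> SL \<Longrightarrow> sign_char \<alpha> h = 1"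
  by (auto simp: sign_char_def SL_def)

lemma SL_SLpm: "h \<in> SL \<Longrightarrow> h \<in> SLpm"
  by (simp add: SL_def SLpm_def)

lemma matrix_inv_unique:
  fixes A B :: "'a::field^'n^'n"
  assumes "A ** B = mat 1"
  shows "matrix_inv A = B"
proof -
  have "B ** A = mat 1" using assms matrix_left_right_inverse by blast
  then have "invertible A" using assms by (auto simp: invertible_def)
  then have "matrix_inv A = matrix_inv A ** (A ** B)" "matrix_inv A ** A = mat 1"
    using assms matrix_inv_works by auto
  then show ?thesis by (simp add: matrix_mul_assoc)
qed

lemma mat_mult_mat: "mat a ** mat b = (mat (a * b) :: 'a::comm_semiring_1^'n^'n)"
proof -
  have "(\<Sum>k\<in>UNIV. (if i = k then a else 0) * (if k = j then b else 0)) = (if i = j then a * b else 0)" for i j :: 'n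
  proof -
    have "(\<Sum>k\<in>UNIV. (if i = k then a else 0) * (if k = j then b else 0)) =
        (\<Sum>k\<in>UNIV. if i = k then (if i = j then a * b else 0) else 0)"
      by (intro sum.cong) auto
    then show ?thesis by simp
  qed
  then show ?thesis by (simp add: vec_eq_iff matrix_matrix_mult_def mat_def)
qed

lemma mat_vector_mult: "mat a *v v = a *s (v :: 'a::comm_semiring_1^'n)"
  by (simp add: vec_eq_iff matrix_vector_mult_def mat_def if_distrib if_distribR cong: if_cong)

lemma mat_mult_commute: "mat c ** A = A ** (mat c :: 'a::comm_semiring_1^'n^'n)"
proof -
  have "(\<Sum>k\<in>UNIV. (if i = k then c else 0) * A $ k $ j) = c * A $ i $ j" for i j
  proof -
    have "(\<Sum>k\<in>UNIV. (if i = k then c else 0) * A $ k $ j) = (\<Sum>k\<in>UNIV. if i = k then c * A $ i $ j else 0)"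
      by (intro sum.cong) auto
    then show ?thesis by simp
  qed
  moreover have "(\<Sum>k\<in>UNIV. A $ i $ k * (if k = j then c else 0)) = c * A $ i $ j" for i j
  proof -
    have "(\<Sum>k\<in>UNIV. A $ i $ k * (if k = j then c else 0)) = (\<Sum>k\<in>UNIV. if k = j then c * A $ i $ j else 0)"
      by (intro sum.cong) (auto simp: mult.commute)
    then show ?thesis by simp
  qed
  ultimately show ?thesis by (simp add: vec_eq_iff matrix_matrix_mult_def mat_def)
qed

lemma SLpm_inv:
  fixes h :: "'m::finite rmat"
  assumes "h \<in> SLpm"
  shows "h ** matrix_inv h = mat 1" "matrix_inv h ** h = mat 1" "matrix_inv h \<in> SLpm"
    "det (matrix_inv h) = det h" "matrix_inv (matrix_inv h) = h"
    "sign_char \<alpha> (matrix_inv h) = sign_char \<alpha> h"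
proof -
  have "invertible h" using assms by (auto simp: SLpm_def invertible_det_nz)
  then show 1: "h ** matrix_inv h = mat 1" "matrix_inv h ** h = mat 1"
    using matrix_inv_works by auto
  then have "det h * det (matrix_inv h) = 1" by (metis det_I det_mul)
  then show 2: "det (matrix_inv h) = det h" using assms by (auto simp: SLpm_def)
  then show "matrix_inv h \<in> SLpm" "sign_char \<alpha> (matrix_inv h) = sign_char \<alpha> h"
    using assms by (auto simp: SLpm_def sign_char_def)
  show "matrix_inv (matrix_inv h) = h" by (rule matrix_inv_unique[OF 1(2)])
qed

lemma inducing_inverse:
  assumes \<rho>: "representation_on SLpm \<rho>" and h: "h \<in> SLpm"
  shows "matrix_inv (mat (sign_char \<beta> h * exp (nu * of_real t)) ** \<rho> h) *v v =
    (sign_char \<beta> h * exp (- nu * of_real t)) *s (\<rho> (matrix_inv h) *v v)"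
proof -
  let ?a = "sign_char \<beta> h * exp (nu * of_real t)" and ?b = "sign_char \<beta> h * exp (- nu * of_real t)"
  have "?a * ?b = (sign_char \<beta> h * sign_char \<beta> h) * (exp (nu * of_real t) * exp (- (nu * of_real t)))"
    by (simp add: mult_ac)
  then have ab: "?a * ?b = 1" unfolding sign_char_square[OF h] exp_minus by simp
  have "\<rho> h ** \<rho> (matrix_inv h) = mat 1"
    using \<rho> h SLpm_inv[OF h] unfolding representation_on_def by metis
  moreover have "(mat ?a ** \<rho> h) ** (mat ?b ** \<rho> (matrix_inv h)) = mat (?a * ?b) ** (\<rho> h ** \<rho> (matrix_inv h))"
  proof -
    have "(mat ?a ** \<rho> h) ** (mat ?b ** \<rho> (matrix_inv h)) = mat ?a ** ((\<rho> h ** mat ?b) ** \<rho> (matrix_inv h))"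
      by (simp only: matrix_mul_assoc)
    also have "\<rho> h ** mat ?b = mat ?b ** \<rho> h" by (rule mat_mult_commute[symmetric])
    finally show ?thesis by (simp only: matrix_mul_assoc mat_mult_mat)
  qed
  ultimately have "matrix_inv (mat ?a ** \<rho> h) = mat ?b ** \<rho> (matrix_inv h)"
    by (intro matrix_inv_unique) (simp only: ab matrix_mul_lid)
  then show ?thesis by (simp add: matrix_vector_mul_assoc[symmetric] mat_vector_mult)
qed

lemma representation_on_triv: "representation_on S triv"
  unfolding representation_on_def triv_def[abs_def] by simp

lemma induced_triv_transform:
  assumes f: "f \<in> induced triv lam \<alpha>" and g: "g \<in> SL" and h: "h \<in> SLpm"
  shows "f (g ** (levi h ** aexp t ** nplus y)) = (sign_char \<alpha> h * exp (- lam * of_real t)) *s f g"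
  using inducedD(3)[OF f g h, of t y] inducing_inverse[OF representation_on_triv h, of \<alpha> lam t]
  by (simp add: triv_def)

lemma mat_1_SLpm [simp]: "mat 1 \<in> SLpm" by (simp add: SLpm_def)

lemma cell_nminus: "cell f (g ** nminus a) x = cell f g (a + x)"
  by (simp add: cell_def matrix_mul_assoc[symmetric] nminus_add)

lemma cell_aexp:
  fixes f :: "'m::finite gmat \<Rightarrow> complex^1"
  assumes f: "f \<in> induced triv lam \<alpha>" and g: "g \<in> SL"
  shows "cell f (g ** aexp t) x = exp (- lam * of_real t) * cell f g (exp (- t - t / real CARD('m)) *\<^sub>R x)"
proof -
  let ?x = "exp (- t - t / real CARD('m)) *\<^sub>R x"
  have "g ** aexp t ** nminus x = (g ** nminus ?x) ** (levi (mat 1) ** aexp t ** nplus 0)"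
    by (simp add: matrix_mul_assoc[symmetric] aexp_nminus)
  then show ?thesis
    unfolding cell_def using induced_triv_transform[OF f, of "g ** nminus ?x" "mat 1" t 0] g
    by (simp add: sign_char_SL)
qed

lemma cell_levi:
  assumes f: "f \<in> induced triv lam \<alpha>" and g: "g \<in> SL" and h: "h \<in> SLpm"
  shows "cell f (g ** levi h) x = sign_char \<alpha> h * cell f g (det h *\<^sub>R (h *v x))"
proof -
  let ?x = "det h *\<^sub>R (h *v x)"
  have "g ** levi h ** nminus x = (g ** nminus ?x) ** (levi h ** aexp 0 ** nplus 0)"
    by (simp add: matrix_mul_assoc[symmetric] levi_nminus[OF h])
  then show ?thesis
    unfolding cell_def using induced_triv_transform[OF f, of "g ** nminus ?x" h 0 0] g h by simp
qed

lemma cell_nplus: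
  assumes f: "f \<in> induced triv lam \<alpha>" and g: "g \<in> SL" and r: "1 + y \<bullet> x > 0"
  shows "cell f (g ** nplus y) x = cpow (- lam) (1 + y \<bullet> x) * cell f g ((1 / (1 + y \<bullet> x)) *\<^sub>R x)"
proof -
  let ?r = "1 + y \<bullet> x" let ?x = "(1 / ?r) *\<^sub>R x"
  obtain h where h: "h \<in> SL" "nplus y ** nminus x = nminus ?x ** (levi h ** aexp (ln ?r) ** nplus ((1 / ?r) *\<^sub>R y))"
    using nplus_nminus[OF r] by blast
  have "g ** nplus y ** nminus x = (g ** nminus ?x) ** (levi h ** aexp (ln ?r) ** nplus ((1 / ?r) *\<^sub>R y))"
    using h(2) by (metis matrix_mul_assoc)
  then show ?thesis
    unfolding cell_def using induced_triv_transform[OF f, of "g ** nminus ?x" h "ln ?r"] g h(1)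
    by (simp add: sign_char_SL SL_SLpm cpow_def)
qed

lemma mpart_cell_aexp:
  fixes f :: "'m::{finite,linorder} gmat \<Rightarrow> complex^1"
  assumes f: "f \<in> induced triv lam \<alpha>" and g: "g \<in> SL"
  shows "mpart \<kappa> (cell f (g ** aexp t)) 0 =
    exp (- (lam + of_nat (sum \<kappa> UNIV) * (1 + 1 / of_nat CARD('m))) * of_real t) * mpart \<kappa> (cell f g) 0"
proof -
  let ?s = "exp (- t - t / real CARD('m))"
  have s: "smooth_open UNIV (cell f g)" by (rule smooth_cell[OF f g])
  have s': "smooth_open UNIV (\<lambda>x. cell f g (?s *\<^sub>R x))"
    using smooth_open_affine[OF bounded_linear_scaleR_right s, of 0 ?s] by simp
  have "cell f (g ** aexp t) = (\<lambda>x. exp (- lam * of_real t) * cell f g (?s *\<^sub>R x))"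
    using cell_aexp[OF f g] by blast
  then have "mpart \<kappa> (cell f (g ** aexp t)) 0 = exp (- lam * of_real t) * (of_real ?s ^ sum \<kappa> UNIV * mpart \<kappa> (cell f g) 0)"
    by (simp only: mpart_cmult[OF s'] mpart_scale[OF s] scaleR_zero_right)
  also have "complex_of_real ?s ^ sum \<kappa> UNIV = exp (of_nat (sum \<kappa> UNIV) * (- of_real t - of_real t / of_nat CARD('m)))"
    by (simp only: exp_of_nat_mult exp_of_real[symmetric]) simp
  finally show ?thesis by (simp add: mult.assoc[symmetric] exp_add[symmetric] algebra_simps)
qed

text \<open>Two polynomials that agree at real points are equal, so a comparison along real lines suffices.\<close>

lemma taylor_cell_levi:
  fixes f :: "'m::{finite,linorder} gmat \<Rightarrow> complex^1"
  assumes f: "f \<in> induced triv lam \<alpha>" and g: "g \<in> SL" and h: "h \<in> SLpm"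
  shows "taylor k (cell f (g ** levi h)) 0 =
    (\<lambda>y. sign_char \<alpha> h * of_real (det h) ^ k * taylor k (cell f g) 0 (cmat h *v y))"
proof (rule Pol_eqI[OF taylor_in_Pol])
  show "(\<lambda>y. sign_char \<alpha> h * of_real (det h) ^ k * taylor k (cell f g) 0 (cmat h *v y)) \<in> Pol k"
    by (intro Pol_cmult Pol_linear_substitution taylor_in_Pol)
  fix z :: "'m rspace"
  let ?L = "\<lambda>x. det h *\<^sub>R (h *v x)"
  have L: "bounded_linear ?L"
    by (intro bounded_linear_compose[OF bounded_linear_scaleR_right] matrix_vector_mul_bounded_linear)
  have s: "smooth_open UNIV (cell f g)" by (rule smooth_cell[OF f g])
  have s': "smooth_open UNIV (\<lambda>x. cell f g (?L x))"
    using smooth_open_affine[OF L s, of 0] by simp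
  have s'': "smooth_open UNIV (\<lambda>x. cell f g (det h *\<^sub>R x))"
    using smooth_open_affine[OF bounded_linear_scaleR_right s, of 0 "det h"] by simp
  have "cell f (g ** levi h) = (\<lambda>x. sign_char \<alpha> h * cell f g (?L x))"
    using cell_levi[OF f g h] by blast
  then have "taylor k (cell f (g ** levi h)) 0 (cvec z) = sign_char \<alpha> h * taylor k (\<lambda>x. cell f g (?L x)) 0 (cvec z)"
    by (simp only: taylor_cmult[OF s'])
  also have "taylor k (\<lambda>x. cell f g (?L x)) 0 (cvec z) = taylor k (\<lambda>x. cell f g (det h *\<^sub>R x)) 0 (cvec (h *v z))"
    by (rule taylor_linear_change[OF s'' matrix_vector_mul_bounded_linear])
  also have "\<dots> = of_real (det h) ^ k * taylor k (cell f g) 0 (cvec (h *v z))"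
    unfolding taylor_def mpart_scale[OF s] sum_distrib_left by (intro sum.cong refl) (simp add: Xi_def mult.assoc)
  finally show "taylor k (cell f (g ** levi h)) 0 (cvec z) =
      sign_char \<alpha> h * of_real (det h) ^ k * taylor k (cell f g) 0 (cmat h *v cvec z)"
    by (simp add: cmat_cvec)
qed

lemma taylor_cell_nplus:
  fixes f :: "'m::{finite,linorder} gmat \<Rightarrow> complex^1"
  assumes f: "f \<in> induced triv lam \<alpha>" and g: "g \<in> SL"
  shows "taylor k (cell f (g ** nplus y)) 0 (cvec z) = (\<Sum>i\<le>k. taylor i (cell f g) 0 (cvec z) *
      of_real (y \<bullet> z) ^ (k - i) * ((- lam - of_nat i) gchoose (k - i)))"
proof (rule taylor_projective_change)
  show "cell f (g ** nplus y) (t *\<^sub>R z) =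
      cpow (- lam) (1 + (y \<bullet> z) * t) * cell f g ((t / (1 + (y \<bullet> z) * t)) *\<^sub>R z)"
    if "1 + (y \<bullet> z) * t > 0" for t
    using cell_nplus[OF f g, of y "t *\<^sub>R z"] that by (simp add: mult.commute)
qed (use f g in \<open>auto intro!: smooth_cell\<close>)

lemma taylor_cell_nplus_critical:
  fixes f :: "'m::{finite,linorder} gmat \<Rightarrow> complex^1"
  assumes f: "f \<in> induced triv lam \<alpha>" and g: "g \<in> SL" and k: "k = 0 \<or> lam = 1 - of_nat k"
  shows "taylor k (cell f (g ** nplus y)) 0 = taylor k (cell f g) 0"
proof (rule Pol_eqI[OF taylor_in_Pol taylor_in_Pol])
  fix z :: "'m rspace"
  show "taylor k (cell f (g ** nplus y)) 0 (cvec z) = taylor k (cell f g) 0 (cvec z)"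
  proof (rule taylor_projective_change_critical)
    show "cell f (g ** nplus y) (t *\<^sub>R z) =
        cpow (- lam) (1 + (y \<bullet> z) * t) * cell f g ((t / (1 + (y \<bullet> z) * t)) *\<^sub>R z)"
      if "1 + (y \<bullet> z) * t > 0" for t
      using cell_nplus[OF f g, of y "t *\<^sub>R z"] that by (simp add: mult.commute)
    show "k = 0 \<or> - lam = of_nat k - 1" using k by auto
  qed (use f g in \<open>auto intro!: smooth_cell\<close>)
qed

section \<open>Sections with prescribed jets\<close>

text \<open>Sections correspond to homogeneous functions of the first column: here a power of its Euclidean
  norm times a homogeneous polynomial of degree \<open>d\<close>, whose parity is dictated by the sign.\<close>

definition column_section ::
    "complex \<Rightarrow> nat \<Rightarrow> (('m::finite \<Rightarrow> nat) \<Rightarrow> complex) \<Rightarrow> 'm::finite gmat \<Rightarrow> complex^1" where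
  "column_section lam d c = restrict (\<lambda>g. vec (cpow (- (lam + of_nat d) / 2) (\<Sum>a\<in>UNIV. (g $ a $ None)\<^sup>2) *
     (\<Sum>\<kappa> | sum \<kappa> UNIV \<le> d. c \<kappa> * of_real (g $ None $ None) ^ (d - sum \<kappa> UNIV) *
        dmono \<kappa> (\<chi> j. of_real (g $ Some j $ None))))) SL"

lemma dmono_scale: "dmono \<kappa> (a *s y) = a ^ sum \<kappa> UNIV * dmono \<kappa> y"
  by (simp add: dmono_def monomial_def power_mult_distrib prod.distrib power_sum)

lemma column_nonzero:
  assumes "g \<in> SL"
  shows "(\<Sum>a\<in>UNIV. (g $ a $ None)\<^sup>2) > (0::real)"
proof (rule ccontr)
  assume "\<not> ?thesis"
  then have "(\<Sum>a\<in>UNIV. (g $ a $ None)\<^sup>2) = (0::real)" by (meson linorder_not_less order_antisym sum_nonneg zero_le_power2)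
  then have "\<forall>a. g $ a $ None = 0" by (simp add: sum_nonneg_eq_0_iff)
  then have "column None g = 0" by (simp add: column_def vec_eq_iff)
  then have "det g = 0" by (rule det_zero_column)
  then show False using assms by (simp add: SL_def)
qed

lemma smooth_matrix_entry: "smooth_open UNIV (\<lambda>g :: real^'n::finite^'n. g $ a $ b)"
  by (intro smooth_open_bounded_linear bounded_linear_compose[OF bounded_linear_vec_nth bounded_linear_vec_nth]) simp

text \<open>The first column is invariant under $N_+$ and $SL(n-1)$, and is scaled by $\pm e^t$ under the rest of $P$;
  the condition on \<open>d\<close> matches the sign.\<close>

lemma column_section_induced:
  fixes c :: "('m::finite \<Rightarrow> nat) \<Rightarrow> complex"
  assumes d: "(-1) ^ d = \<alpha>"
  shows "column_section lam d c \<in> induced triv lam \<alpha>"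
proof -
  define \<mu> where "\<mu> = - (lam + of_nat d) / 2"
  define Q where "Q = (\<lambda>g :: 'm::finite gmat. \<Sum>a\<in>UNIV. (g $ a $ None)\<^sup>2)"
  define P where "P = (\<lambda>g :: 'm gmat.
    \<Sum>\<kappa> | sum \<kappa> UNIV \<le> d. c \<kappa> * of_real (g $ None $ None) ^ (d - sum \<kappa> UNIV) *
        dmono \<kappa> (\<chi> j. of_real (g $ Some j $ None)))"
  have F: "column_section lam d c = restrict (\<lambda>g. vec (cpow \<mu> (Q g) * P g)) SL"
    by (simp add: column_section_def \<mu>_def Q_def P_def)
  have Q0: "Q g > 0" if "g \<in> SL" for g using column_nonzero[OF that] by (simp add: Q_def)
  have cent: "smooth_open UNIV (\<lambda>g :: 'm gmat. complex_of_real (g $ a $ b))" for a b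
    by (rule smooth_open_linear_compose[OF bounded_linear_of_real smooth_matrix_entry])
  have sQ: "smooth_open UNIV Q"
    unfolding Q_def by (intro smooth_open_sum smooth_open_power smooth_matrix_entry open_UNIV)
  have sP: "smooth_open UNIV P"
    unfolding P_def dmono_def monomial_def divide_inverse vec_lambda_beta
    by (intro smooth_open_sum smooth_open_mult smooth_open_prod smooth_open_power cent smooth_open_const open_UNIV)
  have U: "open {g. Q g > 0}"
    by (intro open_Collect_less continuous_on_const smooth_open_continuous[OF sQ])
  have vec: "bounded_linear (vec :: complex \<Rightarrow> complex^1)"
    by (intro linear_conv_bounded_linear[THEN iffD1] linearI) (simp_all add: vec_eq_iff)
  have "smooth_open {g. Q g > 0} (\<lambda>g. vec (cpow \<mu> (Q g) * P g) :: complex^1)"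
    by (intro smooth_open_linear_compose[OF vec] smooth_open_mult smooth_open_cpow smooth_open_subset[OF sQ]
          smooth_open_subset[OF sP] U) auto
  then have "smooth_on SL (column_section lam d c)"
    unfolding smooth_on_iff_local F using Q0
    by (intro ballI exI[of _ "{g. Q g > 0}"] exI[of _ "\<lambda>g. vec (cpow \<mu> (Q g) * P g)"]) auto
  moreover have "column_section lam d c (g ** (levi h ** aexp t ** nplus x)) =
      matrix_inv (mat (sign_char \<alpha> h * exp (lam * of_real t)) ** triv h) *v column_section lam d c g"
    if g: "g \<in> SL" and h: "h \<in> SLpm" for g h t x
  proof -
    define r where "r = det h * exp t"
    have hh: "inverse (det h) = det h" "det h ^ 2 = 1" "r \<noteq> 0" using h by (auto simp: SLpm_def r_def)
    let ?p = "levi h ** aexp t ** nplus x"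
    have "?p $ None $ None = r" "?p $ Some j $ None = 0" for j
      by (simp_all add: levi_eq aexp_eq nplus_eq blk_mult hh r_def)
    then have col: "(g ** ?p) $ a $ None = g $ a $ None * r" for a
      by (simp add: matrix_matrix_mult_def[of g] sum_option[of "\<lambda>c. g $ a $ c * ?p $ c $ None"])
    have r2: "r\<^sup>2 = exp (2 * t)" using hh by (simp add: r_def power_mult_distrib exp_double)
    have "Q (g ** ?p) = r\<^sup>2 * Q g" by (simp add: Q_def col power_mult_distrib sum_distrib_left mult.commute)
    then have "cpow \<mu> (Q (g ** ?p)) = exp (\<mu> * of_real (2 * t)) * cpow \<mu> (Q g)"
      using Q0[OF g] by (simp add: cpow_mult r2 cpow_exp)
    moreover have "P (g ** ?p) = of_real r ^ d * P g"
    proof -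
      have v: "(\<chi> j. complex_of_real ((g ** ?p) $ Some j $ None)) = of_real r *s (\<chi> j. of_real (g $ Some j $ None))"
        by (simp add: vec_eq_iff col mult.commute)
      show ?thesis unfolding P_def sum_distrib_left unfolding v dmono_scale unfolding col
      proof (intro sum.cong refl)
        fix \<kappa> :: "'m \<Rightarrow> nat" assume "\<kappa> \<in> {\<kappa>. sum \<kappa> UNIV \<le> d}"
        then have "complex_of_real r ^ d = of_real r ^ (d - sum \<kappa> UNIV) * of_real r ^ sum \<kappa> UNIV"
          by (simp add: power_add[symmetric])
        then show "c \<kappa> * of_real (g $ None $ None * r) ^ (d - sum \<kappa> UNIV) * (of_real r ^ sum \<kappa> UNIV *
            dmono \<kappa> (\<chi> j. of_real (g $ Some j $ None))) = of_real r ^ d * (c \<kappa> * of_real (g $ None $ None) ^ (d - sum \<kappa> UNIV) *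
            dmono \<kappa> (\<chi> j. of_real (g $ Some j $ None)))"
          by (simp add: power_mult_distrib mult_ac)
      qed
    qed
    moreover have "complex_of_real r ^ d = sign_char \<alpha> h * exp (of_nat d * of_real t)"
    proof -
      have "sign_char \<alpha> h = of_real (det h) ^ d"
        using h d by (cases "even d") (auto simp: sign_char_def SLpm_def)
      then show ?thesis by (simp add: r_def power_mult_distrib exp_of_nat_mult exp_of_real[symmetric])
    qed
    moreover have "exp (\<mu> * of_real (2 * t)) * exp (of_nat d * of_real t) = exp (- lam * of_real t)"
      by (simp add: exp_add[symmetric] \<mu>_def field_simps)
    ultimately have "cpow \<mu> (Q (g ** ?p)) * P (g ** ?p) = sign_char \<alpha> h * exp (- lam * of_real t) * (cpow \<mu> (Q g) * P g)"
    proof -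
      assume 1: "cpow \<mu> (Q (g ** ?p)) = exp (\<mu> * of_real (2 * t)) * cpow \<mu> (Q g)"
        and 2: "P (g ** ?p) = of_real r ^ d * P g"
        and 3: "complex_of_real r ^ d = sign_char \<alpha> h * exp (of_nat d * of_real t)"
        and 4: "exp (\<mu> * of_real (2 * t)) * exp (of_nat d * of_real t) = exp (- lam * of_real t)"
      have "cpow \<mu> (Q (g ** ?p)) * P (g ** ?p) = sign_char \<alpha> h *
          (exp (\<mu> * of_real (2 * t)) * exp (of_nat d * of_real t)) * (cpow \<mu> (Q g) * P g)"
        unfolding 1 2 3 by (simp only: mult_ac)
      then show ?thesis unfolding 4 .
    qed
    then have "column_section lam d c (g ** ?p) = (sign_char \<alpha> h * exp (- lam * of_real t)) *s column_section lam d c g"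
      using g h unfolding F by (simp add: vec_eq_iff)
    then show ?thesis
      using inducing_inverse[OF representation_on_triv h, of \<alpha> lam t] by (simp add: triv_def)
  qed
  ultimately show ?thesis unfolding induced_def by (auto simp: F)
qed

lemma exists_section_with_jet:
  fixes c :: "('m::{finite,linorder} \<Rightarrow> nat) \<Rightarrow> complex"
  assumes "\<alpha> \<in> {1, -1}"
  shows "\<exists>f\<in>induced triv lam \<alpha>. \<forall>\<kappa>. sum \<kappa> UNIV \<le> N \<longrightarrow> mpart \<kappa> (cell f (mat 1)) 0 = c \<kappa>"
proof -
  \<comment> \<open>The degree must be at least \<open>N\<close>, and its parity is that of the sign.\<close>
  define d where "d = (if \<alpha> = 1 then 2 * N else 2 * N + 1)"
  have d: "(-1) ^ d = \<alpha>" "N \<le> d" using assms by (auto simp: d_def)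
  define \<mu> where "\<mu> = - (lam + of_nat d) / 2"
  have q: "smooth_open UNIV (\<lambda>x :: 'm::{finite,linorder} rspace. 1 + (\<Sum>i\<in>UNIV. (x $ i)\<^sup>2))"
    by (intro smooth_open_add smooth_open_const smooth_open_sum smooth_open_power
        smooth_open_bounded_linear bounded_linear_vec_nth open_UNIV)
  have q0: "1 + (\<Sum>i\<in>UNIV. (x $ i)\<^sup>2) > 0" for x :: "'m rspace"
    by (simp add: add_pos_nonneg sum_nonneg)
  define w where "w = (\<lambda>\<mu>. \<lambda>x :: 'm rspace. cpow \<mu> (1 + (\<Sum>i\<in>UNIV. (x $ i)\<^sup>2)))"
  have w: "smooth_open UNIV (w \<mu>)" for \<mu> unfolding w_def by (rule smooth_open_cpow[OF q q0])
  have "w \<mu> x * w (- \<mu>) x = 1" for x by (simp add: w_def cpow_minus)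
  from exists_polynomial_multiple_with_jet[OF w w this, of d c]
  obtain e where e: "\<forall>\<kappa>. sum \<kappa> UNIV \<le> d \<longrightarrow>
      mpart \<kappa> (\<lambda>x. w \<mu> x * (\<Sum>\<kappa> | sum \<kappa> UNIV \<le> d. e \<kappa> * dmono \<kappa> (cvec x))) 0 = c \<kappa>" by blast
  have "cell (column_section lam d e) (mat 1) = (\<lambda>x. w \<mu> x * (\<Sum>\<kappa> | sum \<kappa> UNIV \<le> d. e \<kappa> * dmono \<kappa> (cvec x)))"
    by (simp add: cell_def column_section_def fun_eq_iff w_def \<mu>_def sum_option nminus_eq cvec_def)
      (metis nminus_SL nminus_eq)?
  then show ?thesis using e d by (intro bexI[of _ "column_section lam d e"] column_section_induced) auto
qed

section \<open>Left translation, and smooth dependence on the base point\<close>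

lemma left_translate_apply: "x \<in> SL \<Longrightarrow> left_translate a f x = f (matrix_inv a ** x)"
  by (simp add: left_translate_def)

lemma cell_left_translate: "g \<in> SL \<Longrightarrow> cell (left_translate a f) g = cell f (matrix_inv a ** g)"
  by (simp add: cell_def fun_eq_iff left_translate_apply matrix_mul_assoc)

lemma bounded_linear_matrix_mult: "bounded_linear (\<lambda>x. (A :: real^'n::finite^'n) ** (x :: real^'n^'n))"
proof -
  have "linear (\<lambda>x. A ** (x :: real^'n^'n))"
    by (rule linearI) (simp_all add: vec_eq_iff matrix_matrix_mult_def distrib_left sum.distrib sum_distrib_left mult_ac)
  then show ?thesis by (simp add: linear_conv_bounded_linear)
qed

lemma left_translate_induced:
  assumes f: "f \<in> induced \<rho> lam \<alpha>" and a: "a \<in> SL"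
  shows "left_translate a f \<in> induced \<rho> lam \<alpha>"
proof -
  have "smooth_on SL (left_translate a f)"
    unfolding smooth_on_iff_local
  proof
    fix x :: "real^('a option)^('a option)" assume x: "x \<in> SL"
    then have "matrix_inv a ** x \<in> SL" using a by simp
    then obtain U F where U: "matrix_inv a ** x \<in> U" "smooth_open U F" "\<forall>y\<in>U \<inter> SL. F y = f y"
      using inducedD(2)[OF f] unfolding smooth_on_iff_local by meson
    show "\<exists>U F. x \<in> U \<and> smooth_open U F \<and> (\<forall>y\<in>U \<inter> SL. F y = left_translate a f y)"
      using smooth_open_affine[OF bounded_linear_matrix_mult U(2), of 0 "matrix_inv a"] U a
      by (intro exI[of _ "{y. matrix_inv a ** y \<in> U}"] exI[of _ "\<lambda>y. F (matrix_inv a ** y)"])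
        (simp add: left_translate_apply)
  qed
  moreover have "left_translate a f (g ** (levi h ** aexp t ** nplus x)) =
      matrix_inv (mat (sign_char \<alpha> h * exp (lam * of_real t)) ** \<rho> h) *v left_translate a f g"
    if "g \<in> SL" "h \<in> SLpm" for g h t x
    using inducedD(3)[OF f, of "matrix_inv a ** g" h t x] that a
    by (simp add: left_translate_apply matrix_mul_assoc)
  ultimately show ?thesis by (simp add: induced_def left_translate_def)
qed

text \<open>In the directions tangent to $N_-$ the partial derivatives of a section over the cell centred at
  \<open>g\<close> are given by left invariant vector fields, hence depend smoothly on \<open>g\<close>.\<close>

lemma smooth_on_SL_mpart_cell:
  fixes f :: "'m::{finite,linorder} gmat \<Rightarrow> complex^1"
  assumes f: "f \<in> induced triv lam \<alpha>"
  shows "smooth_on SL (\<lambda>g. mpart \<kappa> (cell f g) 0)"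
  unfolding smooth_on_iff_local
proof
  fix g0 :: "'m gmat" assume "g0 \<in> SL"
  then obtain U F where U: "g0 \<in> U" "smooth_open U F" "\<forall>y\<in>U \<inter> SL. F y = f y"
    using inducedD(2)[OF f] unfolding smooth_on_iff_local by meson
  define R where "R = (\<lambda>\<Psi> :: 'm gmat \<Rightarrow> 'm rspace \<Rightarrow> complex.
    \<exists>H. smooth_open U H \<and> (\<forall>g\<in>SL. \<forall>x. g ** nminus x \<in> U \<longrightarrow> \<Psi> g x = H (g ** nminus x)))"
  have "R (\<lambda>g. mpart \<kappa> (cell f g))"
  proof (rule mpart_family_induct)
    show "R (cell f)"
      unfolding R_def cell_def using U
      by (intro exI[of _ "\<lambda>y. F y $ 1"] conjI smooth_open_linear_compose[OF bounded_linear_vec_nth]) auto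
    fix j and \<Psi> :: "'m gmat \<Rightarrow> 'm rspace \<Rightarrow> complex"
    assume "R \<Psi>"
    then obtain H where H: "smooth_open U H"
      "\<And>g x. g \<in> SL \<Longrightarrow> g ** nminus x \<in> U \<Longrightarrow> \<Psi> g x = H (g ** nminus x)" unfolding R_def by blast
    let ?E = "\<lambda>a. matrix_unit a None :: 'm gmat"
    define K where "K = (\<lambda>g. \<Sum>a\<in>UNIV. g $ a $ Some j *\<^sub>R dderiv (?E a) H g)"
    have "smooth_open U K"
      unfolding K_def
      by (intro smooth_open_sum smooth_open_bilinear[OF bounded_bilinear_scaleR] smooth_open_dderiv H(1)
          smooth_open_subset[OF smooth_matrix_entry] smooth_open_open[OF H(1)]) auto
    moreover have "dderiv (axis j 1) (\<Psi> g) x = K (g ** nminus x)" if g: "g \<in> SL" and x: "g ** nminus x \<in> U" for g x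
    proof -
      let ?L = "\<lambda>x. g ** blk 0 0 x 0"
      let ?V = "{x. g + ?L x \<in> U}"
      have V: "open ?V" "x \<in> ?V"
        using open_affine_vimage[OF bounded_linear_mult_blk smooth_open_open[OF H(1)]] x by (auto simp: mult_nminus)
      have dH: "H differentiable (at (g + ?L x))" using V(2) by (intro smooth_open_differentiable[OF H(1)]) simp
      have "dderiv (axis j 1) (\<lambda>x. H (g + ?L x)) x = dderiv (axis j 1) (\<Psi> g) x"
        by (rule dderiv_cong[OF V _ dderiv_affine(2)[OF bounded_linear_mult_blk dH]])
          (use H(2)[OF g] in \<open>simp add: mult_nminus\<close>)
      then have "dderiv (axis j 1) (\<Psi> g) x = dderiv (?L (axis j 1)) H (g + ?L x)"
        using dderiv_affine(1)[OF bounded_linear_mult_blk dH] by simp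
      also have "?L (axis j 1) = (\<Sum>a\<in>UNIV. g $ a $ Some j *\<^sub>R ?E a)"
      proof -
        have 1: "(\<Sum>c\<in>UNIV. g $ a $ c * blk 0 0 (axis j 1) 0 $ c $ b) = (if b = None then g $ a $ Some j else 0)" for a b
          by (cases b) (simp_all add: sum_option axis_def if_distrib cong: if_cong)
        have 2: "(\<Sum>c\<in>UNIV. g $ c $ Some j * (if a = c \<and> b = None then 1 else 0)) = (if b = None then g $ a $ Some j else 0)" for a b
          by (cases b) (simp_all add: if_distrib cong: if_cong)
        have "?L (axis j 1) $ a $ b = (\<Sum>c\<in>UNIV. g $ c $ Some j *\<^sub>R ?E c) $ a $ b" for a b
          by (simp only: matrix_matrix_mult_def matrix_unit_def vec_lambda_beta sum_component
              vector_scaleR_component real_scaleR_def 1 2)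
        then show ?thesis by (simp only: vec_eq_iff) simp
      qed
      also have "dderiv (\<Sum>a\<in>UNIV. g $ a $ Some j *\<^sub>R ?E a) H (g + ?L x) = (\<Sum>a\<in>UNIV. g $ a $ Some j *\<^sub>R dderiv (?E a) H (g + ?L x))"
      proof -
        have lin: "linear (\<lambda>v. dderiv v H (g + ?L x))"
          using V(2) by (intro has_derivative_linear[OF smooth_open_has_derivative[OF H(1)]]) simp
        show ?thesis by (simp add: linear_sum[OF lin] linear_scale[OF lin])
      qed
      also have "\<dots> = K (g ** nminus x)"
      proof -
        have "(g ** nminus x) $ a $ Some j = g $ a $ Some j" for a
          by (simp add: matrix_matrix_mult_def nminus_eq sum_option mat_def if_distrib cong: if_cong)
        then show ?thesis by (simp add: K_def mult_nminus)
      qed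
      finally show ?thesis .
    qed
    ultimately show "R (\<lambda>g. dderiv (axis j 1) (\<Psi> g))" unfolding R_def by blast
  qed
  then obtain H where "smooth_open U H" "\<And>g x. g \<in> SL \<Longrightarrow> g ** nminus x \<in> U \<Longrightarrow> mpart \<kappa> (cell f g) x = H (g ** nminus x)"
    unfolding R_def by blast
  then show "\<exists>U F. g0 \<in> U \<and> smooth_open U F \<and> (\<forall>y\<in>U \<inter> SL. F y = mpart \<kappa> (cell f y) 0)"
    using U(1) by (intro exI[of _ U] exI[of _ H]) auto
qed

section \<open>Irreducibility of the polynomial representations\<close>

definition diagm :: "('m \<Rightarrow> real) \<Rightarrow> 'm::finite rmat" where
  "diagm d = (\<chi> a b. if a = b then d a else 0)"

lemma det_diagm: "det (diagm d) = (\<Prod>i\<in>UNIV. d i)"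
  unfolding diagm_def by (subst det_diagonal) simp_all

lemma cmat_diagm: "cmat (diagm d) *v y = (\<chi> i. of_real (d i) * y $ i)"
proof -
  have "(\<Sum>j\<in>UNIV. complex_of_real (if i = j then d i else 0) * y $ j) = of_real (d i) * y $ i" for i
  proof -
    have "(\<Sum>j\<in>UNIV. complex_of_real (if i = j then d i else 0) * y $ j) =
        (\<Sum>j\<in>UNIV. if i = j then of_real (d i) * y $ i else 0)" by (intro sum.cong) auto
    then show ?thesis by simp
  qed
  then show ?thesis by (simp add: vec_eq_iff cmat_def diagm_def matrix_vector_mult_def)
qed

lemma cmat_mult: "cmat (A ** B) = cmat A ** cmat B"
  by (simp add: cmat_def matrix_matrix_mult_def vec_eq_iff)

lemma cmat_id: "cmat (mat 1) = mat 1"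
  by (simp add: cmat_def mat_def vec_eq_iff)

lemma cmat_scaleR: "cmat (c *\<^sub>R A) *v y = of_real c *s (cmat A *v y)"
  by (simp add: cmat_def matrix_vector_mult_def vec_eq_iff sum_distrib_left mult.assoc)

lemma poly_act_in_Pol: "p \<in> Pol k \<Longrightarrow> poly_act g p \<in> Pol k"
  unfolding poly_act_def by (rule Pol_linear_substitution)

lemma Pol_homogeneous:
  assumes "p \<in> Pol k"
  shows "p (c *s y) = c ^ k * p y"
proof -
  obtain a where p: "p = (\<lambda>y. \<Sum>\<kappa>\<in>Xi k. a \<kappa> * dmono \<kappa> y)" using assms Pol_iff_dmono by blast
  show ?thesis unfolding p dmono_scale sum_distrib_left
    by (intro sum.cong refl) (simp add: Xi_def mult_ac)
qed

definition pol_submodule :: "nat \<Rightarrow> ('m::finite cspace \<Rightarrow> complex) set \<Rightarrow> bool" where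
  "pol_submodule k V \<longleftrightarrow> V \<subseteq> Pol k \<and> (\<lambda>y. 0) \<in> V \<and> (\<forall>p\<in>V. \<forall>q\<in>V. (\<lambda>y. p y + q y) \<in> V) \<and>
     (\<forall>c. \<forall>p\<in>V. (\<lambda>y. c * p y) \<in> V) \<and> (\<forall>g\<in>SL. \<forall>p\<in>V. poly_act g p \<in> V)"

text \<open>A matrix of positive determinant is a positive multiple of one in $SL$, and scalars act on
  homogeneous polynomials by scalars.\<close>

lemma positive_det_decomposition:
  fixes A :: "'m::finite rmat"
  assumes "det A > 0"
  shows "\<exists>g c. g \<in> SL \<and> (\<forall>k. \<forall>p\<in>Pol k. (\<lambda>y. p (cmat A *v y)) = (\<lambda>y. of_real c ^ k * poly_act g p y))"
proof -
  define c where "c = root CARD('m) (det A)"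
  have c: "c > 0" "c ^ CARD('m) = det A" using assms by (simp_all add: c_def)
  define B where "B = (1 / c) *\<^sub>R A"
  have B: "B \<in> SL" using c assms by (simp add: B_def SL_def det_scaleR power_divide)
  have A: "A = c *\<^sub>R B" using c by (simp add: B_def)
  have "matrix_inv (matrix_inv B) = B" by (rule matrix_inv_unique) (rule matrix_inv_SL(1)[OF B])
  then have "p (cmat A *v y) = of_real c ^ k * poly_act (matrix_inv B) p y" if "p \<in> Pol k" for p k y
    by (simp add: A cmat_scaleR Pol_homogeneous[OF that] poly_act_def)
  then show ?thesis using B by (intro exI[of _ "matrix_inv B"] exI[of _ c]) auto
qed

lemma pol_submodule_positive_det:
  assumes V: "pol_submodule k V" and p: "p \<in> V" and A: "det A > 0"
  shows "(\<lambda>y. p (cmat A *v y)) \<in> V"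
proof -
  obtain g c where "g \<in> SL" "\<forall>k. \<forall>p\<in>Pol k. (\<lambda>y. p (cmat A *v y)) = (\<lambda>y. of_real c ^ k * poly_act g p y)"
    using positive_det_decomposition[OF A] by blast
  moreover have "p \<in> Pol k" using V p unfolding pol_submodule_def by blast
  ultimately show ?thesis using V p unfolding pol_submodule_def by simp
qed

text \<open>The value at $2s$ minus $2^{n+1}$ times the value at \<open>s\<close> has no term of degree $n + 1$, which is the
  induction step.\<close>

lemma extract_coefficient:
  fixes V :: "('b \<Rightarrow> complex) set" and v :: "nat \<Rightarrow> 'b \<Rightarrow> complex"
  assumes add: "\<And>p q. p \<in> V \<Longrightarrow> q \<in> V \<Longrightarrow> (\<lambda>y. p y + q y) \<in> V"
    and cmult: "\<And>c p. p \<in> V \<Longrightarrow> (\<lambda>y. c * p y) \<in> V" and zero: "(\<lambda>y. 0) \<in> V"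
    and V: "\<And>s. s > 0 \<Longrightarrow> (\<lambda>y. \<Sum>i\<le>n. of_real s ^ i * v i y) \<in> V" and i: "i \<le> n"
  shows "v i \<in> V"
  using V i
proof (induction n arbitrary: v i)
  case 0
  then show ?case using "0.prems"(1)[of 1] by simp
next
  case (Suc n)
  have sumV: "(\<lambda>y. \<Sum>i\<in>I. u i y) \<in> V" if "\<And>i. i \<in> I \<Longrightarrow> u i \<in> V" for I :: "nat set" and u
    using that by (induction I rule: infinite_finite_induct) (auto intro: zero add)
  have low: "v i \<in> V" if "i \<le> n" for i
  proof -
    let ?a = "\<lambda>i. (2 ^ i - 2 ^ Suc n :: complex)"
    have comb: "(\<lambda>y. \<Sum>i\<le>n. of_real s ^ i * (?a i * v i y)) \<in> V" if s: "s > 0" for s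
    proof -
      have "(\<lambda>y. (\<Sum>i\<le>Suc n. of_real (2 * s) ^ i * v i y) + (- (2 ^ Suc n)) * (\<Sum>i\<le>Suc n. of_real s ^ i * v i y)) \<in> V"
        by (intro add cmult Suc.prems) (use s in auto)
      moreover have "(\<Sum>i\<le>Suc n. of_real (2 * s) ^ i * v i y) + (- (2 ^ Suc n)) * (\<Sum>i\<le>Suc n. of_real s ^ i * v i y) =
          (\<Sum>i\<le>Suc n. of_real s ^ i * (?a i * v i y))" for y
        unfolding sum_distrib_left sum.distrib[symmetric]
        by (intro sum.cong refl) (simp add: power_mult_distrib algebra_simps)
      ultimately show ?thesis by simp
    qed
    have "(\<lambda>y. ?a i * v i y) \<in> V"
      by (rule Suc.IH[where v = "\<lambda>i y. ?a i * v i y", OF _ that]) (rule comb)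
    then have "(\<lambda>y. (1 / ?a i) * (?a i * v i y)) \<in> V" by (rule cmult)
    moreover have "?a i \<noteq> 0"
    proof -
      have "(2::nat) ^ i < 2 ^ Suc n" using that by (intro power_strict_increasing) auto
      then have "of_nat (2 ^ i) \<noteq> (of_nat (2 ^ Suc n) :: complex)" by (metis less_irrefl of_nat_eq_iff)
      then show ?thesis by simp
    qed
    ultimately show ?thesis by simp
  qed
  show ?case
  proof (cases "i \<le> n")
    case False
    then have "i = Suc n" using Suc.prems(2) by simp
    have "(\<lambda>y. (\<Sum>i\<le>Suc n. of_real 1 ^ i * v i y) + (-1) * (\<Sum>i\<le>n. v i y)) \<in> V"
      by (intro add cmult sumV Suc.prems low) auto
    then show ?thesis using \<open>i = Suc n\<close> by simp
  qed (use low in blast)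
qed

definition stretch :: "'m \<Rightarrow> real \<Rightarrow> 'm::finite rmat" where
  "stretch j s = diagm (\<lambda>i. if i = j then s else 1)"

lemma det_stretch: "det (stretch j s) = s"
  by (simp add: stretch_def det_diagm)

lemma dmono_stretch: "dmono \<kappa> (cmat (stretch j s) *v y) = of_real s ^ \<kappa> j * dmono \<kappa> y"
proof -
  have "(\<Prod>i\<in>UNIV - {j}. (of_real (if i = j then s else 1) * y $ i) ^ \<kappa> i / fact (\<kappa> i)) =
      (\<Prod>i\<in>UNIV - {j}. (y $ i) ^ \<kappa> i / fact (\<kappa> i))" by (intro prod.cong) auto
  then show ?thesis
    unfolding stretch_def cmat_diagm dmono_split[of _ _ j] by (simp add: power_mult_distrib)
qed

lemma Xi_le: "\<kappa> \<in> Xi k \<Longrightarrow> \<kappa> j \<le> k"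
  unfolding Xi_def by (auto intro: member_le_sum)

text \<open>Stretching one coordinate multiplies the part with a given exponent in this coordinate by a power, so
  submodules contain these parts; all coordinates are treated in turn.\<close>

lemma pol_submodule_component:
  fixes c :: "('m::finite \<Rightarrow> nat) \<Rightarrow> complex"
  assumes V: "pol_submodule k V" and p: "(\<lambda>y. \<Sum>\<kappa>\<in>Xi k. c \<kappa> * dmono \<kappa> y) \<in> V" and \<kappa>0: "\<kappa>0 \<in> Xi k"
  shows "(\<lambda>y. c \<kappa>0 * dmono \<kappa>0 y) \<in> V"
proof -
  have cl: "\<And>p q. p \<in> V \<Longrightarrow> q \<in> V \<Longrightarrow> (\<lambda>y. p y + q y) \<in> V" "\<And>c p. p \<in> V \<Longrightarrow> (\<lambda>y. c * p y) \<in> V" "(\<lambda>y. 0) \<in> V"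
    using V unfolding pol_submodule_def by auto
  have "(\<lambda>y. \<Sum>\<kappa> | \<kappa> \<in> Xi k \<and> (\<forall>j\<in>F. \<kappa> j = \<kappa>0 j). c \<kappa> * dmono \<kappa> y) \<in> V" if "finite F" for F
    using that
  proof (induction F)
    case empty
    then show ?case using p by simp
  next
    case (insert j F)
    let ?S = "{\<kappa> \<in> Xi k. \<forall>j\<in>F. \<kappa> j = \<kappa>0 j}"
    have fin: "finite ?S" by simp
    let ?v = "\<lambda>i y. \<Sum>\<kappa> | \<kappa> \<in> ?S \<and> \<kappa> j = i. c \<kappa> * dmono \<kappa> y"
    have "?v (\<kappa>0 j) \<in> V"
    proof (rule extract_coefficient[where n = k and v = ?v and i = "\<kappa>0 j", OF cl])
      fix s :: real assume "s > 0"
      then have "(\<lambda>y. \<Sum>\<kappa>\<in>?S. c \<kappa> * dmono \<kappa> (cmat (stretch j s) *v y)) \<in> V"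
        using pol_submodule_positive_det[OF V insert.IH, of "stretch j s"] by (simp add: det_stretch)
      moreover have "(\<Sum>\<kappa>\<in>?S. c \<kappa> * dmono \<kappa> (cmat (stretch j s) *v y)) = (\<Sum>i\<le>k. of_real s ^ i * ?v i y)" for y
      proof -
        have "(\<Sum>\<kappa>\<in>?S. c \<kappa> * dmono \<kappa> (cmat (stretch j s) *v y)) =
            (\<Sum>i\<le>k. \<Sum>\<kappa> | \<kappa> \<in> ?S \<and> \<kappa> j = i. c \<kappa> * dmono \<kappa> (cmat (stretch j s) *v y))"
          by (rule sum.group[symmetric, OF fin]) (auto dest: Xi_le)
        also have "\<dots> = (\<Sum>i\<le>k. of_real s ^ i * ?v i y)"
          unfolding sum_distrib_left by (intro sum.cong refl) (auto simp: dmono_stretch)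
        finally show ?thesis .
      qed
      ultimately show "(\<lambda>y. \<Sum>i\<le>k. of_real s ^ i * ?v i y) \<in> V" by simp
    qed (use \<kappa>0 Xi_le in auto)
    moreover have "{\<kappa>. \<kappa> \<in> ?S \<and> \<kappa> j = \<kappa>0 j} = {\<kappa>. \<kappa> \<in> Xi k \<and> (\<forall>j\<in>insert j F. \<kappa> j = \<kappa>0 j)}" by auto
    ultimately show ?case by simp
  qed
  from this[of UNIV] have "(\<lambda>y. \<Sum>\<kappa> | \<kappa> \<in> Xi k \<and> (\<forall>j. \<kappa> j = \<kappa>0 j). c \<kappa> * dmono \<kappa> y) \<in> V" by simp
  moreover have "{\<kappa>. \<kappa> \<in> Xi k \<and> (\<forall>j. \<kappa> j = \<kappa>0 j)} = {\<kappa>0}" using \<kappa>0 by (auto simp: fun_eq_iff)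
  ultimately show ?thesis by simp
qed

definition shear :: "'m \<Rightarrow> 'm \<Rightarrow> real \<Rightarrow> 'm::finite rmat" where
  "shear i j s = (\<chi> a b. if a = b then 1 else if a = i \<and> b = j then s else 0)"

lemma det_shear:
  assumes "i \<noteq> j"
  shows "det (shear i j s) = 1"
proof -
  have "shear i j s = (\<chi> a. if a = i then row i (mat 1) + s *s row j (mat 1) else row a (mat 1))"
    using assms by (auto simp: shear_def vec_eq_iff row_def mat_def)
  then show ?thesis using det_row_operation[OF assms, of "mat 1" s] by simp
qed

lemma cmat_shear:
  assumes "i \<noteq> j"
  shows "(cmat (shear i j s) *v y) $ a = (if a = i then y $ i + of_real s * y $ j else y $ a)"
proof -
  have "(\<Sum>b\<in>UNIV. of_real (if a = b then 1 else if a = i \<and> b = j then s else 0) * y $ b) =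
      (\<Sum>b\<in>UNIV. (if a = b then y $ b else 0) + (if j = b then (if a = i then of_real s * y $ b else 0) else 0))"
    using assms by (intro sum.cong) auto
  then show ?thesis
    by (simp add: cmat_def shear_def matrix_vector_mult_def sum.distrib)
qed

text \<open>The infinitesimal shear moves one unit of exponent from \<open>i\<close> to \<open>j\<close>.\<close>

lemma pol_submodule_move:
  fixes \<kappa> :: "'m::finite \<Rightarrow> nat"
  assumes V: "pol_submodule k V" and \<kappa>: "dmono \<kappa> \<in> V" and ij: "i \<noteq> j" and i: "\<kappa> i > 0"
  shows "dmono (bump j (\<kappa>(i := \<kappa> i - 1))) \<in> V"
proof -
  have cl: "\<And>p q. p \<in> V \<Longrightarrow> q \<in> V \<Longrightarrow> (\<lambda>y. p y + q y) \<in> V" "\<And>c p. p \<in> V \<Longrightarrow> (\<lambda>y. c * p y) \<in> V" "(\<lambda>y. 0) \<in> V"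
    using V unfolding pol_submodule_def by auto
  let ?R = "\<lambda>y :: 'm::finite cspace. \<Prod>l\<in>UNIV - {i}. (y $ l) ^ \<kappa> l / fact (\<kappa> l)"
  let ?v = "\<lambda>a y. (y $ j) ^ a / fact a * ((y $ i) ^ (\<kappa> i - a) / fact (\<kappa> i - a)) * ?R y"
  have "?v 1 \<in> V"
  proof (rule extract_coefficient[where n = "\<kappa> i" and v = ?v and i = 1, OF cl])
    fix s :: real
    have "(\<lambda>y. dmono \<kappa> (cmat (shear i j s) *v y)) \<in> V"
      by (rule pol_submodule_positive_det[OF V \<kappa>]) (simp add: det_shear[OF ij])
    moreover have "dmono \<kappa> (cmat (shear i j s) *v y) = (\<Sum>a\<le>\<kappa> i. of_real s ^ a * ?v a y)" for y
    proof -
      have "(\<Prod>l\<in>UNIV - {i}. ((cmat (shear i j s) *v y) $ l) ^ \<kappa> l / fact (\<kappa> l)) = ?R y"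
        by (intro prod.cong) (auto simp: cmat_shear[OF ij])
      then have "dmono \<kappa> (cmat (shear i j s) *v y) = (of_real s * y $ j + y $ i) ^ \<kappa> i / fact (\<kappa> i) * ?R y"
        unfolding dmono_split[of _ _ i] by (simp add: cmat_shear[OF ij] add.commute)
      also have "(of_real s * y $ j + y $ i) ^ \<kappa> i / fact (\<kappa> i) =
          (\<Sum>a\<le>\<kappa> i. of_real s ^ a * ((y $ j) ^ a / fact a * ((y $ i) ^ (\<kappa> i - a) / fact (\<kappa> i - a))))"
        unfolding binomial_ring sum_divide_distrib
        by (intro sum.cong refl) (simp add: binomial_fact power_mult_distrib field_simps)
      finally show ?thesis by (simp add: sum_distrib_right mult.assoc)
    qed
    ultimately show "(\<lambda>y. \<Sum>a\<le>\<kappa> i. of_real s ^ a * ?v a y) \<in> V" by simp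
  qed (use i in auto)
  moreover have "?v 1 = (\<lambda>y. of_nat (Suc (\<kappa> j)) * dmono (bump j (\<kappa>(i := \<kappa> i - 1))) y)"
  proof
    fix y :: "'m cspace"
    have "(\<Prod>l\<in>UNIV - {i}. (y $ l) ^ (\<kappa>(i := \<kappa> i - 1)) l / fact ((\<kappa>(i := \<kappa> i - 1)) l)) = ?R y"
      by (intro prod.cong) auto
    then have "dmono (\<kappa>(i := \<kappa> i - 1)) y = (y $ i) ^ (\<kappa> i - 1) / fact (\<kappa> i - 1) * ?R y"
      unfolding dmono_split[of _ _ i] by simp
    then show "?v 1 y = of_nat (Suc (\<kappa> j)) * dmono (bump j (\<kappa>(i := \<kappa> i - 1))) y"
      using dmono_bump[of "\<kappa>(i := \<kappa> i - 1)" j y] ij by (simp del: of_nat_Suc add: mult.assoc)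
  qed
  ultimately have "(\<lambda>y. of_nat (Suc (\<kappa> j)) * dmono (bump j (\<kappa>(i := \<kappa> i - 1))) y) \<in> V" by simp
  from cl(2)[OF this, of "1 / of_nat (Suc (\<kappa> j))"] show ?thesis by (simp del: of_nat_Suc)
qed

text \<open>Every move decreases the total excess of \<open>\<kappa>\<close> over \<open>\<kappa>'\<close>.\<close>

lemma pol_submodule_connected:
  fixes \<kappa> \<kappa>' :: "'m::finite \<Rightarrow> nat"
  assumes V: "pol_submodule k V" and "dmono \<kappa> \<in> V" "\<kappa> \<in> Xi k" "\<kappa>' \<in> Xi k"
  shows "dmono \<kappa>' \<in> V"
  using assms(2,3)
proof (induction "\<Sum>l\<in>UNIV. \<kappa> l - \<kappa>' l" arbitrary: \<kappa> rule: less_induct)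
  case less
  have sums: "sum \<kappa> UNIV = sum \<kappa>' UNIV" using less.prems assms(4) by (simp add: Xi_def)
  show ?case
  proof (cases "\<exists>i. \<kappa> i > \<kappa>' i")
    case True
    then obtain i where i: "\<kappa> i > \<kappa>' i" ..
    have "\<exists>j. \<kappa> j < \<kappa>' j"
    proof (rule ccontr)
      assume "\<not> ?thesis"
      then have "sum \<kappa>' UNIV < sum \<kappa> UNIV"
        using i by (intro sum_strict_mono_ex1) (auto simp: not_less)
      then show False using sums by simp
    qed
    then obtain j where j: "\<kappa> j < \<kappa>' j" ..
    have ij: "i \<noteq> j" using i j by auto
    let ?\<kappa> = "bump j (\<kappa>(i := \<kappa> i - 1))"
    have "dmono ?\<kappa> \<in> V" using pol_submodule_move[OF V less.prems(1) ij] i by simp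
    moreover have "?\<kappa> \<in> Xi k"
    proof -
      have "bump i (\<kappa>(i := \<kappa> i - 1)) = \<kappa>" using i by (intro bump_lower) simp
      then have "Suc (sum (\<kappa>(i := \<kappa> i - 1)) UNIV) = sum \<kappa> UNIV" using sum_bump by metis
      then show ?thesis using less.prems(2) by (simp only: Xi_def mem_Collect_eq sum_bump)
    qed
    moreover have "(\<Sum>l\<in>UNIV. ?\<kappa> l - \<kappa>' l) < (\<Sum>l\<in>UNIV. \<kappa> l - \<kappa>' l)"
    proof (rule sum_strict_mono_ex1)
      show "\<forall>l\<in>UNIV. ?\<kappa> l - \<kappa>' l \<le> \<kappa> l - \<kappa>' l" using j by (auto simp: bump_def)
      show "\<exists>l\<in>UNIV. ?\<kappa> l - \<kappa>' l < \<kappa> l - \<kappa>' l" using i ij by (intro bexI[of _ i]) (auto simp: bump_def)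
    qed simp
    ultimately show ?thesis by (intro less.hyps) auto
  next
    case False
    have "\<kappa> = \<kappa>'"
      using False sums by (intro ext sum_mono_inv[of \<kappa> UNIV \<kappa>']) (auto simp: not_less)
    then show ?thesis using less.prems by simp
  qed
qed

lemma pol_submodule_irreducible:
  assumes V: "pol_submodule k V" and p: "p \<in> V" "p \<noteq> (\<lambda>y. 0)"
  shows "V = Pol k"
proof -
  have cl: "\<And>p q. p \<in> V \<Longrightarrow> q \<in> V \<Longrightarrow> (\<lambda>y. p y + q y) \<in> V" "\<And>c p. p \<in> V \<Longrightarrow> (\<lambda>y. c * p y) \<in> V" "(\<lambda>y. 0) \<in> V"
    "V \<subseteq> Pol k" using V unfolding pol_submodule_def by auto
  obtain c where c: "p = (\<lambda>y. \<Sum>\<kappa>\<in>Xi k. c \<kappa> * dmono \<kappa> y)" using p(1) cl(4) Pol_iff_dmono by blast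
  have "\<exists>\<kappa>\<in>Xi k. c \<kappa> \<noteq> 0" using p(2) by (rule contrapos_np) (simp add: c)
  then obtain \<kappa>0 where \<kappa>0: "\<kappa>0 \<in> Xi k" "c \<kappa>0 \<noteq> 0" by blast
  have "(\<lambda>y. c \<kappa>0 * dmono \<kappa>0 y) \<in> V"
    by (rule pol_submodule_component[OF V _ \<kappa>0(1)]) (use p(1) c in simp)
  from cl(2)[OF this, of "1 / c \<kappa>0"] have "dmono \<kappa>0 \<in> V" using \<kappa>0(2) by simp
  then have mono: "dmono \<kappa> \<in> V" if "\<kappa> \<in> Xi k" for \<kappa>
    by (rule pol_submodule_connected[OF V _ \<kappa>0(1) that])
  have "q \<in> V" if "q \<in> Pol k" for q
  proof -
    obtain d where q: "q = (\<lambda>y. \<Sum>\<kappa>\<in>Xi k. d \<kappa> * dmono \<kappa> y)"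
      using \<open>q \<in> Pol k\<close> unfolding Pol_iff_dmono by (rule exE)
    have "(\<lambda>y. \<Sum>\<kappa>\<in>I. d \<kappa> * dmono \<kappa> y) \<in> V" if "I \<subseteq> Xi k" for I
      using finite_subset[OF that finite_Xi] that
    proof (induction I rule: finite_induct)
      case (insert \<kappa> I)
      then show ?case using cl(1)[OF cl(2)[OF mono[of \<kappa>]] insert.IH, of "d \<kappa>"] by simp
    qed (use cl in simp)
    then show ?thesis unfolding q by simp
  qed
  then show ?thesis using cl(4) by blast
qed

section \<open>Equivariant maps from polynomials\<close>

definition pol_linear :: "nat \<Rightarrow> (('m::finite cspace \<Rightarrow> complex) \<Rightarrow> complex^'d) \<Rightarrow> bool" where
  "pol_linear k l \<longleftrightarrow> (\<forall>p\<in>Pol k. \<forall>q\<in>Pol k. l (\<lambda>y. p y + q y) = l p + l q) \<and>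
     (\<forall>c. \<forall>p\<in>Pol k. l (\<lambda>y. c * p y) = c *s l p)"

definition pol_equivariant ::
    "('m::finite rmat) set \<Rightarrow> nat \<Rightarrow> ('m rmat \<Rightarrow> complex^'d^'d) \<Rightarrow> (('m cspace \<Rightarrow> complex) \<Rightarrow> complex^'d) \<Rightarrow> bool" where
  "pol_equivariant S k \<rho> l \<longleftrightarrow> (\<forall>g\<in>S. \<forall>p\<in>Pol k. l (poly_act g p) = \<rho> g *v l p)"

lemma poly_iso_alt:
  "poly_iso S k \<rho> T \<longleftrightarrow> bij_betw T (Pol k) UNIV \<and> pol_linear k T \<and> pol_equivariant S k \<rho> T"
  by (auto simp: poly_iso_def pol_linear_def pol_equivariant_def)

lemma pol_linear_add: "pol_linear k l \<Longrightarrow> p \<in> Pol k \<Longrightarrow> q \<in> Pol k \<Longrightarrow> l (\<lambda>y. p y + q y) = l p + l q"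
  by (simp add: pol_linear_def)

lemma pol_linear_cmult: "pol_linear k l \<Longrightarrow> p \<in> Pol k \<Longrightarrow> l (\<lambda>y. c * p y) = c *s l p"
  by (simp add: pol_linear_def)

lemma pol_equivariantD: "pol_equivariant S k \<rho> l \<Longrightarrow> g \<in> S \<Longrightarrow> p \<in> Pol k \<Longrightarrow> l (poly_act g p) = \<rho> g *v l p"
  by (simp add: pol_equivariant_def)

lemma pol_linear_zero: "pol_linear k l \<Longrightarrow> l (\<lambda>y. 0) = 0"
  using pol_linear_cmult[OF _ Pol_zero, of k l 0] by simp

lemma pol_linear_sum:
  assumes "pol_linear k l" "\<And>i. i \<in> I \<Longrightarrow> f i \<in> Pol k" "finite I"
  shows "l (\<lambda>y. \<Sum>i\<in>I. c i * f i y) = (\<Sum>i\<in>I. c i *s l (f i))"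
  using assms(3,2)
proof (induction I rule: finite_induct)
  case empty
  then show ?case using pol_linear_zero[OF assms(1)] by simp
next
  case (insert i I)
  have "(\<lambda>y. c i * f i y) \<in> Pol k" "(\<lambda>y. \<Sum>i\<in>I. c i * f i y) \<in> Pol k"
    using insert.prems by (auto intro!: Pol_cmult Pol_sum)
  then show ?case
    using insert by (simp add: pol_linear_add[OF assms(1)] pol_linear_cmult[OF assms(1)])
qed

lemma kernel_pol_submodule:
  assumes "pol_linear k l" "pol_equivariant SL k \<rho> l"
  shows "pol_submodule k {p \<in> Pol k. l p = 0}"
  using assms pol_linear_zero[OF assms(1)]
  unfolding pol_submodule_def pol_linear_def pol_equivariant_def
  by (auto intro!: Pol_zero Pol_add Pol_cmult poly_act_in_Pol)

text \<open>Kernel and image of a nonzero equivariant map are trivial by irreducibility on both sides.\<close>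

lemma equivariant_nonzero_imp_iso:
  fixes \<rho> :: "'m::finite rmat \<Rightarrow> complex^'d^'d"
  assumes l: "pol_linear k l" "pol_equivariant SL k \<rho> l" and irr: "irreducible_on SL \<rho>"
    and nz: "p \<in> Pol k" "l p \<noteq> 0"
  shows "poly_iso SL k \<rho> l"
proof -
  have ker: "q = (\<lambda>y. 0)" if "q \<in> Pol k" "l q = 0" for q
  proof (rule ccontr)
    assume "q \<noteq> (\<lambda>y. 0)"
    then have "{p \<in> Pol k. l p = 0} = Pol k"
      using pol_submodule_irreducible[OF kernel_pol_submodule[OF l], of q] that by simp
    then show False using nz by auto
  qed
  have "inj_on l (Pol k)"
  proof (rule inj_onI)
    fix p q assume pq: "p \<in> Pol k" "q \<in> Pol k" "l p = l q"
    then have m: "(\<lambda>y. (-1) * q y) \<in> Pol k" by (intro Pol_cmult)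
    have "l (\<lambda>y. p y + (-1) * q y) = l p + (-1) *s l q"
      by (simp only: pol_linear_add[OF l(1) pq(1) m] pol_linear_cmult[OF l(1) pq(2)])
    also have "\<dots> = 0" using pq by (simp add: vec_eq_iff)
    finally have "(\<lambda>y. p y + (-1) * q y) = (\<lambda>y. 0)" by (rule ker[OF Pol_add[OF pq(1) m]])
    then show "p = q" by (simp add: fun_eq_iff)
  qed
  moreover have "l ` Pol k = UNIV"
  proof -
    have "vec.subspace (l ` Pol k)"
      unfolding vec.subspace_def
    proof (intro conjI ballI allI)
      show "0 \<in> l ` Pol k" using pol_linear_zero[OF l(1)] Pol_zero by (metis imageI)
      fix x y assume "x \<in> l ` Pol k" "y \<in> l ` Pol k"
      then obtain p q where "p \<in> Pol k" "q \<in> Pol k" "x = l p" "y = l q" by blast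
      then show "x + y \<in> l ` Pol k"
        using pol_linear_add[OF l(1), of p q] by (intro image_eqI[OF _ Pol_add[of p k q]]) simp_all
    next
      fix c x assume "x \<in> l ` Pol k"
      then obtain p where "p \<in> Pol k" "x = l p" by blast
      then show "c *s x \<in> l ` Pol k"
        using pol_linear_cmult[OF l(1), of p c] by (intro image_eqI[OF _ Pol_cmult[of p k c]]) simp_all
    qed
    moreover have "\<forall>g\<in>SL. \<forall>v\<in>l ` Pol k. \<rho> g *v v \<in> l ` Pol k"
    proof (intro ballI)
      fix g :: "'m rmat" and v assume g: "g \<in> SL" and "v \<in> l ` Pol k"
      then obtain p where "p \<in> Pol k" "v = l p" by blast
      then show "\<rho> g *v v \<in> l ` Pol k"
        using pol_equivariantD[OF l(2) g, of p] by (intro image_eqI[OF _ poly_act_in_Pol[of p k g]]) simp_all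
    qed
    ultimately have "l ` Pol k = {0} \<or> l ` Pol k = UNIV" using irr unfolding irreducible_on_def by blast
    then show ?thesis using nz by blast
  qed
  ultimately show ?thesis using l by (simp add: poly_iso_alt bij_betw_def)
qed

text \<open>A relation between two equivariant maps persists under matrices of positive determinant, in
  particular under the full torus of positive diagonal matrices, which separates the monomials.\<close>

lemma equivariant_positive_det:
  assumes T: "pol_linear k T" "pol_equivariant SL k \<rho> T" and l: "pol_linear k l" "pol_equivariant SL k \<rho> l"
    and pq: "p \<in> Pol k" "q \<in> Pol k" "T q = l p" and A: "det A > 0"
  shows "T (\<lambda>y. q (cmat A *v y)) = l (\<lambda>y. p (cmat A *v y))"
proof -
  obtain g c where g: "g \<in> SL" "\<forall>k. \<forall>p\<in>Pol k. (\<lambda>y. p (cmat A *v y)) = (\<lambda>y. of_real c ^ k * poly_act g p y)"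
    using positive_det_decomposition[OF A] by blast
  have "T (\<lambda>y. of_real c ^ k * poly_act g q y) = of_real c ^ k *s (\<rho> g *v T q)"
    by (simp only: pol_linear_cmult[OF T(1) poly_act_in_Pol[OF pq(2)]] pol_equivariantD[OF T(2) g(1) pq(2)])
  moreover have "l (\<lambda>y. of_real c ^ k * poly_act g p y) = of_real c ^ k *s (\<rho> g *v l p)"
    by (simp only: pol_linear_cmult[OF l(1) poly_act_in_Pol[OF pq(1)]] pol_equivariantD[OF l(2) g(1) pq(1)])
  ultimately show ?thesis using g(2) pq by simp
qed

lemma Xi_nonempty: "\<exists>\<kappa>. \<kappa> \<in> (Xi k :: ('m::finite \<Rightarrow> nat) set)"
proof -
  have "(\<lambda>i. if i = (SOME j. True) then k else 0) \<in> (Xi k :: ('m \<Rightarrow> nat) set)" by (simp add: Xi_def)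
  then show ?thesis by blast
qed

text \<open>Schur's lemma. An eigenvector is found by weights: a monomial spans its weight space.\<close>

lemma equivariant_unique:
  fixes T l :: "('m::{finite,linorder} cspace \<Rightarrow> complex) \<Rightarrow> complex^'d"
  assumes T: "poly_iso SL k \<rho> T" and l: "pol_linear k l" "pol_equivariant SL k \<rho> l"
  shows "\<exists>c. \<forall>p\<in>Pol k. l p = c *s T p"
proof -
  have T': "pol_linear k T" "pol_equivariant SL k \<rho> T" "inj_on T (Pol k)" "T ` Pol k = UNIV"
    using T by (auto simp: poly_iso_alt bij_betw_def)
  obtain \<kappa>0 where \<kappa>0: "\<kappa>0 \<in> (Xi k :: ('m \<Rightarrow> nat) set)" using Xi_nonempty by blast
  note m0 = dmono_in_Pol[OF \<kappa>0]
  obtain q where q: "q \<in> Pol k" "T q = l (dmono \<kappa>0)" using T'(4) by (metis UNIV_I imageE)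
  have weight: "q (cmat (stretch j 2) *v y) = 2 ^ \<kappa>0 j * q y" for j y
  proof -
    have "T (\<lambda>y. q (cmat (stretch j 2) *v y)) = l (\<lambda>y. dmono \<kappa>0 (cmat (stretch j 2) *v y))"
      by (rule equivariant_positive_det[OF T'(1,2) l m0 q]) (simp add: det_stretch)
    also have "(\<lambda>y. dmono \<kappa>0 (cmat (stretch j 2) *v y)) = (\<lambda>y. 2 ^ \<kappa>0 j * dmono \<kappa>0 y)"
      by (simp add: dmono_stretch)
    also have "l \<dots> = 2 ^ \<kappa>0 j *s T q" unfolding q(2) by (rule pol_linear_cmult[OF l(1) m0])
    also have "\<dots> = T (\<lambda>y. 2 ^ \<kappa>0 j * q y)" by (rule pol_linear_cmult[OF T'(1) q(1), symmetric])
    finally have "(\<lambda>y. q (cmat (stretch j 2) *v y)) = (\<lambda>y. 2 ^ \<kappa>0 j * q y)"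
      by (rule inj_onD[OF T'(3) _ Pol_linear_substitution[OF q(1)] Pol_cmult[OF q(1)]])
    then show ?thesis by (rule fun_cong)
  qed
  obtain b where b: "q = (\<lambda>y. \<Sum>\<kappa>\<in>Xi k. b \<kappa> * dmono \<kappa> y)" using q(1) Pol_iff_dmono by blast
  \<comment> \<open>Coefficientwise, the stretch multiplies by $2^{\kappa_j}$; comparison with $2^{\kappa^0_j}$ leaves only \<open>\<kappa>0\<close>.\<close>
  have b0: "b \<kappa> = 0" if "\<kappa> \<in> Xi k" "\<kappa> \<noteq> \<kappa>0" for \<kappa>
  proof -
    obtain j where j: "\<kappa> j \<noteq> \<kappa>0 j" using \<open>\<kappa> \<noteq> \<kappa>0\<close> by (auto simp: fun_eq_iff)
    have e1: "(\<lambda>y. q (cmat (stretch j 2) *v y)) = (\<lambda>y. \<Sum>\<kappa>\<in>Xi k. (b \<kappa> * 2 ^ \<kappa> j) * dmono \<kappa> y)"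
      by (simp add: b dmono_stretch mult.assoc)
    have e2: "(\<lambda>y. q (cmat (stretch j 2) *v y)) = (\<lambda>y. \<Sum>\<kappa>\<in>Xi k. (2 ^ \<kappa>0 j * b \<kappa>) * dmono \<kappa> y)"
      by (rule ext, subst weight) (simp add: b sum_distrib_left mult.assoc)
    have "b \<kappa> * 2 ^ \<kappa> j = 2 ^ \<kappa>0 j * b \<kappa>"
      using trans[OF mpart_Pol[OF e1, of \<kappa>, symmetric] mpart_Pol[OF e2, of \<kappa>]] that(1) by (simp only: if_True)
    moreover have "(2::complex) ^ \<kappa> j \<noteq> 2 ^ \<kappa>0 j"
    proof -
      have "(2::nat) ^ \<kappa> j \<noteq> 2 ^ \<kappa>0 j" using j by simp
      then have "of_nat (2 ^ \<kappa> j) \<noteq> (of_nat (2 ^ \<kappa>0 j) :: complex)" by (simp only: of_nat_eq_iff not_False_eq_True)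
      then show ?thesis by simp
    qed
    ultimately show ?thesis by (simp add: mult.commute)
  qed
  have "q = (\<lambda>y. b \<kappa>0 * dmono \<kappa>0 y)"
  proof -
    have "(\<Sum>\<kappa>\<in>Xi k. b \<kappa> * dmono \<kappa> y) = (\<Sum>\<kappa>\<in>{\<kappa>0}. b \<kappa> * dmono \<kappa> y)" for y
      using \<kappa>0 b0 by (intro sum.mono_neutral_right) auto
    then show ?thesis by (simp add: b)
  qed
  then have eig: "l (dmono \<kappa>0) = b \<kappa>0 *s T (dmono \<kappa>0)"
    using q(2) pol_linear_cmult[OF T'(1) m0] by metis
  define d where "d = (\<lambda>p. l p + (- b \<kappa>0) *s T p)"
  have "pol_linear k d" "pol_equivariant SL k \<rho> d"
    using l T'(1,2) unfolding pol_linear_def pol_equivariant_def d_def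
    by (simp_all add: vector_add_ldistrib matrix_vector_right_distrib vector_smult_assoc mult.commute vec.scale algebra_simps)
  from kernel_pol_submodule[OF this] have "{p \<in> Pol k. d p = 0} = Pol k"
    by (rule pol_submodule_irreducible[where p = "dmono \<kappa>0"])
      (use m0 eig mpart_dmono_zero[of \<kappa>0 \<kappa>0] in \<open>auto simp: d_def vec_eq_iff\<close>)
  then have "\<forall>p\<in>Pol k. d p = 0" by blast
  then show ?thesis by (intro exI[of _ "b \<kappa>0"]) (auto simp: d_def vec_eq_iff add_eq_0_iff)
qed


section \<open>The sign of the inducing character\<close>

text \<open>Equivariance under $M$ of the symbol of a differential operator of order \<open>k\<close> at the base point.\<close>

definition levi_equivariant ::
    "int \<Rightarrow> int \<Rightarrow> nat \<Rightarrow> ('m::finite rmat \<Rightarrow> complex^'d^'d) \<Rightarrow> (('m cspace \<Rightarrow> complex) \<Rightarrow> complex^'d) \<Rightarrow> bool" where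
  "levi_equivariant \<alpha> \<beta> k \<rho> l \<longleftrightarrow> (\<forall>h\<in>SLpm. \<forall>p\<in>Pol k.
     (sign_char \<alpha> h * of_real (det h) ^ k) *s l (poly_act h p) = sign_char \<beta> h *s (\<rho> h *v l p))"

lemma levi_equivariant_SL:
  assumes "levi_equivariant \<alpha> \<beta> k \<rho> l"
  shows "pol_equivariant SL k \<rho> l"
  unfolding pol_equivariant_def
proof (intro ballI)
  fix g :: "real^'a^'a" and p :: "complex^'a \<Rightarrow> complex" assume "g \<in> SL" "p \<in> Pol k"
  then have "(sign_char \<alpha> g * of_real (det g) ^ k) *s l (poly_act g p) = sign_char \<beta> g *s (\<rho> g *v l p)"
    using assms SL_SLpm unfolding levi_equivariant_def by blast
  then show "l (poly_act g p) = \<rho> g *v l p" using \<open>g \<in> SL\<close> by (simp add: sign_char_SL) (simp add: SL_def)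
qed

lemma card_1_matrix:
  fixes h :: "'m::finite rmat"
  assumes "CARD('m) = 1"
  shows "h = det h *\<^sub>R mat 1"
proof -
  obtain a :: 'm where a: "UNIV = {a}" using assms by (metis card_1_singletonE)
  then have all: "i = a" for i :: 'm by auto
  have "h = diagm (\<lambda>i. h $ i $ i)" by (simp add: vec_eq_iff diagm_def) (metis all)
  then have "det h = (\<Prod>i\<in>UNIV. h $ i $ i)" using det_diagm[of "\<lambda>i. h $ i $ i"] by simp
  then have "det h = h $ a $ a" unfolding a by simp
  then show ?thesis by (simp add: vec_eq_iff mat_def) (metis all)
qed

lemma poly_act_card_1:
  fixes h :: "'m::finite rmat"
  assumes "CARD('m) = 1" and h: "h \<in> SLpm" and p: "p \<in> Pol k"
  shows "poly_act h p = (\<lambda>y. of_real (det h) ^ k * p y)"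
proof -
  obtain c where c: "det h = c" "h = c *\<^sub>R mat 1" using card_1_matrix[OF assms(1)] by blast
  have "h ** h = (c * c) *\<^sub>R mat 1"
    unfolding c(2) by (simp add: scalar_matrix_assoc[symmetric] matrix_scalar_ac)
  also have "c * c = 1" using h c(1) by (auto simp: SLpm_def)
  finally have "matrix_inv h = h" by (intro matrix_inv_unique) simp
  then have "poly_act h p y = p (of_real c *s (cmat (mat 1) *v y))" for y
    unfolding poly_act_def by (simp only: c(2) cmat_scaleR)
  then show ?thesis by (simp add: cmat_id Pol_homogeneous[OF p] ext c(1))
qed

lemma poly_iso_dmono_nonzero:
  fixes T :: "('m::{finite,linorder} cspace \<Rightarrow> complex) \<Rightarrow> complex^'d"
  assumes T: "poly_iso S k \<rho> T" and \<kappa>: "\<kappa> \<in> Xi k"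
  shows "T (dmono \<kappa>) \<noteq> 0"
proof
  have T': "pol_linear k T" "inj_on T (Pol k)" using T by (auto simp: poly_iso_alt bij_betw_def)
  assume "T (dmono \<kappa>) = 0"
  then have "T (dmono \<kappa>) = T (\<lambda>y. 0)" by (simp add: pol_linear_zero[OF T'(1)])
  then have "dmono \<kappa> = (\<lambda>y. 0)" by (rule inj_onD[OF T'(2) _ dmono_in_Pol[OF \<kappa>] Pol_zero])
  then show False using mpart_dmono_zero[of \<kappa> \<kappa>] by simp
qed

text \<open>If $n - 1 \ge 2$, the normalization provides an isomorphism with the natural action of $SL^\pm(n-1)$, and
  \<open>T\<close> is proportional to it by Schur's lemma. If $n - 1 = 1$, then $SL(1)$ is trivial and the normalization for
  $\mathrm{Pol}^0$ makes the representation trivial on $SL^\pm(1)$; the natural action of $-1$ on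
  $\mathrm{Pol}^k$ cancels against $(\det h)^k$.\<close>

lemma poly_iso_levi_equivariant:
  fixes \<rho> :: "'m::{finite,linorder} rmat \<Rightarrow> complex^'d^'d"
  assumes \<rho>: "representation_on SLpm \<rho>" and norm: "normalized_extension \<rho>"
    and T: "poly_iso SL k \<rho> T" and \<alpha>: "\<alpha> \<in> {1, -1}"
  shows "levi_equivariant \<alpha> (target_sign TYPE('m) \<alpha> k) k \<rho> T"
proof -
  have T': "pol_linear k T" "pol_equivariant SL k \<rho> T" "inj_on T (Pol k)" "T ` Pol k = UNIV"
    using T by (auto simp: poly_iso_alt bij_betw_def)
  show ?thesis
  proof (cases "CARD('m) = 1")
    case False
    then have "CARD('m) \<ge> 2" using zero_less_card_finite[where 'a = 'm] by linarith
    then obtain S where S: "poly_iso SLpm k \<rho> S" using norm T unfolding normalized_extension_def by blast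
    then have S': "pol_linear k S" "pol_equivariant SLpm k \<rho> S" by (auto simp: poly_iso_alt)
    have "poly_iso SL k \<rho> S" using S SL_SLpm unfolding poly_iso_def by blast
    then obtain c where c: "\<forall>p\<in>Pol k. T p = c *s S p" using equivariant_unique T'(1,2) by blast
    have eq: "T (poly_act h p) = \<rho> h *v T p" if "h \<in> SLpm" "p \<in> Pol k" for h p
      using c that poly_act_in_Pol[OF that(2)] pol_equivariantD[OF S'(2) that] by (simp add: vec.scale)
    have "sign_char \<alpha> h * of_real (det h) ^ k = sign_char (target_sign TYPE('m) \<alpha> k) h" if "h \<in> SLpm" for h :: "'m rmat"
      using that \<alpha> False by (cases "even k") (auto simp: target_sign_def sign_char_def SLpm_def)
    then show ?thesis by (simp add: levi_equivariant_def eq)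
  next
    case True
    obtain \<kappa>0 where \<kappa>0: "\<kappa>0 \<in> (Xi k :: ('m \<Rightarrow> nat) set)" using Xi_nonempty by blast
    obtain a :: 'm where a: "UNIV = {a}" using True by (metis card_1_singletonE)
    have uniq: "\<kappa> = \<kappa>'" if "\<kappa> \<in> Xi j" "\<kappa>' \<in> Xi j" for \<kappa> \<kappa>' :: "'m \<Rightarrow> nat" and j
    proof
      fix i
      have "i = a" using a by auto
      moreover have "sum \<mu> UNIV = \<mu> a" for \<mu> :: "'m \<Rightarrow> nat" unfolding a by simp
      ultimately show "\<kappa> i = \<kappa>' i" using that by (simp add: Xi_def)
    qed
    then have Xi: "Xi k = {\<kappa>0}" using \<kappa>0 by blast
    define w where "w = T (dmono \<kappa>0)"
    have w0: "w \<noteq> 0"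
      unfolding w_def by (rule poly_iso_dmono_nonzero[OF T \<kappa>0])
    have span: "\<exists>c. v = c *s w" for v
    proof -
      obtain p where p: "p \<in> Pol k" "v = T p" using T'(4) by (metis UNIV_I imageE)
      obtain c where "p = (\<lambda>y. \<Sum>\<kappa>\<in>Xi k. c \<kappa> * dmono \<kappa> y)" using p(1) unfolding Pol_iff_dmono by (rule exE)
      then have "p = (\<lambda>y. c \<kappa>0 * dmono \<kappa>0 y)" by (simp add: Xi)
      then show ?thesis using p(2) pol_linear_cmult[OF T'(1) dmono_in_Pol[OF \<kappa>0]] w_def by blast
    qed
    have SL1: "g = mat 1" if "g \<in> SL" for g :: "'m rmat"
      using card_1_matrix[OF True, of g] that by (simp add: SL_def)
    define S :: "('m cspace \<Rightarrow> complex) \<Rightarrow> complex^'d" where "S = (\<lambda>p. p 0 *s w)"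
    have "poly_iso SL 0 \<rho> S"
      unfolding poly_iso_alt
    proof (intro conjI)
      have "inj_on S (Pol 0)"
        using w0 by (auto simp: inj_on_def S_def Pol_0 vec_eq_iff)
      moreover have "v \<in> S ` Pol 0" for v
      proof -
        obtain c where "v = c *s w" using span by blast
        then show ?thesis by (intro image_eqI[of _ _ "\<lambda>y. c"]) (auto simp: S_def Pol_0)
      qed
      ultimately show "bij_betw S (Pol 0) UNIV" by (auto simp: bij_betw_def)
      show "pol_linear 0 S" by (simp add: pol_linear_def S_def vector_sadd_rdistrib vector_smult_assoc)
      have "\<rho> (mat 1) = mat 1" using \<rho> by (simp add: representation_on_def)
      then show "pol_equivariant SL 0 \<rho> S"
        unfolding pol_equivariant_def using SL1 by (auto simp: S_def Pol_0 poly_act_def)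
    qed
    then obtain R where R: "poly_iso SLpm 0 \<rho> R" using norm unfolding normalized_extension_def by blast
    have id: "\<rho> h *v v = v" if h: "h \<in> SLpm" for h v
    proof -
      have "R ` Pol 0 = UNIV" using R by (simp add: poly_iso_alt bij_betw_def)
      then obtain p where p: "p \<in> Pol 0" "v = R p" by (metis UNIV_I imageE)
      have "poly_act h p = p" using p(1) by (auto simp: Pol_0 poly_act_def)
      moreover have "R (poly_act h p) = \<rho> h *v R p" using R p(1) h by (simp add: poly_iso_def)
      ultimately show ?thesis using p(2) by simp
    qed
    have "(sign_char \<alpha> h * of_real (det h) ^ k) *s T (poly_act h p) = sign_char \<alpha> h *s (\<rho> h *v T p)"
      if h: "h \<in> SLpm" and p: "p \<in> Pol k" for h p
    proof -
      have "complex_of_real (det h) ^ k * of_real (det h) ^ k = 1"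
        using h by (auto simp: SLpm_def power_mult_distrib[symmetric])
      then show ?thesis
        unfolding id[OF h] poly_act_card_1[OF True h p] pol_linear_cmult[OF T'(1) p]
        by (simp add: vector_smult_assoc mult.assoc)
    qed
    then show ?thesis by (simp add: levi_equivariant_def target_sign_def True)
  qed
qed

text \<open>With the wrong sign, equivariance under a reflection contradicts the previous lemma.\<close>

lemma levi_equivariant_sign:
  fixes \<rho> :: "'m::{finite,linorder} rmat \<Rightarrow> complex^'d^'d"
  assumes \<rho>: "representation_on SLpm \<rho>" and norm: "normalized_extension \<rho>"
    and T: "poly_iso SL k \<rho> T" and \<alpha>: "\<alpha> \<in> {1, -1}" and \<beta>: "\<beta> \<in> {1, -1}"
    and eq: "levi_equivariant \<alpha> \<beta> k \<rho> T"
  shows "\<beta> = target_sign TYPE('m) \<alpha> k"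
proof (rule ccontr)
  assume neq: "\<beta> \<noteq> target_sign TYPE('m) \<alpha> k"
  obtain a :: 'm where True by simp
  define h where "h = stretch a (-1)"
  have deth: "det h = -1" by (simp add: h_def det_stretch)
  then have h: "h \<in> SLpm" by (simp add: SLpm_def)
  obtain \<kappa>0 where \<kappa>0: "\<kappa>0 \<in> (Xi k :: ('m \<Rightarrow> nat) set)" using Xi_nonempty by blast
  define p where "p = poly_act (matrix_inv h) (dmono \<kappa>0)"
  have p: "p \<in> Pol k" unfolding p_def by (rule poly_act_in_Pol[OF dmono_in_Pol[OF \<kappa>0]])
  have inv: "invertible h" using deth by (simp add: invertible_det_nz)
  then have "matrix_inv (matrix_inv h) = h" by (intro matrix_inv_unique) (simp add: matrix_inv_works)
  then have "poly_act h p = dmono \<kappa>0"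
    using matrix_inv_works[OF inv]
    by (simp add: p_def poly_act_def matrix_vector_mul_assoc cmat_mult[symmetric] cmat_id)
  moreover have "T (dmono \<kappa>0) \<noteq> 0"
    by (rule poly_iso_dmono_nonzero[OF T \<kappa>0])
  ultimately have nz: "T (poly_act h p) \<noteq> 0" by simp
  let ?X = "\<rho> h *v T p" and ?\<beta> = "target_sign TYPE('m) \<alpha> k"
  let ?L = "(sign_char \<alpha> h * of_real (det h) ^ k) *s T (poly_act h p)"
  have "?L = sign_char \<beta> h *s ?X" using eq h p unfolding levi_equivariant_def by blast
  moreover have "?L = sign_char ?\<beta> h *s ?X"
    using poly_iso_levi_equivariant[OF \<rho> norm T \<alpha>] h p unfolding levi_equivariant_def by blast
  moreover have "sign_char ?\<beta> h = - sign_char \<beta> h"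
    using neq \<alpha> \<beta> deth by (cases "even k") (auto simp: sign_char_def target_sign_def split: if_splits)
  ultimately have "?L = - ?L" by (simp add: vec_eq_iff)
  then have "?L = 0" by (simp add: vec_eq_iff)
  moreover have "sign_char \<alpha> h * of_real (det h) ^ k \<noteq> 0" using deth by (simp add: sign_char_def)
  ultimately show False using nz deth by (auto simp: vec_eq_iff)
qed

section \<open>Differential operators on the cell\<close>

lemma multi_partial_1:
  fixes \<phi> :: "'m::{finite,linorder} rspace \<Rightarrow> complex^1"
  assumes "\<phi> \<in> Cinf"
  shows "multi_partial \<kappa> \<phi> x $ 1 = mpart \<kappa> (\<lambda>x. \<phi> x $ 1) x"
  using mpart_linear_compose[OF bounded_linear_vec_nth, of \<phi> \<kappa> 1] assms
  by (simp add: multi_partial_eq_mpart Cinf_iff)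

lemma matrix_vector_1: "a *v (v :: complex^1) = v $ 1 *s (column 1 a :: complex^'d)"
  by (simp add: vec_eq_iff matrix_vector_mult_def column_def UNIV_1 mult.commute)

lemma diff_ops_jet:
  fixes E :: "('m::{finite,linorder} rspace \<Rightarrow> complex^1) \<Rightarrow> 'm rspace \<Rightarrow> complex^'d"
  assumes "E \<in> diff_ops"
  shows "\<exists>N w. \<forall>\<phi>\<in>Cinf. \<forall>x. E \<phi> x = (\<Sum>\<kappa> | sum \<kappa> UNIV \<le> N. mpart \<kappa> (\<lambda>x. \<phi> x $ 1) x *s w \<kappa> x)"
proof -
  obtain N a where a: "\<forall>\<phi>\<in>Cinf. \<forall>x. E \<phi> x = (\<Sum>\<kappa> | sum \<kappa> UNIV \<le> N. a \<kappa> x *v multi_partial \<kappa> \<phi> x)"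
    using assms unfolding diff_ops_def by blast
  show ?thesis
    by (rule exI[of _ N], rule exI[of _ "\<lambda>\<kappa> x. column 1 (a \<kappa> x)"])
      (simp add: a matrix_vector_1 multi_partial_1)
qed

lemma cell_in_Cinf: "f \<in> induced triv lam \<alpha> \<Longrightarrow> g \<in> SL \<Longrightarrow> (\<lambda>y. f (g ** nminus y)) \<in> Cinf"
  unfolding Cinf_iff by (intro smooth_on_SL_cell inducedD(2))

lemma matrix_inv_nminus: "matrix_inv (nminus x) = nminus (- x)"
  by (rule matrix_inv_unique) (simp add: nminus_add)

text \<open>Sections have arbitrary jets at every point of the cell, so an operator on the cell is
  determined by its values on sections.\<close>

lemma diff_ops_eqI:
  fixes E1 E2 :: "('m::{finite,linorder} rspace \<Rightarrow> complex^1) \<Rightarrow> 'm rspace \<Rightarrow> complex^'d"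
  assumes E: "E1 \<in> diff_ops" "E2 \<in> diff_ops" and \<alpha>: "\<alpha> \<in> {1, -1}"
    and eq: "\<And>f x. f \<in> induced triv lam \<alpha> \<Longrightarrow> E1 (\<lambda>y. f (nminus y)) x = E2 (\<lambda>y. f (nminus y)) x"
  shows "E1 = E2"
proof
  fix \<phi> :: "'m rspace \<Rightarrow> complex^1"
  show "E1 \<phi> = E2 \<phi>"
  proof (cases "\<phi> \<in> Cinf")
    case False
    then show ?thesis using E by (simp add: diff_ops_def extensional_def)
  next
    case True
    obtain N1 w1 where 1: "\<forall>\<phi>\<in>Cinf. \<forall>x. E1 \<phi> x = (\<Sum>\<kappa> | sum \<kappa> UNIV \<le> N1. mpart \<kappa> (\<lambda>x. \<phi> x $ 1) x *s w1 \<kappa> x)"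
      using diff_ops_jet[OF E(1)] by blast
    obtain N2 w2 where 2: "\<forall>\<phi>\<in>Cinf. \<forall>x. E2 \<phi> x = (\<Sum>\<kappa> | sum \<kappa> UNIV \<le> N2. mpart \<kappa> (\<lambda>x. \<phi> x $ 1) x *s w2 \<kappa> x)"
      using diff_ops_jet[OF E(2)] by blast
    show ?thesis
    proof
      fix x0
      obtain f0 where f0: "f0 \<in> induced triv lam \<alpha>"
        "\<forall>\<kappa>. sum \<kappa> UNIV \<le> max N1 N2 \<longrightarrow> mpart \<kappa> (cell f0 (mat 1)) 0 = mpart \<kappa> (\<lambda>x. \<phi> x $ 1) x0"
        using exists_section_with_jet[OF \<alpha>, of lam "max N1 N2" "\<lambda>\<kappa>. mpart \<kappa> (\<lambda>x. \<phi> x $ 1) x0"] by blast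
      define f where "f = left_translate (nminus x0) f0"
      have f: "f \<in> induced triv lam \<alpha>" unfolding f_def by (intro left_translate_induced f0) simp
      have "(\<lambda>y. f (nminus y) $ 1) = (\<lambda>y. cell f0 (mat 1) (- x0 + y))"
      proof -
        have "(\<lambda>y. f (nminus y) $ 1) = cell f (mat 1)" by (simp add: cell_def fun_eq_iff)
        also have "\<dots> = cell f0 (nminus (- x0))" by (simp add: f_def cell_left_translate matrix_inv_nminus)
        also have "\<dots> = (\<lambda>y. cell f0 (mat 1) (- x0 + y))" using cell_nminus[of f0 "mat 1" "- x0"] by (simp add: fun_eq_iff)
        finally show ?thesis .
      qed
      then have jet: "mpart \<kappa> (\<lambda>y. f (nminus y) $ 1) x0 = mpart \<kappa> (\<lambda>x. \<phi> x $ 1) x0" if "sum \<kappa> UNIV \<le> max N1 N2" for \<kappa>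
        using f0(2) that mpart_translate[OF smooth_cell[OF f0(1) mat_1_SL], of \<kappa> "- x0"] by simp
      have C: "(\<lambda>y. f (nminus y)) \<in> Cinf" using cell_in_Cinf[OF f, of "mat 1"] by simp
      have "E1 \<phi> x0 = E1 (\<lambda>y. f (nminus y)) x0"
        unfolding bspec[OF 1 True, rule_format] bspec[OF 1 C, rule_format]
        by (intro sum.cong refl) (simp add: jet)
      also have "\<dots> = E2 (\<lambda>y. f (nminus y)) x0" by (rule eq[OF f])
      also have "\<dots> = E2 \<phi> x0"
        unfolding bspec[OF 2 True, rule_format] bspec[OF 2 C, rule_format]
        by (intro sum.cong refl) (simp add: jet)
      finally show "E1 \<phi> x0 = E2 \<phi> x0" .
    qed
  qed
qed

lemma on_cell_eqI:
  fixes E :: "('m::{finite,linorder} rspace \<Rightarrow> complex^1) \<Rightarrow> 'm rspace \<Rightarrow> complex^'d"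
  assumes \<alpha>: "\<alpha> \<in> {1, -1}" and E: "E \<in> diff_ops"
    and eq: "\<And>f x. f \<in> induced triv lam \<alpha> \<Longrightarrow> D f (nminus x) = E (\<lambda>y. f (nminus y)) x"
  shows "on_cell (induced triv lam \<alpha>) D = E"
  unfolding on_cell_def
proof (rule the_equality)
  fix E' assume "E' \<in> diff_ops \<and> (\<forall>f\<in>induced triv lam \<alpha>. \<forall>x. D f (nminus x) = E' (\<lambda>y. f (nminus y)) x)"
  then show "E' = E" using eq by (intro diff_ops_eqI[OF _ E \<alpha>]) auto
qed (use E eq in auto)

lemma Dk_eq_sum:
  assumes "\<phi> \<in> Cinf"
  shows "Dk k l \<phi> x = (\<Sum>\<kappa>\<in>Xi k. mpart \<kappa> (\<lambda>x. \<phi> x $ 1) x *s l (dmono \<kappa>))"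
  by (simp add: Dk_def multi_partial_1[OF assms] dmono_def[abs_def])

lemma pol_linear_taylor:
  assumes "pol_linear k l"
  shows "l (taylor k \<phi> x) = (\<Sum>\<kappa>\<in>Xi k. mpart \<kappa> \<phi> x *s l (dmono \<kappa>))"
  unfolding taylor_def by (rule pol_linear_sum[OF assms dmono_in_Pol]) auto

lemma Dk_eq_taylor: "pol_linear k l \<Longrightarrow> \<phi> \<in> Cinf \<Longrightarrow> Dk k l \<phi> x = l (taylor k (\<lambda>x. \<phi> x $ 1) x)"
  by (simp add: Dk_eq_sum pol_linear_taylor)

lemma Dk_in_diff_ops:
  fixes l :: "('m::{finite,linorder} cspace \<Rightarrow> complex) \<Rightarrow> complex^'d"
  shows "restrict (Dk k l) Cinf \<in> diff_ops"
proof -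
  define a where "a = (\<lambda>\<kappa>. \<lambda>x :: 'm rspace. (\<chi> i j. if \<kappa> \<in> Xi k then l (dmono \<kappa>) $ i else 0) :: complex^1^'d)"
  have "smooth_on UNIV (a \<kappa>)" for \<kappa> unfolding a_def smooth_on_UNIV_iff by (rule smooth_open_const) simp
  moreover have "Dk k l \<phi> x = (\<Sum>\<kappa> | sum \<kappa> UNIV \<le> k. a \<kappa> x *v multi_partial \<kappa> \<phi> x)" if "\<phi> \<in> Cinf" for \<phi> x
  proof -
    have "(\<Sum>\<kappa> | sum \<kappa> UNIV \<le> k. a \<kappa> x *v multi_partial \<kappa> \<phi> x) = (\<Sum>\<kappa>\<in>Xi k. a \<kappa> x *v multi_partial \<kappa> \<phi> x)"
      by (rule sum.mono_neutral_right[OF finite_multiindex_le])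
        (auto simp: Xi_def a_def matrix_vector_mult_def vec_eq_iff)
    also have "\<dots> = Dk k l \<phi> x"
      unfolding Dk_eq_sum[OF that] by (intro sum.cong refl)
        (simp add: matrix_vector_1 multi_partial_1[OF that], simp add: a_def column_def vec_eq_iff)
    finally show ?thesis by simp
  qed
  ultimately show ?thesis
    unfolding diff_ops_def mem_Collect_eq by (intro conjI exI[of _ k] exI[of _ a]) auto
qed

section \<open>Construction of the intertwining operators\<close>

text \<open>On functions over the cell this is the constant coefficient operator \<open>Dk k l\<close> (see \<open>symbol_op_eq_Dk\<close>), with \<open>l\<close> in
  the role of its symbol; in this form it makes sense at every point of the group.\<close>

definition symbol_op ::
    "complex \<Rightarrow> int \<Rightarrow> nat \<Rightarrow> (('m::{finite,linorder} cspace \<Rightarrow> complex) \<Rightarrow> complex^'d)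
      \<Rightarrow> ('m gmat \<Rightarrow> complex^1)
      \<Rightarrow> 'm gmat \<Rightarrow> complex^'d" where
  "symbol_op lam \<alpha> k l = restrict (\<lambda>f. restrict (\<lambda>g. l (taylor k (cell f g) 0)) SL) (induced triv lam \<alpha>)"

lemma smooth_on_add:
  assumes "smooth_on S f" "smooth_on S g"
  shows "smooth_on S (\<lambda>x. f x + g x)"
  unfolding smooth_on_iff_local
proof
  fix x assume x: "x \<in> S"
  obtain U F where U: "x \<in> U" "smooth_open U F" "\<forall>y\<in>U \<inter> S. F y = f y"
    using assms(1) x unfolding smooth_on_iff_local by meson
  obtain V G where V: "x \<in> V" "smooth_open V G" "\<forall>y\<in>V \<inter> S. G y = g y"
    using assms(2) x unfolding smooth_on_iff_local by meson
  have o: "open (U \<inter> V)" using U V smooth_open_open by blast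
  have "smooth_open (U \<inter> V) (\<lambda>y. F y + G y)"
    by (intro smooth_open_add smooth_open_subset[OF U(2) _ o] smooth_open_subset[OF V(2) _ o]) auto
  then show "\<exists>U H. x \<in> U \<and> smooth_open U H \<and> (\<forall>y\<in>U \<inter> S. H y = f y + g y)"
    using U V by (intro exI[of _ "U \<inter> V"] exI[of _ "\<lambda>y. F y + G y"]) auto
qed

lemma smooth_on_sum:
  assumes "finite I" "\<And>i. i \<in> I \<Longrightarrow> smooth_on S (f i)"
  shows "smooth_on S (\<lambda>x. \<Sum>i\<in>I. f i x)"
  using assms
proof (induction I rule: finite_induct)
  case empty
  show ?case
    unfolding smooth_on_iff_local
    by (intro ballI exI[of _ UNIV] exI[of _ "\<lambda>_. 0"]) (simp add: smooth_open_const)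
qed (simp add: smooth_on_add)

lemma taylor_cell_aexp:
  fixes f :: "'m::{finite,linorder} gmat \<Rightarrow> complex^1"
  assumes f: "f \<in> induced triv lam \<alpha>" and g: "g \<in> SL" and nu: "nu = lam + of_nat k * (1 + 1 / of_nat CARD('m))"
  shows "taylor k (cell f (g ** aexp t)) 0 = (\<lambda>y. exp (- nu * of_real t) * taylor k (cell f g) 0 y)"
  unfolding taylor_def mpart_cell_aexp[OF f g] sum_distrib_left
  by (intro ext sum.cong refl) (simp add: Xi_def nu mult.assoc)

lemma symbol_op_apply:
  "f \<in> induced triv lam \<alpha> \<Longrightarrow> g \<in> SL \<Longrightarrow> symbol_op lam \<alpha> k l f g = l (taylor k (cell f g) 0)"
  by (simp add: symbol_op_def)

lemma eq_symbol_opI: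
  assumes D: "D \<in> induced triv lam \<alpha> \<rightarrow>\<^sub>E induced \<rho> nu \<beta>"
    and eq: "\<And>f g. f \<in> induced triv lam \<alpha> \<Longrightarrow> g \<in> SL \<Longrightarrow> D f g = l (taylor k (cell f g) 0)"
  shows "D = symbol_op lam \<alpha> k l"
proof (intro ext)
  fix f g
  show "D f g = symbol_op lam \<alpha> k l f g"
  proof (cases "f \<in> induced triv lam \<alpha>")
    case f: True
    have "D f \<in> extensional SL" by (rule inducedD(1)[OF PiE_mem[OF D f]])
    then show ?thesis using f eq[OF f, of g]
      by (cases "g \<in> SL") (simp_all add: symbol_op_def extensional_def)
  next
    case False
    then show ?thesis using D by (simp add: symbol_op_def PiE_def extensional_def)
  qed
qed

lemma symbol_op_eq_Dk:
  fixes l :: "('m::{finite,linorder} cspace \<Rightarrow> complex) \<Rightarrow> complex^'d"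
  assumes l: "pol_linear k l" and f: "f \<in> induced triv lam \<alpha>" and g: "g \<in> SL"
  shows "symbol_op lam \<alpha> k l f (g ** nminus x) = restrict (Dk k l) Cinf (\<lambda>y. f (g ** nminus y)) x"
proof -
  have "cell f (g ** nminus x) = (\<lambda>y. cell f g (x + y))" by (simp add: fun_eq_iff cell_nminus)
  then have "taylor k (cell f (g ** nminus x)) 0 = taylor k (cell f g) x"
    by (simp add: taylor_def mpart_translate[OF smooth_cell[OF f g]])
  moreover have "(\<lambda>y. f (g ** nminus y) $ 1) = cell f g" by (simp add: cell_def fun_eq_iff)
  ultimately show ?thesis using cell_in_Cinf[OF f g] f g by (simp add: symbol_op_apply Dk_eq_taylor[OF l])
qed

lemma on_cell_symbol_op:
  fixes l :: "('m::{finite,linorder} cspace \<Rightarrow> complex) \<Rightarrow> complex^'d"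
  assumes l: "pol_linear k l" and \<alpha>: "\<alpha> \<in> {1, -1}"
  shows "on_cell (induced triv lam \<alpha>) (symbol_op lam \<alpha> k l) = restrict (Dk k l) Cinf"
  using symbol_op_eq_Dk[OF l _ mat_1_SL] by (intro on_cell_eqI[OF \<alpha> Dk_in_diff_ops]) simp

text \<open>Left translations commute with the construction. The three conditions are those for the transformation
  law under $M$, $N_+$ and $A$; on each cell the operator has constant coefficients because $N_-$ acts by
  translations.\<close>

lemma symbol_op_in_Diff_G:
  fixes \<rho> :: "'m::{finite,linorder} rmat \<Rightarrow> complex^'d^'d"
  assumes \<rho>: "representation_on SLpm \<rho>" and l: "pol_linear k l"
    and cond: "(\<forall>p\<in>Pol k. l p = 0) \<or> (levi_equivariant \<alpha> \<beta> k \<rho> l \<and> (k = 0 \<or> lam = 1 - of_nat k) \<and>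
      nu = lam + of_nat k * (1 + 1 / of_nat CARD('m)))"
  shows "symbol_op lam \<alpha> k l \<in> Diff_G (induced triv lam \<alpha>) (induced \<rho> nu \<beta>)"
proof -
  let ?I = "induced triv lam \<alpha>" and ?D = "symbol_op lam \<alpha> k l"
  have D_in: "?D f \<in> induced \<rho> nu \<beta>" if f: "f \<in> ?I" for f
  proof -
    have "smooth_on SL (\<lambda>g. l (taylor k (cell f g) 0))"
    proof -
      have b: "bounded_linear (\<lambda>c. c *s w)" for w :: "complex^'d"
        by (intro linear_conv_bounded_linear[THEN iffD1] linearI) (simp_all add: vec_eq_iff distrib_right)
      show ?thesis
        unfolding pol_linear_taylor[OF l] by (intro smooth_on_sum smooth_on_SL_linear[OF _ b] smooth_on_SL_mpart_cell[OF f]) simp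
    qed
    then have "smooth_on SL (?D f)" unfolding smooth_on_iff_local by (simp add: symbol_op_apply[OF f])
    moreover have "?D f (g ** (levi h ** aexp t ** nplus x)) =
        matrix_inv (mat (sign_char \<beta> h * exp (nu * of_real t)) ** \<rho> h) *v ?D f g"
      if g: "g \<in> SL" and h: "h \<in> SLpm" for g h t x
      using cond
    proof
      assume z: "\<forall>p\<in>Pol k. l p = 0"
      have "l (taylor k \<phi> 0) = 0" for \<phi> using z taylor_in_Pol by blast
      then show ?thesis using g h f by (simp add: symbol_op_apply)
    next
      assume c: "levi_equivariant \<alpha> \<beta> k \<rho> l \<and> (k = 0 \<or> lam = 1 - of_nat k) \<and>
          nu = lam + of_nat k * (1 + 1 / of_nat CARD('m))"
      let ?h = "matrix_inv h" let ?p = "taylor k (cell f g) 0"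
      note hi = SLpm_inv[OF h]
      have "taylor k (cell f (g ** levi h ** aexp t ** nplus x)) 0 = taylor k (cell f (g ** levi h ** aexp t)) 0"
        using c g h by (intro taylor_cell_nplus_critical[OF f]) auto
      also have "\<dots> = (\<lambda>y. exp (- nu * of_real t) * taylor k (cell f (g ** levi h)) 0 y)"
        using c g h by (intro taylor_cell_aexp[OF f]) auto
      also have "\<dots> = (\<lambda>y. (exp (- nu * of_real t) * (sign_char \<alpha> h * of_real (det h) ^ k)) * poly_act ?h ?p y)"
        unfolding taylor_cell_levi[OF f g h] by (simp add: poly_act_def hi mult.assoc)
      finally have "l (taylor k (cell f (g ** levi h ** aexp t ** nplus x)) 0) =
          exp (- nu * of_real t) *s ((sign_char \<alpha> h * of_real (det h) ^ k) *s l (poly_act ?h ?p))"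
        by (simp add: pol_linear_cmult[OF l poly_act_in_Pol[OF taylor_in_Pol]] vector_smult_assoc)
      also have "(sign_char \<alpha> h * of_real (det h) ^ k) *s l (poly_act ?h ?p) = sign_char \<beta> h *s (\<rho> ?h *v l ?p)"
        using c hi taylor_in_Pol[of k "cell f g" 0] unfolding levi_equivariant_def by metis
      finally show ?thesis
        using g h f by (simp add: symbol_op_apply matrix_mul_assoc inducing_inverse[OF \<rho> h] vector_smult_assoc mult.commute)
    qed
    ultimately show ?thesis using f by (simp add: induced_def symbol_op_def)
  qed
  have "?D \<in> ?I \<rightarrow>\<^sub>E induced \<rho> nu \<beta>" using D_in by (auto simp: PiE_def symbol_op_def)
  moreover have "\<forall>g\<in>SL. \<exists>E\<in>diff_ops. \<forall>f\<in>?I. \<forall>x. ?D f (g ** nminus x) = E (\<lambda>y. f (g ** nminus y)) x"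
    using symbol_op_eq_Dk[OF l] Dk_in_diff_ops by blast
  moreover have "?D (left_translate a f) = left_translate a (?D f)" if a: "a \<in> SL" and f: "f \<in> ?I" for a f
  proof
    fix x
    show "?D (left_translate a f) x = left_translate a (?D f) x"
      using a f left_translate_induced[OF f a]
      by (cases "x \<in> SL") (simp_all add: symbol_op_apply left_translate_apply cell_left_translate,
          simp add: symbol_op_def left_translate_def)
  qed
  ultimately show ?thesis by (simp add: Diff_G_def bundle_diff_op_def)
qed

section \<open>Every intertwining operator arises in this way\<close>

lemma exp_linear_unique:
  assumes "\<And>t::real. exp (- a * of_real t) = exp (- b * complex_of_real t)"
  shows "a = b"
proof -
  have d: "((\<lambda>t. exp (- c * of_real t)) has_vector_derivative - c) (at 0)" for c :: complex
  proof -
    have "((\<lambda>z. exp (- c * z)) has_field_derivative - c) (at (of_real 0))"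
      by (auto intro!: derivative_eq_intros)
    from has_vector_derivative_real_field[OF this] show ?thesis .
  qed
  have "- a = - b" using vector_derivative_unique_at[OF d[of a]] d[of b] assms by simp
  then show ?thesis by simp
qed

lemma order_unique:
  assumes "(lam::complex) + of_nat k * (1 + 1 / of_nat CARD('m::finite)) = lam + of_nat k' * (1 + 1 / of_nat CARD('m))"
  shows "k = k'"
proof -
  have "(1 + 1 / of_nat CARD('m) :: complex) = of_real (1 + 1 / real CARD('m))" by simp
  moreover have "1 + 1 / real CARD('m) > 0" by (simp add: add_pos_nonneg)
  ultimately have "(1 + 1 / of_nat CARD('m) :: complex) \<noteq> 0" by (metis less_irrefl of_real_eq_0_iff)
  then show ?thesis using assms by simp
qed

text \<open>The converse of the construction: the value at \<open>mat 1\<close> is a combination of partial derivatives there, left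
  translations carry it to every point, and testing the transformation law on sections with suitable
  jets yields the conditions.\<close>

lemma Diff_G_eq_symbol_op:
  fixes \<rho> :: "'m::{finite,linorder} rmat \<Rightarrow> complex^'d^'d"
  assumes \<rho>: "representation_on SLpm \<rho>" and \<alpha>: "\<alpha> \<in> {1, -1}"
    and D: "D \<in> Diff_G (induced triv lam \<alpha>) (induced \<rho> nu \<beta>)"
  shows "\<exists>k l. pol_linear k l \<and> D = symbol_op lam \<alpha> k l \<and> ((\<forall>p. l p = 0) \<or>
    (\<exists>p\<in>Pol k. l p \<noteq> 0) \<and> levi_equivariant \<alpha> \<beta> k \<rho> l \<and> (k = 0 \<or> lam = 1 - of_nat k) \<and>
      nu = lam + of_nat k * (1 + 1 / of_nat CARD('m)))"
proof -
  let ?I = "induced triv lam \<alpha>"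
  have DI: "D \<in> ?I \<rightarrow>\<^sub>E induced \<rho> nu \<beta>" and
    inter: "\<And>g f. g \<in> SL \<Longrightarrow> f \<in> ?I \<Longrightarrow> D (left_translate g f) = left_translate g (D f)"
    using D by (auto simp: Diff_G_def bundle_diff_op_def)
  obtain E where "E \<in> diff_ops" "\<forall>f\<in>?I. \<forall>x. D f (mat 1 ** nminus x) = E (\<lambda>y. f (mat 1 ** nminus y)) x"
    using D mat_1_SL unfolding Diff_G_def bundle_diff_op_def by blast
  then obtain N w' where "\<forall>\<phi>\<in>Cinf. \<forall>x. E \<phi> x = (\<Sum>\<kappa> | sum \<kappa> UNIV \<le> N. mpart \<kappa> (\<lambda>x. \<phi> x $ 1) x *s w' \<kappa> x)"
    and E: "\<forall>f\<in>?I. \<forall>x. D f (mat 1 ** nminus x) = E (\<lambda>y. f (mat 1 ** nminus y)) x"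
    using diff_ops_jet by blast
  then have at_1: "D f (mat 1) = (\<Sum>\<kappa> | sum \<kappa> UNIV \<le> N. mpart \<kappa> (cell f (mat 1)) 0 *s w' \<kappa> 0)" if "f \<in> ?I" for f
    using that E[rule_format, of f 0] cell_in_Cinf[OF that mat_1_SL] by (simp add: cell_def[abs_def])
  define w where "w = (\<lambda>\<kappa>. w' \<kappa> 0)"
  have at_g: "D f g = (\<Sum>\<kappa> | sum \<kappa> UNIV \<le> N. mpart \<kappa> (cell f g) 0 *s w \<kappa>)" if f: "f \<in> ?I" and g: "g \<in> SL" for f g
  proof -
    have gg: "matrix_inv (matrix_inv g) = g" by (rule matrix_inv_unique[OF matrix_inv_SL(1)[OF g]])
    have "D f g = left_translate (matrix_inv g) (D f) (mat 1)" by (simp add: left_translate_apply gg)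
    also have "\<dots> = D (left_translate (matrix_inv g) f) (mat 1)" using inter f g by simp
    also have "\<dots> = (\<Sum>\<kappa> | sum \<kappa> UNIV \<le> N. mpart \<kappa> (cell (left_translate (matrix_inv g) f) (mat 1)) 0 *s w' \<kappa> 0)"
      by (rule at_1[OF left_translate_induced[OF f]]) (simp add: g)
    finally show ?thesis by (simp add: cell_left_translate gg w_def)
  qed
  have trans: "D f (levi h ** aexp t ** nplus x) = (sign_char \<beta> h * exp (- nu * of_real t)) *s (\<rho> (matrix_inv h) *v D f (mat 1))"
    if "f \<in> ?I" "h \<in> SLpm" for f h t x
  proof -
    have "D f \<in> induced \<rho> nu \<beta>" using DI that by auto
    from inducedD(3)[OF this mat_1_SL that(2), of t x] show ?thesis
      by (simp add: inducing_inverse[OF \<rho> that(2)])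
  qed
  have "matrix_inv (mat 1 :: 'm rmat) = mat 1" by (rule matrix_inv_unique) simp
  then have \<rho>1: "\<rho> (matrix_inv (mat 1)) = mat 1" using \<rho> by (simp add: representation_on_def)
  have pick: "\<exists>f\<in>?I. \<forall>\<kappa>. sum \<kappa> UNIV \<le> M \<longrightarrow> mpart \<kappa> (cell f (mat 1)) 0 = c \<kappa>" for M c
    by (rule exists_section_with_jet[OF \<alpha>])
  \<comment> \<open>The weights of \<open>A\<close> single out one order of differentiation.\<close>
  have order: "nu = lam + of_nat (sum \<kappa> UNIV) * (1 + 1 / of_nat CARD('m))" if \<kappa>: "sum \<kappa> UNIV \<le> N" "w \<kappa> \<noteq> 0" for \<kappa>
  proof -
    obtain f where f: "f \<in> ?I" "\<forall>\<kappa>'. sum \<kappa>' UNIV \<le> N \<longrightarrow> mpart \<kappa>' (cell f (mat 1)) 0 = (if \<kappa>' = \<kappa> then 1 else 0)"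
      using pick[of N "\<lambda>\<kappa>'. if \<kappa>' = \<kappa> then 1 else 0"] by blast
    let ?b = "lam + of_nat (sum \<kappa> UNIV) * (1 + 1 / of_nat CARD('m))"
    have ev: "(\<Sum>\<kappa>' | sum \<kappa>' UNIV \<le> N. (c \<kappa>' * mpart \<kappa>' (cell f (mat 1)) 0) *s w \<kappa>') = c \<kappa> *s w \<kappa>" for c
    proof -
      have "(\<Sum>\<kappa>' | sum \<kappa>' UNIV \<le> N. (c \<kappa>' * mpart \<kappa>' (cell f (mat 1)) 0) *s w \<kappa>') =
          (\<Sum>\<kappa>' | sum \<kappa>' UNIV \<le> N. if \<kappa>' = \<kappa> then c \<kappa>' *s w \<kappa>' else 0)"
        using f(2) by (intro sum.cong) auto
      then show ?thesis using \<kappa>(1) by (simp add: sum.delta[OF finite_multiindex_le])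
    qed
    have "exp (- ?b * of_real t) = exp (- nu * of_real t)" for t :: real
    proof -
      have "D f (aexp t) = exp (- ?b * of_real t) *s w \<kappa>"
        using ev[of "\<lambda>\<kappa>'. exp (- (lam + of_nat (sum \<kappa>' UNIV) * (1 + 1 / of_nat CARD('m))) * of_real t)"]
        by (simp only: at_g[OF f(1) aexp_SL] mpart_cell_aexp[OF f(1) mat_1_SL, unfolded matrix_mul_lid])
      moreover have "D f (aexp t) = exp (- nu * of_real t) *s D f (mat 1)"
        using trans[OF f(1) mat_1_SLpm, of t 0] by (simp add: \<rho>1 sign_char_SL)
      moreover have "D f (mat 1) = w \<kappa>" using ev[of "\<lambda>_. 1"] at_g[OF f(1) mat_1_SL] by simp
      ultimately have "exp (- ?b * of_real t) *s w \<kappa> = exp (- nu * of_real t) *s w \<kappa>" by metis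
      then show ?thesis unfolding vector_mul_rcancel using \<kappa>(2) by blast
    qed
    from exp_linear_unique[OF this] show ?thesis by simp
  qed
  show ?thesis
  proof (cases "\<forall>\<kappa>. sum \<kappa> UNIV \<le> N \<longrightarrow> w \<kappa> = 0")
    case True
    have "D = symbol_op lam \<alpha> 0 (\<lambda>_. 0)"
      by (rule eq_symbol_opI[OF DI]) (simp add: at_g True)
    then show ?thesis by (intro exI[of _ 0] exI[of _ "\<lambda>_. 0"]) (simp add: pol_linear_def)
  next
    case False
    then obtain \<kappa>0 where \<kappa>0: "sum \<kappa>0 UNIV \<le> N" "w \<kappa>0 \<noteq> 0" by blast
    define k where "k = sum \<kappa>0 UNIV"
    have nu: "nu = lam + of_nat k * (1 + 1 / of_nat CARD('m))" using order[OF \<kappa>0] by (simp add: k_def)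
    have wk: "sum \<kappa> UNIV = k" if "sum \<kappa> UNIV \<le> N" "w \<kappa> \<noteq> 0" for \<kappa>
    proof (rule order_unique)
      show "lam + of_nat (sum \<kappa> UNIV) * (1 + 1 / of_nat CARD('m)) = lam + of_nat k * (1 + 1 / of_nat CARD('m))"
        using order[OF that] nu by metis
    qed
    define l where "l = (\<lambda>p :: 'm cspace \<Rightarrow> complex. \<Sum>\<kappa>\<in>Xi k. mpart \<kappa> (\<lambda>x. p (cvec x)) 0 *s w \<kappa>)"
    have l: "pol_linear k l"
      unfolding pol_linear_def
    proof (intro conjI ballI allI)
      fix p q :: "'m cspace \<Rightarrow> complex" assume p: "p \<in> Pol k" and q: "q \<in> Pol k"
      show "l (\<lambda>y. p y + q y) = l p + l q"
        unfolding l_def mpart_add[OF smooth_Pol[OF p] smooth_Pol[OF q]] by (simp only: vector_sadd_rdistrib sum.distrib)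
    next
      fix c and p :: "'m cspace \<Rightarrow> complex" assume p: "p \<in> Pol k"
      show "l (\<lambda>y. c * p y) = c *s l p"
        unfolding l_def mpart_cmult[OF smooth_Pol[OF p]] by (simp only: vec.scale_sum_right vector_smult_assoc)
    qed
    have l_dmono: "l (dmono \<kappa>) = w \<kappa>" if "\<kappa> \<in> Xi k" for \<kappa>
    proof -
      have "l (dmono \<kappa>) = (\<Sum>\<kappa>'\<in>Xi k. if \<kappa>' = \<kappa> then w \<kappa>' else 0)"
        unfolding l_def by (intro sum.cong) (auto simp: mpart_dmono_zero)
      then show ?thesis using that by (simp add: sum.delta)
    qed
    have Dl: "D f g = l (taylor k (cell f g) 0)" if "f \<in> ?I" "g \<in> SL" for f g
    proof -
      have "D f g = (\<Sum>\<kappa>\<in>Xi k. mpart \<kappa> (cell f g) 0 *s w \<kappa>)"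
        unfolding at_g[OF that]
      proof (rule sum.mono_neutral_right[OF finite_multiindex_le])
        show "Xi k \<subseteq> {\<kappa>. sum \<kappa> UNIV \<le> N}" using \<kappa>0(1) by (auto simp: Xi_def k_def)
        show "\<forall>\<kappa>\<in>{\<kappa>. sum \<kappa> UNIV \<le> N} - Xi k. mpart \<kappa> (cell f g) 0 *s w \<kappa> = 0"
        proof
          fix \<kappa> :: "'m \<Rightarrow> nat" assume "\<kappa> \<in> {\<kappa>. sum \<kappa> UNIV \<le> N} - Xi k"
          then have "w \<kappa> = 0" using wk[of \<kappa>] unfolding Xi_def by blast
          then show "mpart \<kappa> (cell f g) 0 *s w \<kappa> = 0" by simp
        qed
      qed
      also have "\<dots> = l (taylor k (cell f g) 0)" unfolding pol_linear_taylor[OF l] by (simp add: l_dmono)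
      finally show ?thesis .
    qed
    have D_eq: "D = symbol_op lam \<alpha> k l"
      by (rule eq_symbol_opI[OF DI Dl])
    have \<kappa>0k: "\<kappa>0 \<in> Xi k" by (simp add: k_def Xi_def)
    have nz: "\<exists>p\<in>Pol k. l p \<noteq> 0"
      using l_dmono[OF \<kappa>0k] \<kappa>0(2) dmono_in_Pol[OF \<kappa>0k] by metis
    \<comment> \<open>The transformation law under $M$, tested on sections whose jet is a given polynomial.\<close>
    have levi: "levi_equivariant \<alpha> \<beta> k \<rho> l"
      unfolding levi_equivariant_def
    proof (intro ballI)
      fix h :: "'m rmat" and p :: "'m cspace \<Rightarrow> complex"
      assume h: "h \<in> SLpm" and p: "p \<in> Pol k"
      note hi = SLpm_inv[OF h]
      obtain f where f: "f \<in> ?I" "\<forall>\<kappa>. sum \<kappa> UNIV \<le> k \<longrightarrow> mpart \<kappa> (cell f (mat 1)) 0 = mpart \<kappa> (\<lambda>x. p (cvec x)) 0"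
        using pick[of k "\<lambda>\<kappa>. mpart \<kappa> (\<lambda>x. p (cvec x)) 0"] by blast
      have "taylor k (cell f (mat 1)) 0 = taylor k (\<lambda>x. p (cvec x)) 0"
        unfolding taylor_def by (intro ext sum.cong refl) (simp add: Xi_def f(2))
      then have Jp: "taylor k (cell f (mat 1)) 0 = p" using taylor_Pol[OF p] by simp
      have "taylor k (cell f (levi (matrix_inv h))) 0 = (\<lambda>y. (sign_char \<alpha> h * of_real (det h) ^ k) * poly_act h p y)"
        using taylor_cell_levi[OF f(1) mat_1_SL hi(3), of k] by (simp add: Jp hi poly_act_def)
      then have "D f (levi (matrix_inv h)) = (sign_char \<alpha> h * of_real (det h) ^ k) *s l (poly_act h p)"
        using hi by (simp add: Dl[OF f(1)] pol_linear_cmult[OF l poly_act_in_Pol[OF p]])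
      moreover have "D f (levi (matrix_inv h)) = sign_char \<beta> h *s (\<rho> h *v l p)"
        using trans[OF f(1) hi(3), of 0 0] by (simp add: hi Dl[OF f(1)] Jp)
      ultimately show "(sign_char \<alpha> h * of_real (det h) ^ k) *s l (poly_act h p) = sign_char \<beta> h *s (\<rho> h *v l p)"
        by simp
    qed
    \<comment> \<open>A section whose jet is a monomial of degree \<open>k - 1\<close> is moved by $N_+$ to one whose jet has a nonzero
      part of degree \<open>k\<close>, unless \<open>lam\<close> has the critical value.\<close>
    have lam: "lam = 1 - of_nat k" if kn: "k \<noteq> 0"
    proof (rule ccontr)
      assume neq: "lam \<noteq> 1 - of_nat k"
      obtain k' where k': "k = Suc k'" using kn by (cases k) auto
      have "l (dmono (bump j \<kappa>)) = 0" if \<kappa>: "\<kappa> \<in> Xi k'" for j \<kappa>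
      proof -
        have bk: "bump j \<kappa> \<in> Xi k" using \<kappa> by (simp add: Xi_def sum_bump k')
        obtain f where f: "f \<in> ?I" "\<forall>\<kappa>'. sum \<kappa>' UNIV \<le> k \<longrightarrow> mpart \<kappa>' (cell f (mat 1)) 0 = (if \<kappa>' = \<kappa> then 1 else 0)"
          using pick[of k "\<lambda>\<kappa>'. if \<kappa>' = \<kappa> then 1 else 0"] by blast
        have Ji: "taylor i (cell f (mat 1)) 0 = (\<lambda>y. if i = k' then dmono \<kappa> y else 0)" if "i \<le> k" for i
        proof
          fix y
          have "taylor i (cell f (mat 1)) 0 y = (\<Sum>\<kappa>'\<in>Xi i. if \<kappa>' = \<kappa> then dmono \<kappa>' y else 0)"
            unfolding taylor_def using f(2) that by (intro sum.cong refl) (simp add: Xi_def)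
          also have "\<dots> = (if \<kappa> \<in> Xi i then dmono \<kappa> y else 0)" by (simp add: sum.delta)
          also have "\<kappa> \<in> Xi i \<longleftrightarrow> i = k'" using \<kappa> by (auto simp: Xi_def)
          finally show "taylor i (cell f (mat 1)) 0 y = (if i = k' then dmono \<kappa> y else 0)" .
        qed
        let ?e = "- lam - of_nat k'"
        have "taylor k (cell f (nplus (axis j 1))) 0 = (\<lambda>y. (?e * of_nat (Suc (\<kappa> j))) * dmono (bump j \<kappa>) y)"
        proof (rule Pol_eqI[OF taylor_in_Pol Pol_cmult[OF dmono_in_Pol[OF bk]]])
          fix z :: "'m rspace"
          have "taylor k (cell f (nplus (axis j 1))) 0 (cvec z) = (\<Sum>i\<le>k. taylor i (cell f (mat 1)) 0 (cvec z) *
              of_real (axis j 1 \<bullet> z) ^ (k - i) * ((- lam - of_nat i) gchoose (k - i)))"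
            using taylor_cell_nplus[OF f(1) mat_1_SL, of k "axis j 1" z] by simp
          also have "\<dots> = (\<Sum>i\<le>k. if i = k' then dmono \<kappa> (cvec z) * of_real (z $ j) * ?e else 0)"
            by (intro sum.cong refl) (auto simp: Ji k' inner_axis')
          also have "\<dots> = dmono \<kappa> (cvec z) * of_real (z $ j) * ?e" by (simp add: k' sum.delta)
          also have "\<dots> = (?e * of_nat (Suc (\<kappa> j))) * dmono (bump j \<kappa>) (cvec z)"
            using dmono_bump[of \<kappa> j "cvec z"] by (simp add: mult_ac del: of_nat_Suc)
          finally show "taylor k (cell f (nplus (axis j 1))) 0 (cvec z) =
              (?e * of_nat (Suc (\<kappa> j))) * dmono (bump j \<kappa>) (cvec z)" .
        qed
        then have "D f (nplus (axis j 1)) = (?e * of_nat (Suc (\<kappa> j))) *s l (dmono (bump j \<kappa>))"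
          by (simp only: Dl[OF f(1) nplus_SL] pol_linear_cmult[OF l dmono_in_Pol[OF bk]])
        moreover have "D f (nplus (axis j 1)) = D f (mat 1)"
          using trans[OF f(1) mat_1_SLpm, of 0 "axis j 1"] by (simp add: \<rho>1 sign_char_SL)
        moreover have "D f (mat 1) = 0"
          unfolding Dl[OF f(1) mat_1_SL] Ji[OF order_refl] by (simp add: k' pol_linear_zero[OF l[unfolded k']])
        moreover have "?e \<noteq> 0"
        proof
          assume "?e = 0"
          then have "lam = - of_nat k'" by algebra
          then show False using neq k' by simp
        qed
        ultimately show ?thesis by (simp add: vec_eq_iff del: of_nat_Suc)
      qed
      moreover obtain \<kappa> j where "\<kappa>0 = bump j \<kappa>"
      proof (cases \<kappa>0 rule: multiindex_cases)
        case 1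
        then have "k = 0" by (simp add: k_def)
        then show ?thesis using kn by blast
      qed (use that in blast)
      moreover then have "\<kappa> \<in> Xi k'" using sum_bump[of j \<kappa>] k' by (simp add: Xi_def k_def)
      ultimately show False using l_dmono[OF \<kappa>0k] \<kappa>0(2) by metis
    qed
    show ?thesis
      by (rule exI[of _ k], rule exI[of _ l]) (use l D_eq nz levi lam nu in blast)
  qed
qed

section \<open>Classification\<close>

lemma symbol_op_cong:
  "(\<And>p. p \<in> Pol k \<Longrightarrow> l p = l' p) \<Longrightarrow> symbol_op lam \<alpha> k l = symbol_op lam \<alpha> k l'"
  unfolding symbol_op_def by (intro restrict_ext) (simp add: taylor_in_Pol)

lemma symbol_op_zero:
  assumes "\<And>p. p \<in> Pol k \<Longrightarrow> l p = 0" "\<And>p. p \<in> Pol k' \<Longrightarrow> l' p = 0"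
  shows "symbol_op lam \<alpha> k l = symbol_op lam \<alpha> k' l'"
  unfolding symbol_op_def by (intro restrict_ext) (simp add: taylor_in_Pol assms)

text \<open>In the admissible cases the operators are the symbol operators of the multiples of \<open>T\<close>, and an operator can
  be recovered from its form on the cell.\<close>

lemma Diff_G_line:
  fixes \<rho> :: "'m::{finite,linorder} rmat \<Rightarrow> complex^'d^'d"
  assumes \<alpha>: "\<alpha> \<in> {1, -1}" and \<rho>: "representation_on SLpm \<rho>" and norm: "normalized_extension \<rho>"
    and T: "poly_iso SL k \<rho> T" and \<beta>: "\<beta> = target_sign TYPE('m) \<alpha> k"
    and nu: "nu = lam + of_nat k * (1 + 1 / of_nat CARD('m))" and k: "k = 0 \<or> lam = 1 - of_nat k"
  shows "Diff_G_equals (induced triv lam \<alpha>) (induced \<rho> nu \<beta>) (line (Dk k T))"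
proof -
  let ?I = "induced triv lam \<alpha>" and ?I' = "induced \<rho> nu \<beta>"
  let ?S = "\<lambda>c. symbol_op lam \<alpha> k (\<lambda>p. c *s T p)"
  have T': "pol_linear k T" using T by (simp add: poly_iso_alt)
  have lin: "pol_linear k (\<lambda>p. c *s T p)" for c
    using T' by (simp add: pol_linear_def vector_add_ldistrib vector_smult_assoc mult.commute)
  have "levi_equivariant \<alpha> \<beta> k \<rho> T" unfolding \<beta> by (rule poly_iso_levi_equivariant[OF \<rho> norm T \<alpha>])
  then have "levi_equivariant \<alpha> \<beta> k \<rho> (\<lambda>p. c *s T p)" for c
    unfolding levi_equivariant_def by (simp add: vec.scale vector_smult_assoc mult.left_commute)
      (metis (no_types, lifting) mult.commute vector_smult_assoc)
  then have mem: "?S c \<in> Diff_G ?I ?I'" for c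
    using lin nu k by (intro symbol_op_in_Diff_G[OF \<rho>]) auto
  have all: "\<exists>c. D = ?S c" if "D \<in> Diff_G ?I ?I'" for D
  proof -
    obtain k' l where l: "pol_linear k' l" "D = symbol_op lam \<alpha> k' l" and c: "(\<forall>p. l p = 0) \<or>
        (\<exists>p\<in>Pol k'. l p \<noteq> 0) \<and> levi_equivariant \<alpha> \<beta> k' \<rho> l \<and> (k' = 0 \<or> lam = 1 - of_nat k') \<and>
        nu = lam + of_nat k' * (1 + 1 / of_nat CARD('m))"
      using Diff_G_eq_symbol_op[OF \<rho> \<alpha> \<open>D \<in> _\<close>] by blast
    from c show ?thesis
    proof
      assume "\<forall>p. l p = 0"
      then have "D = ?S 0" unfolding l(2) by (intro symbol_op_zero) auto
      then show ?thesis ..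
    next
      assume c: "(\<exists>p\<in>Pol k'. l p \<noteq> 0) \<and> levi_equivariant \<alpha> \<beta> k' \<rho> l \<and> (k' = 0 \<or> lam = 1 - of_nat k') \<and>
        nu = lam + of_nat k' * (1 + 1 / of_nat CARD('m))"
      then have "nu = lam + of_nat k' * (1 + 1 / of_nat CARD('m))" by blast
      then have kk: "k' = k" using nu by (intro order_unique[OF trans[OF sym]])
      then have "pol_equivariant SL k \<rho> l" using c levi_equivariant_SL by blast
      then obtain c where "\<forall>p\<in>Pol k. l p = c *s T p" using equivariant_unique[OF T] l(1) kk by blast
      then have "D = ?S c" unfolding l(2) kk by (intro symbol_op_cong) auto
      then show ?thesis ..
    qed
  qed
  have oc: "on_cell ?I (?S c) = restrict (\<lambda>\<phi> x. c *s Dk k T \<phi> x) Cinf" for c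
    unfolding on_cell_symbol_op[OF lin \<alpha>]
    by (intro restrict_ext ext) (simp add: Dk_def vec.scale_sum_right vector_smult_assoc mult.commute)
  have "inj_on (on_cell ?I) (Diff_G ?I ?I')"
  proof (rule inj_onI)
    fix D1 D2 assume D: "D1 \<in> Diff_G ?I ?I'" "D2 \<in> Diff_G ?I ?I'" "on_cell ?I D1 = on_cell ?I D2"
    obtain c1 c2 where c: "D1 = ?S c1" "D2 = ?S c2" using all D by blast
    have "restrict (Dk k (\<lambda>p. c1 *s T p)) Cinf = restrict (Dk k (\<lambda>p. c2 *s T p)) Cinf"
      using D(3) unfolding c on_cell_symbol_op[OF lin \<alpha>] .
    then have eq: "?S c1 f (g ** nminus 0) = ?S c2 f (g ** nminus 0)" if "f \<in> ?I" "g \<in> SL" for f g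
      unfolding symbol_op_eq_Dk[OF lin that] by simp
    show "D1 = D2"
    proof (intro ext)
      fix f g
      show "D1 f g = D2 f g"
        using eq[of f g] unfolding c by (cases "f \<in> ?I \<and> g \<in> SL") (auto simp: symbol_op_def)
    qed
  qed
  moreover have "on_cell ?I ` Diff_G ?I ?I' = line (Dk k T)"
  proof -
    have "Diff_G ?I ?I' = range ?S" using all mem by blast
    then show ?thesis by (auto simp: line_def oc image_image)
  qed
  ultimately show ?thesis by (simp add: Diff_G_equals_def bij_betw_def)
qed

lemma triv_iso_imp_poly_iso:
  fixes \<rho> :: "'m::finite rmat \<Rightarrow> complex^'d^'d"
  assumes A: "rep_iso SL triv \<rho> A"
  shows "poly_iso SL 0 \<rho> (\<lambda>p. A *v (\<chi> i. p 0))"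
  unfolding poly_iso_alt
proof (intro conjI)
  have b: "bij ((*v) A)" and eq: "\<And>g. g \<in> SL \<Longrightarrow> A = \<rho> g ** A"
    using A by (auto simp: rep_iso_def triv_def)
  show "bij_betw (\<lambda>p :: 'm cspace \<Rightarrow> complex. A *v (\<chi> i. p 0)) (Pol 0) UNIV"
  proof (rule bij_betw_imageI)
    show "inj_on (\<lambda>p :: 'm cspace \<Rightarrow> complex. A *v (\<chi> i. p 0)) (Pol 0)"
    proof (rule inj_onI)
      fix p q :: "'m cspace \<Rightarrow> complex"
      assume "p \<in> Pol 0" "q \<in> Pol 0" and e: "A *v (\<chi> i. p 0) = A *v (\<chi> i. q 0)"
      moreover have "(\<chi> i. p 0) = ((\<chi> i. q 0) :: complex^1)" by (rule injD[OF bij_is_inj[OF b] e])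
      ultimately show "p = q" by (auto simp: Pol_0 vec_eq_iff)
    qed
    have "v \<in> (\<lambda>p :: 'm cspace \<Rightarrow> complex. A *v (\<chi> i. p 0)) ` Pol 0" for v
    proof -
      obtain u where u: "v = A *v u" using bij_is_surj[OF b] by (metis surjD)
      have "(\<chi> i. u $ 1) = u" by (simp add: vec_eq_iff)
      then show ?thesis using u by (intro image_eqI[of _ _ "\<lambda>y. u $ 1"]) (auto simp: Pol_0)
    qed
    then show "(\<lambda>p :: 'm cspace \<Rightarrow> complex. A *v (\<chi> i. p 0)) ` Pol 0 = UNIV" by auto
  qed
  show "pol_linear 0 (\<lambda>p :: 'm cspace \<Rightarrow> complex. A *v (\<chi> i. p 0))"
    by (simp add: pol_linear_def vec_eq_iff matrix_vector_mult_def distrib_left mult.left_commute)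
  show "pol_equivariant SL 0 \<rho> (\<lambda>p :: 'm cspace \<Rightarrow> complex. A *v (\<chi> i. p 0))"
    unfolding pol_equivariant_def
  proof (intro ballI)
    fix g :: "'m rmat" and p :: "'m cspace \<Rightarrow> complex" assume g: "g \<in> SL" and "p \<in> Pol 0"
    then have "poly_act g p 0 = p 0" by (auto simp: Pol_0 poly_act_def)
    then show "A *v (\<chi> i. poly_act g p 0) = \<rho> g *v (A *v (\<chi> i. p 0))"
      using eq[OF g] by (simp add: matrix_vector_mul_assoc)
  qed
qed

lemma poly_iso_0_imp_triv_iso:
  fixes \<rho> :: "'m::finite rmat \<Rightarrow> complex^'d^'d"
  assumes T: "poly_iso SL 0 \<rho> T"
  shows "\<exists>A. rep_iso SL triv \<rho> A"
proof -
  have T': "pol_linear 0 T" "inj_on T (Pol 0)" "T ` Pol 0 = UNIV" "pol_equivariant SL 0 \<rho> T"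
    using T by (auto simp: poly_iso_alt bij_betw_def)
  define w where "w = T (\<lambda>y. 1)"
  have one: "(\<lambda>y. 1) \<in> Pol 0" by (auto simp: Pol_0)
  have Tc: "T (\<lambda>y. c) = c *s w" for c using pol_linear_cmult[OF T'(1) one, of c] by (simp add: w_def)
  define A :: "complex^1^'d" where "A = (\<chi> i j. w $ i)"
  have A: "A *v u = T (\<lambda>y. u $ 1)" for u
    by (simp add: Tc A_def matrix_vector_mult_def vec_eq_iff mult.commute)
  have "bij ((*v) A)"
    unfolding bij_def
  proof
    show "inj ((*v) A)"
    proof (rule injI)
      fix u v :: "complex^1" assume "A *v u = A *v v"
      then have "(\<lambda>y :: 'm cspace. u $ 1) = (\<lambda>y. v $ 1)"
        unfolding A by (intro inj_onD[OF T'(2)]) (auto simp: Pol_0)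
      then show "u = v" by (simp add: fun_eq_iff vec_eq_iff)
    qed
    have "\<exists>u. v = A *v u" for v
    proof -
      obtain p where "p \<in> Pol 0" "v = T p" using T'(3) by (metis UNIV_I imageE)
      then obtain c where "v = T (\<lambda>y. c)" by (auto simp: Pol_0)
      then show ?thesis unfolding A by (intro exI[of _ "\<chi> i. c"]) simp
    qed
    then show "surj ((*v) A)" by (auto simp: surj_def)
  qed
  moreover have "A ** triv g = \<rho> g ** A" if g: "g \<in> SL" for g
  proof -
    have "\<rho> g *v w = w" using pol_equivariantD[OF T'(4) g one] by (simp add: w_def poly_act_def)
    then have "(\<rho> g ** A) $ i $ j = A $ i $ j" for i j
      by (simp add: matrix_matrix_mult_def A_def matrix_vector_mult_def vec_eq_iff)
    then show ?thesis by (simp add: triv_def vec_eq_iff)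
  qed
  ultimately show ?thesis unfolding rep_iso_def by blast
qed

theorem theorem4p5:
  fixes \<rho> :: "real^'m::{finite,linorder}^'m::{finite,linorder} \<Rightarrow> complex^'d^'d"
    and \<alpha> \<beta> :: int and lam nu :: complex
  assumes "\<alpha> \<in> {1, -1}" and "\<beta> \<in> {1, -1}"
    and "representation_on SLpm \<rho>"
    and "irreducible_on SL \<rho>"
    and "normalized_extension \<rho>"
  shows
    "(\<forall>A. \<beta> = \<alpha> \<and> rep_iso SL triv \<rho> A \<and> nu = lam \<longrightarrow>
        Diff_G_equals (induced triv lam \<alpha>) (induced \<rho> nu \<beta>) (line (\<lambda>\<phi> x. A *v \<phi> x))) \<and>
     (\<forall>k T. (\<alpha>, \<beta>, \<rho>, lam, nu) \<in> Lambda_G \<and> lam = 1 - of_nat k \<and>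
        nu = 1 + of_nat k / of_nat CARD('m) \<and> poly_iso SL k \<rho> T \<longrightarrow>
        Diff_G_equals (induced triv lam \<alpha>) (induced \<rho> nu \<beta>) (line (Dk k T))) \<and>
     (\<not> (\<beta> = \<alpha> \<and> (\<exists>A. rep_iso SL triv \<rho> A) \<and> nu = lam) \<and> (\<alpha>, \<beta>, \<rho>, lam, nu) \<notin> Lambda_G \<longrightarrow>
        Diff_G_equals (induced triv lam \<alpha>) (induced \<rho> nu \<beta>) {restrict (\<lambda>\<phi> x. 0) Cinf})"
proof (intro conjI allI impI)
  note \<alpha> = assms(1) and \<beta> = assms(2) and \<rho> = assms(3) and irr = assms(4) and norm = assms(5)
  let ?I = "induced triv lam \<alpha>" and ?I' = "induced \<rho> nu \<beta>"
  {
    fix A :: "complex^1^'d" assume A: "\<beta> = \<alpha> \<and> rep_iso SL triv \<rho> A \<and> nu = lam"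
    \<comment> \<open>This is the case of order \<open>0\<close>: the trivial representation is $\mathrm{Pol}^0$.\<close>
    let ?T = "\<lambda>p :: complex^'m::{finite,linorder} \<Rightarrow> complex. A *v (\<chi> i. p 0)"
    have "Dk 0 ?T \<phi> x = A *v \<phi> x" if "\<phi> \<in> Cinf" for \<phi> x
    proof -
      have "Dk 0 ?T \<phi> x = \<phi> x $ 1 *s (A *v (\<chi> i. 1))"
        unfolding Dk_eq_sum[OF that] Xi_0 by (simp add: dmono_def monomial_def)
      then show ?thesis by (simp add: vec_eq_iff matrix_vector_mult_def mult.commute)
    qed
    then have "line (Dk 0 ?T) = line (\<lambda>\<phi> x. A *v \<phi> x)"
      unfolding line_def by (intro Collect_cong ex_cong1) (auto intro!: arg_cong2[where f = "(=)"] restrict_ext)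
    moreover have "Diff_G_equals ?I ?I' (line (Dk 0 ?T))"
      using A by (intro Diff_G_line[OF \<alpha> \<rho> norm triv_iso_imp_poly_iso]) (auto simp: target_sign_def)
    ultimately show "Diff_G_equals ?I ?I' (line (\<lambda>\<phi> x. A *v \<phi> x))" by simp
  next
    fix k T assume k: "(\<alpha>, \<beta>, \<rho>, lam, nu) \<in> Lambda_G \<and> lam = 1 - of_nat k \<and>
        nu = 1 + of_nat k / of_nat CARD('m) \<and> poly_iso SL k \<rho> T"
    then obtain k' where "\<beta> = target_sign TYPE('m) \<alpha> k'" "lam = 1 - of_nat k'"
      unfolding Lambda_G_def by blast
    then have "\<beta> = target_sign TYPE('m) \<alpha> k" using k by simp
    then show "Diff_G_equals ?I ?I' (line (Dk k T))"
      using k by (intro Diff_G_line[OF \<alpha> \<rho> norm]) (auto simp: ring_distribs)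
  next
    assume no: "\<not> (\<beta> = \<alpha> \<and> (\<exists>A. rep_iso SL triv \<rho> A) \<and> nu = lam) \<and> (\<alpha>, \<beta>, \<rho>, lam, nu) \<notin> Lambda_G"
    let ?z = "\<lambda>p :: complex^'m::{finite,linorder} \<Rightarrow> complex. 0 :: complex^'d"
    let ?Z = "symbol_op lam \<alpha> 0 ?z"
    have z: "pol_linear 0 ?z" by (simp add: pol_linear_def)
    have "D = ?Z" if "D \<in> Diff_G ?I ?I'" for D
    proof -
      obtain k l where l: "pol_linear k l" "D = symbol_op lam \<alpha> k l" and c: "(\<forall>p. l p = 0) \<or>
          (\<exists>p\<in>Pol k. l p \<noteq> 0) \<and> levi_equivariant \<alpha> \<beta> k \<rho> l \<and> (k = 0 \<or> lam = 1 - of_nat k) \<and>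
          nu = lam + of_nat k * (1 + 1 / of_nat CARD('m))"
        using Diff_G_eq_symbol_op[OF \<rho> \<alpha> \<open>D \<in> _\<close>] by blast
      have "\<forall>p. l p = 0"
      proof (rule ccontr)
        assume "\<not> ?thesis"
        with c obtain p where p: "p \<in> Pol k" "l p \<noteq> 0" and c: "levi_equivariant \<alpha> \<beta> k \<rho> l"
          "k = 0 \<or> lam = 1 - of_nat k" "nu = lam + of_nat k * (1 + 1 / of_nat CARD('m))" by blast
        have iso: "poly_iso SL k \<rho> l"
          by (rule equivariant_nonzero_imp_iso[OF l(1) levi_equivariant_SL[OF c(1)] irr p])
        have sgn: "\<beta> = target_sign TYPE('m) \<alpha> k"
          by (rule levi_equivariant_sign[OF \<rho> norm iso \<alpha> \<beta> c(1)])
        show False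
        proof (cases "k = 0")
          case True
          then have "\<beta> = \<alpha>" "nu = lam" "\<exists>A. rep_iso SL triv \<rho> A"
            using sgn c(3) poly_iso_0_imp_triv_iso[of \<rho> l] iso by (auto simp: target_sign_def)
          then show False using no by blast
        next
          case False
          then have lam: "lam = 1 - of_nat k" using c(2) by simp
          then have "nu = 1 + of_nat k / of_nat CARD('m)" using c(3) by (simp add: ring_distribs)
          then have "(\<alpha>, \<beta>, \<rho>, lam, nu) \<in> Lambda_G"
            unfolding Lambda_G_def mem_Collect_eq
            by (intro exI[of _ \<alpha>] exI[of _ k] exI[of _ \<rho>]) (use sgn lam \<alpha> iso in auto)
          then show False using no by blast
        qed
      qed
      then show ?thesis unfolding l(2) by (intro symbol_op_zero) auto
    qed
    moreover have "?Z \<in> Diff_G ?I ?I'" by (rule symbol_op_in_Diff_G[OF \<rho> z]) simp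
    ultimately have "Diff_G ?I ?I' = {?Z}" by blast
    moreover have "on_cell ?I ?Z = restrict (\<lambda>\<phi> x. 0) Cinf"
      unfolding on_cell_symbol_op[OF z \<alpha>] by (intro restrict_ext ext) (simp add: Dk_def)
    ultimately show "Diff_G_equals ?I ?I' {restrict (\<lambda>\<phi> x. 0) Cinf}"
      by (simp add: Diff_G_equals_def bij_betw_def)
  }
qed

end
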